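(* Let $J$ be a Jacobi matrix with off-diagonal $(\rho_n)_{n=0}^\infty$ and diagonal $(q_n)_{n=0}^\infty$ ($\rho_n>0$, $q_n\in\mathbb{R}$). Suppose that there are $\epsilon>0$, $\beta_1,\beta_2\in\mathbb{R}$, $x_0>0$, $y_0\in\mathbb{R}\setminus\{0\}$ and $x_1,y_1\in\mathbb{R}$ such that, as $n\to\infty$, $$\rho_n=n^{\beta_1}\Big(x_0+\frac{x_1}{n}+\mathrm{O}\Big(\frac{1}{n^{1+\epsilon}}\Big)\Big),\qquad q_n=n^{\beta_2}\Big(y_0+\frac{y_1}{n}+\mathrm{O}\Big(\frac{1}{n^{1+\epsilon}}\Big)\Big).$$ Then the following hold. (i) If $\beta_1\le\beta_2$, and moreover $2x_0<|y_0|$ in case $\beta_1=\beta_2$, then $J$ is in the limit point case. (ii) If $\beta_1\ge\beta_2$, and moreover $2x_0>|y_0|$ in case $\beta_1=\beta_2$, then $J$ is in the limit circle case if and only if $\beta_1>1$. Moreover, if (under the assumptions of (i) or (ii)) $J$ is in the limit circle case, then the convergence exponent of the spectrum $\sigma(J)$ is $1/\beta_1$, and the upper density of the spectrum satisfies $$\frac{\beta_1-1}{\beta_1}\Big(\frac{1}{x_0}\Big)^{1/\beta_1}\le\limsup_{r\to\infty}\frac{n_\sigma(r)}{r^{1/\beta_1}}\le e\,\frac{\beta_1}{\beta_1-1}\Big(\frac{a}{x_0}\Big)^{1/\beta_1},$$ where $n_\sigma(r):=\#(\sigma(J)\cap[-r,r])$, and $$a:=\begin{cases}1, & \beta_1>\beta_2,\\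 \Big(1-\dfrac{y_0^2}{4x_0^2}\Big)^{-1/2}, & \beta_1=\beta_2.\end{cases}$$
   Context: A Jacobi matrix $J$ with off-diagonal $(\rho_n)_{n=0}^\infty$ and diagonal $(q_n)_{n=0}^\infty$ is the semi-infinite symmetric tridiagonal matrix $$J=\begin{pmatrix} q_0&\rho_0&&\\ \rho_0&q_1&\rho_1&\\ &\rho_1&q_2&\ddots\\ &&\ddots&\ddots\end{pmatrix}$$ with real $q_n$ and positive $\rho_n$. It induces a closed symmetric operator $T_J$ on $\ell^2(\mathbb{N})$ (sequences indexed by $n=0,1,2,\dots$), namely the closure of the natural action of $J$ on the subspace of finitely supported sequences. Exactly one of the following occurs: $T_J$ is selfadjoint, in which case $J$ is said to be in the limit point case; or $T_J$ has defect index $(1,1)$, in which case $J$ is said to be in the limit circle case. If $J$ is in the limit circle case, then the spectrum of every canonical selfadjoint extension of $T_J$ (i.e. every selfadjoint extension acting in the same space $\ell^2(\mathbb{N})$) is discrete, and the spectra of any two such extensions interlace. One such extension is fixed (arbitrarily), and $\sigma(J)$ denotes its spectrum. The convergence exponent of $\sigma(J)$ is the infimum of all $\alpha>0$ such that $\sum_{\lambda\in\sigma(J),\,\lambda\ne0}|\lambda|^{-\alpha}<\infty$. *)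

theory Defs
  imports
    "HOL-Analysis.Analysis"
    "HOL-Library.Function_Algebras"
    "HOL-Library.Landau_Symbols"
begin

section \<open>The Hilbert space of square summable sequences\<close>

type_synonym cseq = "nat \<Rightarrow> complex"

definition ell2 :: "cseq set" where
  "ell2 = {u. summable (\<lambda>n. (cmod (u n))\<^sup>2)}"

text \<open>The inner product is linear in its first argument.\<close>

definition ell2_inner :: "cseq \<Rightarrow> cseq \<Rightarrow> complex" where
  "ell2_inner u v = (\<Sum>n. u n * cnj (v n))"

definition ell2_norm :: "cseq \<Rightarrow> real" where
  "ell2_norm u = sqrt (\<Sum>n. (cmod (u n))\<^sup>2)"

definition cseq_scale :: "complex \<Rightarrow> cseq \<Rightarrow> cseq" where
  "cseq_scale c u = (\<lambda>n. c * u n)"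

interpretation cseq: vector_space cseq_scale
  by unfold_locales (auto simp: cseq_scale_def fun_eq_iff algebra_simps)


section \<open>Unbounded operators\<close>

text \<open>
  An operator in \<open>ell2\<close> is represented by its graph, the set of all pairs \<open>(u, v)\<close> such that
  \<open>u\<close> lies in its domain and is mapped to \<open>v\<close>. Hence \<open>Domain T\<close> is the domain of \<open>T\<close>, and
  \<open>T \<subseteq> A\<close> says that \<open>A\<close> extends \<open>T\<close>.
\<close>

type_synonym oper = "(cseq \<times> cseq) set"

definition op_closure :: "oper \<Rightarrow> oper" where
  "op_closure T = {(u, v). u \<in> ell2 \<and> v \<in> ell2 \<and>
     (\<exists>x y. (\<forall>k. (x k, y k) \<in> T) \<and>
        (\<lambda>k. ell2_norm (x k - u)) \<longlonglongrightarrow> 0 \<and> (\<lambda>k. ell2_norm (y k - v)) \<longlonglongrightarrow> 0)}"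

definition densely_defined :: "oper \<Rightarrow> bool" where
  "densely_defined T \<longleftrightarrow>
     (\<forall>u\<in>ell2. \<forall>e>0. \<exists>x\<in>Domain T. x \<in> ell2 \<and> ell2_norm (x - u) < e)"

definition op_adjoint :: "oper \<Rightarrow> oper" where
  "op_adjoint T = {(v, w). v \<in> ell2 \<and> w \<in> ell2 \<and>
     (\<forall>(x, y)\<in>T. ell2_inner y v = ell2_inner x w)}"

text \<open>
  An adjoint consists of pairs in \<open>ell2\<close> and is closed under linear combinations, and it is
  single-valued if the original domain is dense. So the following condition already forces \<open>A\<close>
  to be the graph of a linear operator in \<open>ell2\<close>.
\<close>

definition selfadjoint :: "oper \<Rightarrow> bool" where
  "selfadjoint A \<longleftrightarrow> densely_defined A \<and> op_adjoint A = A"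

definition op_kernel :: "oper \<Rightarrow> complex \<Rightarrow> cseq set" where
  "op_kernel T z = {u. (u, cseq_scale z u) \<in> T}"

text \<open>
  The defect numbers are the dimensions of the kernels of \<open>T\<^sup>* - \<i>\<close> and \<open>T\<^sup>* + \<i>\<close>. The function
  \<open>cseq.dim\<close> returns 0 on infinite-dimensional spaces, so an entry 0 of the pair is ambiguous
  whereas a positive entry is the true dimension.
\<close>

definition defect_index :: "oper \<Rightarrow> nat \<times> nat" where
  "defect_index T =
     (cseq.dim (op_kernel (op_adjoint T) \<i>), cseq.dim (op_kernel (op_adjoint T) (- \<i>)))"

definition resolvent_set :: "oper \<Rightarrow> complex set" where
  "resolvent_set A = {z.
     (\<forall>w\<in>ell2. \<exists>!u. (u, w + cseq_scale z u) \<in> A) \<and>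
     (\<exists>C. \<forall>(u, v)\<in>A. ell2_norm u \<le> C * ell2_norm (v - cseq_scale z u))}"

definition spectrum :: "oper \<Rightarrow> complex set" where
  "spectrum A = - resolvent_set A"


section \<open>Jacobi matrices\<close>

definition jacobi_entry :: "(nat \<Rightarrow> real) \<Rightarrow> (nat \<Rightarrow> real) \<Rightarrow> nat \<Rightarrow> nat \<Rightarrow> real" where
  "jacobi_entry \<rho> q i j =
     (if i = j then q i else if j = Suc i then \<rho> i else if i = Suc j then \<rho> j else 0)"

definition finsupp :: "cseq set" where
  "finsupp = {u. finite {n. u n \<noteq> 0}}"

definition jacobi_apply :: "(nat \<Rightarrow> real) \<Rightarrow> (nat \<Rightarrow> real) \<Rightarrow> cseq \<Rightarrow> cseq" where
  "jacobi_apply \<rho> q u = (\<lambda>i. \<Sum>j | u j \<noteq> 0. complex_of_real (jacobi_entry \<rho> q i j) * u j)"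

definition jacobi_op :: "(nat \<Rightarrow> real) \<Rightarrow> (nat \<Rightarrow> real) \<Rightarrow> oper" where
  "jacobi_op \<rho> q = op_closure {(u, jacobi_apply \<rho> q u) | u. u \<in> finsupp}"

definition limit_point :: "(nat \<Rightarrow> real) \<Rightarrow> (nat \<Rightarrow> real) \<Rightarrow> bool" where
  "limit_point \<rho> q \<longleftrightarrow> selfadjoint (jacobi_op \<rho> q)"

definition limit_circle :: "(nat \<Rightarrow> real) \<Rightarrow> (nat \<Rightarrow> real) \<Rightarrow> bool" where
  "limit_circle \<rho> q \<longleftrightarrow> defect_index (jacobi_op \<rho> q) = (1, 1)"

definition canonical_extension :: "(nat \<Rightarrow> real) \<Rightarrow> (nat \<Rightarrow> real) \<Rightarrow> oper \<Rightarrow> bool" where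
  "canonical_extension \<rho> q A \<longleftrightarrow> selfadjoint A \<and> jacobi_op \<rho> q \<subseteq> A"


section \<open>Distribution of the spectrum\<close>

text \<open>The infimum is taken in \<open>ereal\<close>, where it is \<open>\<infinity>\<close> if no exponent is admissible.\<close>

definition convergence_exponent :: "complex set \<Rightarrow> ereal" where
  "convergence_exponent S =
     Inf {ereal \<alpha> | \<alpha>. \<alpha> > 0 \<and> (\<lambda>z. cmod z powr (- \<alpha>)) summable_on (S - {0})}"

definition counting_fun :: "complex set \<Rightarrow> real \<Rightarrow> ereal" where
  "counting_fun S r =
     (let N = S \<inter> complex_of_real ` {-r..r}
      in if finite N then ereal (real (card N)) else \<infinity>)"

definition upper_density :: "complex set \<Rightarrow> real \<Rightarrow> ereal" where
  "upper_density S \<gamma> = Limsup at_top (\<lambda>r. counting_fun S r / ereal (r powr \<gamma>))"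

end

theory Submission
  imports
    Defs
    "HOL-Complex_Analysis.Great_Picard"
    "HOL-Computational_Algebra.Fundamental_Theorem_Algebra"
    "HOL-Real_Asymp.Real_Asymp"
begin

text \<open>
  Everything is read off from the solutions \<open>p(z)\<close> of the three-term recurrence; \<open>J\<close> is in the limit
  circle case iff \<open>p(\<i>)\<close> is square summable, and otherwise \<open>T\<^sub>J\<close> is selfadjoint.

  The scaled solutions \<open>n\<^sup>\<beta>\<^sup>/\<^sup>2 u\<^sub>n\<close> satisfy a recurrence whose coefficients have bounded variation. If it
  is elliptic in the limit, a quadratic form in two consecutive terms is almost conserved; this bounds
  the solutions of \<open>Ju = v\<close> with the sharp constant \<open>a / x\<^sub>0\<close>. As a consequence the unit ball in
  the graph norm of a selfadjoint extension \<open>A\<close> is relatively compact, and the spectrum consists of simple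
  eigenvalues.

  Upper bound: cut the indices beyond \<open>N\<close> into blocks on which \<open>\<Sum> k\<^sup>-\<^sup>\<beta>\<close> is of order \<open>1 / r\<close>. A vector in the
  domain of \<open>A\<close> that vanishes on \<open>{0..N}\<close> and at the first two indices of every block satisfies
  \<open>\<parallel>Au\<parallel> > r \<parallel>u\<parallel>\<close>, so the number of these conditions bounds the number of eigenvalues in \<open>[-r, r]\<close>.

  Lower bound: by a minimum principle for \<open>\<parallel>Au\<parallel> / \<parallel>u\<parallel>\<close>, the polynomial \<open>p\<^sub>n\<close> has at most one zero more in
  \<open>[-r, r]\<close> than \<open>A\<close> has eigenvalues there. On the other hand the zeros cannot be sparse, since
  \<open>\<Prod>\<bar>\<i> - z\<bar> = \<bar>p\<^sub>n(\<i>)\<bar> \<rho>\<^sub>0 \<dots> \<rho>\<^sub>n\<^sub>-\<^sub>1\<close> with \<open>p\<^sub>n(\<i>)\<close> bounded.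
\<close>

section \<open>The space of square summable sequences as a Hilbert space\<close>

text \<open>The extension A is arbitrary and known only to lie between the minimal operator and its
  adjoint. So the estimates are proved on the whole maximal domain, and eigenvalues are counted by
  comparing dimensions with numbers of linear conditions. In the scaled recurrence the diagonal
  coefficient \<gamma> tends to 0 if \<beta>_2 < \<beta>_1 and to y_0 if the exponents agree. The
  limiting quadratic form has discriminant c = x_0^2 - (lim \<gamma>)^2 / 4, and 1 / sqrt c = a /
  x_0. The upper bound costs about N conditions for the initial segment and two per block. The best
  choice is N^\<beta> = 2 \<kappa> r, with total about \<beta> / (\<beta> - 1) (2 \<kappa>
  r)^(1/\<beta>), for any \<kappa> > a / x_0. For the lower bound, if the counting function stays
  below L t^(1/\<beta>), the product of the |i - z| is at least of order (n!)^\<beta> L^(-\<beta>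
  n), up to a fixed power of n, while the product of the \<rho>_k is at most C (n!)^\<beta> Y^n for
  any Y > x_0. Hence L^(-\<beta>) \<le> x_0; the factor (\<beta> - 1) / \<beta> in the claim is pure
  slack.\<close>

lemma summable_prod_of_ell2:
  assumes "u \<in> ell2" "v \<in> ell2"
  shows "summable (\<lambda>n. cmod (u n) * cmod (v n))"
proof (rule summable_comparison_test')
  show "summable (\<lambda>n. (cmod (u n))\<^sup>2 + (cmod (v n))\<^sup>2)"
    using assms by (auto simp: ell2_def intro: summable_add)
  show "norm (cmod (u n) * cmod (v n)) \<le> (cmod (u n))\<^sup>2 + (cmod (v n))\<^sup>2" if "n \<ge> 0" for n
  proof -
    have "2 * (cmod (u n) * cmod (v n)) \<le> (cmod (u n))\<^sup>2 + (cmod (v n))\<^sup>2"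
      using sum_squares_bound[of "cmod (u n)" "cmod (v n)"] by (simp add: mult.assoc)
    moreover have "0 \<le> cmod (u n) * cmod (v n)" by simp
    ultimately show ?thesis unfolding real_norm_def by linarith
  qed
qed

lemma summable_ell2_inner:
  assumes "u \<in> ell2" "v \<in> ell2"
  shows "summable (\<lambda>n. u n * cnj (v n))"
  by (rule summable_norm_cancel) (use summable_prod_of_ell2[OF assms] in \<open>simp add: norm_mult\<close>)

lemma ell2_add: assumes "u \<in> ell2" "v \<in> ell2" shows "u + v \<in> ell2"
proof -
  have "summable (\<lambda>n. 2 * (cmod (u n))\<^sup>2 + 2 * (cmod (v n))\<^sup>2)"
    using assms by (auto simp: ell2_def intro!: summable_add summable_mult)
  moreover have "(cmod (u n + v n))\<^sup>2 \<le> 2 * (cmod (u n))\<^sup>2 + 2 * (cmod (v n))\<^sup>2" for n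
  proof -
    have "(cmod (u n + v n))\<^sup>2 \<le> (cmod (u n) + cmod (v n))\<^sup>2"
      by (intro power_mono norm_triangle_ineq) auto
    then show ?thesis
      using sum_squares_bound[of "cmod (u n)" "cmod (v n)"] by (simp add: power2_sum)
  qed
  ultimately show ?thesis
    unfolding ell2_def by (auto intro: summable_comparison_test')
qed

lemma ell2_scale: "u \<in> ell2 \<Longrightarrow> cseq_scale c u \<in> ell2"
  by (auto simp: ell2_def cseq_scale_def norm_mult power_mult_distrib intro: summable_mult)

lemma ell2_zero: "0 \<in> ell2"
  by (simp add: ell2_def)

lemma ell2_uminus: "u \<in> ell2 \<Longrightarrow> - u \<in> ell2"
  by (simp add: ell2_def)

lemma ell2_minus: "u \<in> ell2 \<Longrightarrow> v \<in> ell2 \<Longrightarrow> u - v \<in> ell2"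
  using ell2_add[of u "- v"] ell2_uminus[of v] by simp

lemma finsupp_subset_ell2: "finsupp \<subseteq> ell2"
proof
  fix u :: cseq assume "u \<in> finsupp"
  then show "u \<in> ell2"
    unfolding ell2_def finsupp_def by (auto intro!: summable_finite[of "{n. u n \<noteq> 0}"])
qed

text \<open>As a type of its own the space can be made a real Hilbert space, so that limits,
  closures and Cauchy sequences come from the type classes. The complex structure is carried along
  by \<open>scaleC\<close> and \<open>cinner\<close>, whose real part is the class operation
  \<open>inner\<close>.\<close>

typedef l2 = ell2 morphisms seq_of l2_of
  using ell2_zero by blast

setup_lifting type_definition_l2

instantiation l2 :: ab_group_add
begin
lift_definition zero_l2 :: l2 is 0 by (rule ell2_zero)
lift_definition plus_l2 :: "l2 \<Rightarrow> l2 \<Rightarrow> l2" is "(+)" by (rule ell2_add)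
lift_definition uminus_l2 :: "l2 \<Rightarrow> l2" is uminus by (rule ell2_uminus)
lift_definition minus_l2 :: "l2 \<Rightarrow> l2 \<Rightarrow> l2" is "(-)" by (rule ell2_minus)
instance by standard (transfer; simp)+
end

lift_definition scaleC :: "complex \<Rightarrow> l2 \<Rightarrow> l2" (infixr \<open>*\<^sub>C\<close> 75) is cseq_scale
  by (rule ell2_scale)

lift_definition cinner :: "l2 \<Rightarrow> l2 \<Rightarrow> complex" is ell2_inner .

lemma seq_of_simps [simp]:
  "seq_of 0 n = 0" "seq_of (x + y) n = seq_of x n + seq_of y n"
  "seq_of (x - y) n = seq_of x n - seq_of y n" "seq_of (- x) n = - seq_of x n"
  "seq_of (c *\<^sub>C x) n = c * seq_of x n"
  by (transfer; simp add: cseq_scale_def)+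

lemma l2_eqI: "(\<And>n. seq_of x n = seq_of y n) \<Longrightarrow> x = y"
  by (metis ext seq_of_inject)

lemma summable_cinner: "summable (\<lambda>n. seq_of x n * cnj (seq_of y n))"
  by (rule summable_ell2_inner) (rule seq_of)+

lemma summable_norm2: "summable (\<lambda>n. (cmod (seq_of x n))\<^sup>2)"
  using seq_of[of x] by (simp add: ell2_def)

lemma cinner_def': "cinner x y = (\<Sum>n. seq_of x n * cnj (seq_of y n))"
  by transfer (simp add: ell2_inner_def)

lemma cinner_add_left: "cinner (x + y) z = cinner x z + cinner y z"
  unfolding cinner_def' by (subst suminf_add[OF summable_cinner summable_cinner]) (simp add: algebra_simps)

lemma cinner_scaleC_left: "cinner (c *\<^sub>C x) y = c * cinner x y"
  unfolding cinner_def' by (subst suminf_mult[OF summable_cinner, symmetric]) (simp add: algebra_simps)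

lemma cinner_commute: "cinner x y = cnj (cinner y x)"
proof -
  have "(\<lambda>n. cnj (seq_of y n * cnj (seq_of x n))) sums cnj (cinner y x)"
    unfolding cinner_def' using summable_sums[OF summable_cinner[of y x]] by (subst sums_cnj)
  then have "(\<lambda>n. seq_of x n * cnj (seq_of y n)) sums cnj (cinner y x)"
    by (simp add: mult.commute)
  then show ?thesis
    unfolding cinner_def' by (simp add: sums_iff)
qed

lemma cinner_self: "cinner x x = complex_of_real (\<Sum>n. (cmod (seq_of x n))\<^sup>2)"
  unfolding cinner_def'
  by (subst suminf_of_real[OF summable_norm2]) (simp only: complex_norm_square)

instantiation l2 :: real_inner
begin
definition scaleR_l2 :: "real \<Rightarrow> l2 \<Rightarrow> l2" where "scaleR_l2 r x = complex_of_real r *\<^sub>C x"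
definition inner_l2 :: "l2 \<Rightarrow> l2 \<Rightarrow> real" where "inner_l2 x y = Re (cinner x y)"
definition norm_l2 :: "l2 \<Rightarrow> real" where "norm_l2 x = sqrt (inner x x)"
definition dist_l2 :: "l2 \<Rightarrow> l2 \<Rightarrow> real" where "dist_l2 x y = norm (x - y)"
definition sgn_l2 :: "l2 \<Rightarrow> l2" where "sgn_l2 x = inverse (norm x) *\<^sub>R x"
definition uniformity_l2 :: "(l2 \<times> l2) filter" where
  "uniformity_l2 = (INF e\<in>{0<..}. principal {(x, y). dist x y < e})"
definition open_l2 :: "l2 set \<Rightarrow> bool" where
  "open_l2 U \<longleftrightarrow> (\<forall>x\<in>U. eventually (\<lambda>(x', y). x' = x \<longrightarrow> y \<in> U) uniformity)"
instance
proof
  fix x y z :: l2 and r s :: real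
  show "inner x y = inner y x"
    unfolding inner_l2_def by (subst cinner_commute) simp
  show "inner (x + y) z = inner x z + inner y z"
    by (simp add: inner_l2_def cinner_add_left)
  show "inner (r *\<^sub>R x) y = r * inner x y"
    by (simp add: inner_l2_def scaleR_l2_def cinner_scaleC_left)
  show "0 \<le> inner x x"
    by (simp add: inner_l2_def cinner_self suminf_nonneg summable_norm2)
  show "(inner x x = 0) = (x = 0)"
    by (auto simp: inner_l2_def cinner_self suminf_eq_zero_iff summable_norm2 intro!: l2_eqI)
qed (auto simp: scaleR_l2_def norm_l2_def dist_l2_def sgn_l2_def uniformity_l2_def open_l2_def
      algebra_simps intro!: l2_eqI)
end

lemma seq_of_scaleR [simp]: "seq_of (r *\<^sub>R x) n = complex_of_real r * seq_of x n"
  by (simp add: scaleR_l2_def)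

lemma norm_l2_squared: "(norm (x::l2))\<^sup>2 = (\<Sum>n. (cmod (seq_of x n))\<^sup>2)"
  by (simp add: norm_l2_def inner_l2_def cinner_self suminf_nonneg summable_norm2)

lemma norm_eq_ell2_norm: "norm x = ell2_norm (seq_of x)"
  by (simp add: ell2_norm_def norm_l2_squared[symmetric])

lemma ell2_norm_l2_of: "u \<in> ell2 \<Longrightarrow> ell2_norm u = norm (l2_of u)"
  by (simp add: norm_eq_ell2_norm l2_of_inverse)

lemma cmod_seq_of_le: "cmod (seq_of x n) \<le> norm x"
proof -
  have "(\<Sum>k\<in>{n}. (cmod (seq_of x k))\<^sup>2) \<le> (\<Sum>k. (cmod (seq_of x k))\<^sup>2)"
    by (rule sum_le_suminf[OF summable_norm2]) auto
  then have "(cmod (seq_of x n))\<^sup>2 \<le> (norm x)\<^sup>2"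
    by (simp add: norm_l2_squared)
  then show ?thesis by (rule power2_le_imp_le) simp
qed

lemma norm_scaleC: "norm (c *\<^sub>C x) = cmod c * norm x"
proof -
  have "(norm (c *\<^sub>C x))\<^sup>2 = (cmod c * norm x)\<^sup>2"
    using suminf_mult[OF summable_norm2[of x], of "(cmod c)\<^sup>2"]
    by (simp add: norm_l2_squared norm_mult power_mult_distrib)
  then show ?thesis by (simp add: power2_eq_iff_nonneg)
qed

lemma scaleC_algebra:
  "(c + d) *\<^sub>C x = c *\<^sub>C x + d *\<^sub>C x" "(c - d) *\<^sub>C x = c *\<^sub>C x - d *\<^sub>C x"
  "c *\<^sub>C (x + y) = c *\<^sub>C x + c *\<^sub>C y" "c *\<^sub>C (x - y) = c *\<^sub>C x - c *\<^sub>C y"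
  "c *\<^sub>C d *\<^sub>C x = (c * d) *\<^sub>C x"
  by (rule l2_eqI, simp add: algebra_simps)+

lemma scaleC_simps [simp]: "1 *\<^sub>C x = x" "0 *\<^sub>C x = 0" "c *\<^sub>C 0 = 0"
  by (rule l2_eqI, simp)+

lemma scaleC_of_real: "complex_of_real r *\<^sub>C x = r *\<^sub>R x"
  by (simp add: scaleR_l2_def)

lemma tendsto_scaleC: "(f \<longlongrightarrow> x) F \<Longrightarrow> ((\<lambda>k. c *\<^sub>C f k) \<longlongrightarrow> c *\<^sub>C x) F"
proof -
  have "bounded_linear ((*\<^sub>C) c)"
    by (rule bounded_linear_intro[of _ "cmod c"])
       (auto simp: scaleC_algebra norm_scaleC scaleR_l2_def mult.commute)
  then show "(f \<longlongrightarrow> x) F \<Longrightarrow> ((\<lambda>k. c *\<^sub>C f k) \<longlongrightarrow> c *\<^sub>C x) F"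
    by (rule bounded_linear.tendsto)
qed

lemma cinner_add_right: "cinner x (y + z) = cinner x y + cinner x z"
  by (metis cinner_add_left cinner_commute complex_cnj_add)

lemma cinner_scaleC_right: "cinner x (c *\<^sub>C y) = cnj c * cinner x y"
  by (metis cinner_scaleC_left cinner_commute complex_cnj_mult)

lemma cinner_diff_left: "cinner (x - y) z = cinner x z - cinner y z"
  by (metis add_diff_cancel_right' cinner_add_left diff_add_cancel)

lemma cinner_zero [simp]: "cinner 0 x = 0" "cinner x 0 = 0"
  using cinner_scaleC_left[of 0 x x] cinner_scaleC_right[of x 0 x] by simp_all

lemma cinner_sum_left: "cinner (sum f I) y = (\<Sum>i\<in>I. cinner (f i) y)"
  by (induction I rule: infinite_finite_induct) (auto simp: cinner_add_left)

lemma cinner_sum_right: "cinner y (sum f I) = (\<Sum>i\<in>I. cinner y (f i))"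
  by (induction I rule: infinite_finite_induct) (auto simp: cinner_add_right)

lemma seq_of_sum: "seq_of (sum f I) n = (\<Sum>i\<in>I. seq_of (f i) n)"
  by (induction I rule: infinite_finite_induct) auto

lemma cinner_norm: "cinner x x = complex_of_real ((norm x)\<^sup>2)"
  by (simp add: cinner_self norm_l2_squared)

text \<open>Since \<open>cinner x (\<i> *\<^sub>C y)\<close> is -i times \<open>cinner x y\<close>,
  its real part recovers the imaginary part. Continuity, the Cauchy-Schwarz inequality and
  orthogonality pass through this from the real to the complex product.\<close>

lemma cinner_eq_inner: "cinner x y = Complex (inner x y) (inner x (\<i> *\<^sub>C y))"
  by (rule complex_eqI) (auto simp: inner_l2_def cinner_scaleC_right)

lemma tendsto_cinner:
  "(f \<longlongrightarrow> x) F \<Longrightarrow> (g \<longlongrightarrow> y) F \<Longrightarrow> ((\<lambda>k. cinner (f k) (g k)) \<longlongrightarrow> cinner x y) F"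
  unfolding cinner_eq_inner by (intro tendsto_Complex tendsto_inner tendsto_scaleC)

section \<open>Completeness, and compactness of dominated sequences\<close>

lemma norm_le_of_partial_sums:
  assumes "\<And>m. (\<Sum>n<m. (cmod (u n))\<^sup>2) \<le> B\<^sup>2" "B \<ge> 0"
  shows "u \<in> ell2" "norm (l2_of u) \<le> B"
proof -
  have s: "summable (\<lambda>n. (cmod (u n))\<^sup>2)"
    by (rule bounded_imp_summable[of _ "B\<^sup>2"]) (use assms(1) in \<open>auto simp only: lessThan_Suc_atMost[symmetric] zero_le_power2\<close>)
  then show u: "u \<in> ell2" by (simp add: ell2_def)
  have "(\<Sum>n. (cmod (u n))\<^sup>2) \<le> B\<^sup>2"
    by (rule suminf_le_const[OF s]) (use assms in auto)
  then have "(norm (l2_of u))\<^sup>2 \<le> B\<^sup>2" by (simp add: norm_l2_squared l2_of_inverse u)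
  then show "norm (l2_of u) \<le> B" using assms(2) by (rule power2_le_imp_le)
qed

lemma sum_cmod_le_norm: "(\<Sum>n<m. (cmod (seq_of x n))\<^sup>2) \<le> (norm x)\<^sup>2"
  unfolding norm_l2_squared by (rule sum_le_suminf[OF summable_norm2]) auto

text \<open>The candidate is the coordinatewise limit. Norm estimates survive because they are
  checked on finite partial sums, where the limit may be taken term by term.\<close>

instance l2 :: complete_space
proof
  fix X :: "nat \<Rightarrow> l2" assume C: "Cauchy X"
  have "Cauchy (\<lambda>k. seq_of (X k) n)" for n
  proof (rule metric_CauchyI)
    fix e :: real assume "e > 0"
    then obtain M where M: "\<And>m k. m \<ge> M \<Longrightarrow> k \<ge> M \<Longrightarrow> dist (X m) (X k) < e"
      using metric_CauchyD[OF C] by blast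
    have "dist (seq_of (X m) n) (seq_of (X k) n) < e" if "m \<ge> M" "k \<ge> M" for m k
      using cmod_seq_of_le[of "X m - X k" n] M[OF that] by (simp add: dist_norm)
    then show "\<exists>M. \<forall>m\<ge>M. \<forall>k\<ge>M. dist (seq_of (X m) n) (seq_of (X k) n) < e" by blast
  qed
  then have "\<forall>n. \<exists>l. (\<lambda>k. seq_of (X k) n) \<longlonglongrightarrow> l"
    using Cauchy_convergent convergent_def by blast
  then obtain u where u: "\<And>n. (\<lambda>k. seq_of (X k) n) \<longlonglongrightarrow> u n" by metis
  have key: "\<exists>M. \<forall>m\<ge>M. seq_of (X m) - u \<in> ell2 \<and> norm (l2_of (seq_of (X m) - u)) \<le> e" if e: "e > 0" for e
  proof -
    obtain M where M: "\<And>m k. m \<ge> M \<Longrightarrow> k \<ge> M \<Longrightarrow> dist (X m) (X k) < e"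
      using metric_CauchyD[OF C e] by blast
    have "(\<Sum>n<N. (cmod ((seq_of (X m) - u) n))\<^sup>2) \<le> e\<^sup>2" if m: "m \<ge> M" for m N
    proof (rule tendsto_le[OF sequentially_bot tendsto_const])
      show "(\<lambda>k. \<Sum>n<N. (cmod (seq_of (X m - X k) n))\<^sup>2) \<longlonglongrightarrow> (\<Sum>n<N. (cmod ((seq_of (X m) - u) n))\<^sup>2)"
        by (auto intro!: tendsto_intros u)
      have "(\<Sum>n<N. (cmod (seq_of (X m - X k) n))\<^sup>2) \<le> e\<^sup>2" if "k \<ge> M" for k
      proof -
        have "(\<Sum>n<N. (cmod (seq_of (X m - X k) n))\<^sup>2) \<le> (norm (X m - X k))\<^sup>2"
          by (rule sum_cmod_le_norm)
        also have "\<dots> \<le> e\<^sup>2"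
          using M[OF m that] by (intro power_mono) (auto simp: dist_norm)
        finally show ?thesis .
      qed
      then show "\<forall>\<^sub>F k in sequentially. (\<Sum>n<N. (cmod (seq_of (X m - X k) n))\<^sup>2) \<le> e\<^sup>2"
        by (auto simp: eventually_sequentially)
    qed
    then show ?thesis using norm_le_of_partial_sums[of _ e] e by (intro exI[of _ M]) (simp del: fun_diff_def)
  qed
  obtain M where "seq_of (X M) - u \<in> ell2" using key[of 1] by auto
  then have uell: "u \<in> ell2" using ell2_minus[OF seq_of[of "X M"]] by fastforce
  have "X \<longlonglongrightarrow> l2_of u"
  proof (rule metric_LIMSEQ_I)
    fix e :: real assume e: "e > 0"
    then obtain M where M: "\<forall>m\<ge>M. norm (l2_of (seq_of (X m) - u)) \<le> e / 2" using key[of "e/2"] by auto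
    have "l2_of (seq_of (X m) - u) = X m - l2_of u" for m
      by (rule l2_eqI) (simp add: l2_of_inverse uell ell2_minus seq_of)
    then show "\<exists>M. \<forall>m\<ge>M. dist (X m) (l2_of u) < e"
      using M e by (intro exI[of _ M]) (force simp: dist_norm)
  qed
  then show "convergent X" by (auto simp: convergent_def)
qed

text \<open>A diagonal subsequence converges in each coordinate, and the square summable majorant
  makes all tails uniformly small. All compactness used for the Jacobi operators comes from
  here.\<close>

lemma l2_convergent_subsequence_of_dominated:
  assumes h: "summable (\<lambda>n. (h n)\<^sup>2)" and dom: "\<And>k n. cmod (seq_of (X k) n) \<le> h n"
  obtains r x where "strict_mono (r :: nat \<Rightarrow> nat)" "(\<lambda>k. X (r k)) \<longlonglongrightarrow> x"
proof -
  have "(\<lambda>n. (h n)\<^sup>2) \<longlonglongrightarrow> 0" by (rule summable_LIMSEQ_zero[OF h])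
  then have "Bseq (\<lambda>n. (h n)\<^sup>2)" using convergent_imp_Bseq convergent_def by blast
  then obtain B where B: "\<And>n. (h n)\<^sup>2 \<le> B" unfolding Bseq_def by fastforce
  have "cmod (seq_of (X k) n) \<le> sqrt B" for k n
    using dom[of k n] B[of n] by (smt (verit) norm_ge_zero real_le_rsqrt)
  obtain r where r: "strict_mono r" "\<And>n. \<exists>l. (\<lambda>k. seq_of (X (r k)) n) \<longlonglongrightarrow> l"
  proof (rule function_convergent_subsequence[of UNIV "\<lambda>k. seq_of (X k)" "sqrt B"])
    show "cmod (seq_of (X k) n) \<le> sqrt B" for k n by fact
  qed auto
  have "Cauchy (\<lambda>k. X (r k))"
  proof (rule metric_CauchyI)
    fix e :: real assume e: "e > 0"
    \<comment> \<open>Two terms dominated by h differ by at most 2 h, so the tail contributes at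
      most 4 (e/4)^2 = e^2 / 4. The first N coordinates are made to contribute as little, and the
      total e^2 / 2 is below e^2.\<close>
    obtain N where N: "\<And>m. (\<Sum>n\<in>{N..<m}. (h n)\<^sup>2) < (e/4)\<^sup>2"
    proof -
      obtain N where "\<forall>m\<ge>N. \<forall>n. norm (\<Sum>k\<in>{m..<n}. (h k)\<^sup>2) < (e/4)\<^sup>2"
        using h[unfolded summable_Cauchy, rule_format, of "(e/4)\<^sup>2"] e by auto
      then have "\<And>m. (\<Sum>n\<in>{N..<m}. (h n)\<^sup>2) < (e/4)\<^sup>2" by (simp add: sum_nonneg)
      then show ?thesis by (rule that)
    qed
    have "Cauchy (\<lambda>k. seq_of (X (r k)) n)" for n
      using r(2)[of n] by (auto intro: LIMSEQ_imp_Cauchy)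
    then have "\<exists>M. \<forall>k\<ge>M. \<forall>l\<ge>M. cmod (seq_of (X (r k)) n - seq_of (X (r l)) n) < e / (2 * (real N + 1))" for n
      using metric_CauchyD[OF \<open>Cauchy (\<lambda>k. seq_of (X (r k)) n)\<close>, of "e / (2 * (real N + 1))"] e
      unfolding dist_norm by (metis add_nonneg_pos divide_pos_pos mult_pos_pos of_nat_0_le_iff zero_less_numeral zero_less_one)
    then obtain M where M: "\<And>n k l. k \<ge> M n \<Longrightarrow> l \<ge> M n \<Longrightarrow>
        cmod (seq_of (X (r k)) n - seq_of (X (r l)) n) < e / (2 * (real N + 1))" by metis
    define K where "K = Max (M ` {..N})"
    have K: "M n \<le> K" if "n \<le> N" for n unfolding K_def using that by (intro Max_ge) auto
    have "dist (X (r k)) (X (r l)) < e" if kl: "k \<ge> K" "l \<ge> K" for k l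
    proof -
      let ?d = "X (r k) - X (r l)"
      have "(\<Sum>n<m. (cmod (seq_of ?d n))\<^sup>2) \<le> e\<^sup>2 / 2" for m
      proof -
        have "(\<Sum>n<m. (cmod (seq_of ?d n))\<^sup>2) \<le> (\<Sum>n\<in>{..<N} \<union> {N..<m}. (cmod (seq_of ?d n))\<^sup>2)"
          by (intro sum_mono2) auto
        also have "\<dots> = (\<Sum>n<N. (cmod (seq_of ?d n))\<^sup>2) + (\<Sum>n\<in>{N..<m}. (cmod (seq_of ?d n))\<^sup>2)"
          by (intro sum.union_disjoint) auto
        also have "(\<Sum>n<N. (cmod (seq_of ?d n))\<^sup>2) \<le> (\<Sum>n<N. (e / (2 * (real N + 1)))\<^sup>2)"
        proof (intro sum_mono power_mono)
          fix n assume "n \<in> {..<N}"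
          then have "M n \<le> k" "M n \<le> l" using K[of n] kl by auto
          then show "cmod (seq_of ?d n) \<le> e / (2 * (real N + 1))" using M[of n k l] by simp
        qed simp
        also have "(\<Sum>n<N. (e / (2 * (real N + 1)))\<^sup>2) \<le> e\<^sup>2 / 4"
        proof -
          have "real N \<le> (real N + 1)\<^sup>2" by (simp add: power2_eq_square ring_distribs)
          then have "e\<^sup>2 / 4 * (real N / (real N + 1)\<^sup>2) \<le> e\<^sup>2 / 4 * 1"
            by (intro mult_left_mono) (auto simp: divide_le_eq)
          moreover have "(e / (2 * (real N + 1)))\<^sup>2 = e\<^sup>2 / 4 / (real N + 1)\<^sup>2"
            by (simp add: power_divide power_mult_distrib del: distrib_left_numeral)
          ultimately show ?thesis by (simp add: mult.commute)
        qed
        also have "(\<Sum>n\<in>{N..<m}. (cmod (seq_of ?d n))\<^sup>2) \<le> (\<Sum>n\<in>{N..<m}. 4 * (h n)\<^sup>2)"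
        proof (intro sum_mono)
          fix n
          have "cmod (seq_of ?d n) \<le> 2 * h n"
            using norm_triangle_ineq4[of "seq_of (X (r k)) n" "seq_of (X (r l)) n"] dom[of "r k" n] dom[of "r l" n]
            by simp
          then have "(cmod (seq_of ?d n))\<^sup>2 \<le> (2 * h n)\<^sup>2" by (intro power_mono) auto
          then show "(cmod (seq_of ?d n))\<^sup>2 \<le> 4 * (h n)\<^sup>2" by (simp add: power_mult_distrib)
        qed
        also have "\<dots> \<le> e\<^sup>2 / 4" using N[of m] by (simp add: sum_distrib_left[symmetric] power_divide)
        finally show ?thesis by simp
      qed
      then have "(norm ?d)\<^sup>2 \<le> e\<^sup>2 / 2"
        unfolding norm_l2_squared by (intro suminf_le_const[OF summable_norm2]) auto
      also have "\<dots> < e\<^sup>2" using e by simp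
      finally have "norm ?d < e" using e by (intro power2_less_imp_less[of _ e]) auto
      then show ?thesis by (simp add: dist_norm)
    qed
    then show "\<exists>M. \<forall>m\<ge>M. \<forall>n\<ge>M. dist (X (r m)) (X (r n)) < e" by blast
  qed
  then show ?thesis using that[OF r(1)] by (auto simp: Cauchy_convergent_iff convergent_def)
qed

text \<open>A minimizing sequence is Cauchy by the parallelogram law.\<close>

lemma orthogonal_projection_exists:
  fixes S :: "'a :: {real_inner, complete_space} set"
  assumes sub: "subspace S" and cl: "closed S"
  obtains p where "p \<in> S" "\<And>s. s \<in> S \<Longrightarrow> inner (x - p) s = 0"
proof -
  define d where "d = Inf ((\<lambda>s. norm (x - s)) ` S)"
  have bdd: "bdd_below ((\<lambda>s. norm (x - s)) ` S)" by (auto intro!: bdd_belowI[of _ 0])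
  have ne: "S \<noteq> {}" using subspace_0[OF sub] by auto
  have d_le: "d \<le> norm (x - s)" if "s \<in> S" for s
    unfolding d_def by (rule cInf_lower[OF _ bdd]) (use that in auto)
  have d0: "d \<ge> 0" unfolding d_def by (rule cInf_greatest) (use ne in auto)
  have "\<exists>s\<in>S. norm (x - s) < d + 1 / Suc k" for k
    using cInf_lessD[of "(\<lambda>s. norm (x - s)) ` S" "d + 1 / Suc k"] ne unfolding d_def by auto
  then obtain s where s: "\<And>k. s k \<in> S" "\<And>k. norm (x - s k) < d + 1 / Suc k" by metis
  have lim: "(\<lambda>k. norm (x - s k)) \<longlonglongrightarrow> d"
  proof (rule real_tendsto_sandwich)
    show "\<forall>\<^sub>F n in sequentially. d \<le> norm (x - s n)" using d_le s by auto
    show "\<forall>\<^sub>F n in sequentially. norm (x - s n) \<le> d + 1 / Suc n"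
      using s(2) by (intro always_eventually allI less_imp_le)
    show "(\<lambda>n. d + 1 / real (Suc n)) \<longlonglongrightarrow> d" using tendsto_add[OF tendsto_const LIMSEQ_Suc[OF lim_1_over_n]] by simp
  qed simp
  have "Cauchy s"
  proof (rule metric_CauchyI)
    fix e :: real assume e: "e > 0"
    have "(\<lambda>k. (norm (x - s k))\<^sup>2) \<longlonglongrightarrow> d\<^sup>2" by (intro tendsto_intros lim)
    from order_tendstoD(2)[OF this, of "d\<^sup>2 + e\<^sup>2/4"]
    obtain M where M: "\<And>k. k \<ge> M \<Longrightarrow> (norm (x - s k))\<^sup>2 < d\<^sup>2 + e\<^sup>2 / 4"
      using e unfolding eventually_sequentially by auto
    have "dist (s k) (s l) < e" if "k \<ge> M" "l \<ge> M" for k l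
    proof -
      have mid: "(1/2) *\<^sub>R (s k + s l) \<in> S"
        using s(1) sub by (intro subspace_scale subspace_add)
      have "d\<^sup>2 \<le> (norm (x - (1/2) *\<^sub>R (s k + s l)))\<^sup>2"
        using d_le[OF mid] d0 by (intro power_mono)
      moreover have "(norm (s k - s l))\<^sup>2 + 4 * (norm (x - (1/2) *\<^sub>R (s k + s l)))\<^sup>2 =
          2 * (norm (x - s k))\<^sup>2 + 2 * (norm (x - s l))\<^sup>2"
        unfolding power2_norm_eq_inner by (simp add: algebra_simps inner_commute)
      ultimately have "(norm (s k - s l))\<^sup>2 < e\<^sup>2" using M[OF that(1)] M[OF that(2)] by linarith
      then show ?thesis using e by (simp add: dist_norm power2_less_imp_less)
    qed
    then show "\<exists>M. \<forall>m\<ge>M. \<forall>n\<ge>M. dist (s m) (s n) < e" by blast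
  qed
  then obtain p where p: "s \<longlonglongrightarrow> p" by (auto simp: Cauchy_convergent_iff convergent_def)
  have pS: "p \<in> S" by (rule closed_sequentially[OF cl s(1) p])
  have "(\<lambda>k. norm (x - s k)) \<longlonglongrightarrow> norm (x - p)" by (intro tendsto_intros p)
  then have dp: "norm (x - p) = d" using lim LIMSEQ_unique by blast
  have "inner (x - p) t = 0" if t: "t \<in> S" for t
  proof (cases "t = 0")
    case False
    let ?c = "inner (x - p) t / (norm t)\<^sup>2"
    have "p + ?c *\<^sub>R t \<in> S" using pS t sub by (intro subspace_scale subspace_add)
    then have "(norm (x - p))\<^sup>2 \<le> (norm (x - (p + ?c *\<^sub>R t)))\<^sup>2"
      unfolding dp using d_le d0 by (intro power_mono) auto
    moreover have "(norm (x - (p + ?c *\<^sub>R t)))\<^sup>2 = (norm (x - p))\<^sup>2 - (inner (x - p) t)\<^sup>2 / (norm t)\<^sup>2"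
    proof -
      have "(norm (v - c *\<^sub>R t))\<^sup>2 = (norm v)\<^sup>2 - 2 * c * inner v t + c\<^sup>2 * (norm t)\<^sup>2" for v c
        unfolding power2_norm_eq_inner
        by (simp add: inner_diff_left inner_diff_right inner_commute[of t v] power2_eq_square ring_distribs)
      then have "(norm ((x - p) - ?c *\<^sub>R t))\<^sup>2 = (norm (x - p))\<^sup>2 - 2 * ?c * inner (x - p) t + ?c\<^sup>2 * (norm t)\<^sup>2" .
      also have "\<dots> = (norm (x - p))\<^sup>2 - (inner (x - p) t)\<^sup>2 / (norm t)\<^sup>2"
      proof -
        have "2 * (a / b) * a - (a / b)\<^sup>2 * b = a\<^sup>2 / b" if "b \<noteq> 0" for a b :: real
          using that by (simp add: field_simps power2_eq_square)
        from this[of "(norm t)\<^sup>2" "inner (x - p) t"] False show ?thesis by simp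
      qed
      finally show ?thesis by (simp only: diff_diff_add)
    qed
    ultimately have "(inner (x - p) t)\<^sup>2 / (norm t)\<^sup>2 \<le> 0" by linarith
    then show ?thesis using False by (simp add: divide_le_0_iff)
  qed simp
  then show ?thesis using that pS by blast
qed


section \<open>Selfadjoint operators with compact resolvent\<close>

definition complex_linear :: "(l2 \<times> l2) set \<Rightarrow> bool" where
  "complex_linear G \<longleftrightarrow> (0, 0) \<in> G \<and>
     (\<forall>x y x' y' c. (x, y) \<in> G \<longrightarrow> (x', y') \<in> G \<longrightarrow> (x + c *\<^sub>C x', y + c *\<^sub>C y') \<in> G)"

lemma complex_linearD:
  assumes "complex_linear G"
  shows "(0, 0) \<in> G" "(x, y) \<in> G \<Longrightarrow> (x', y') \<in> G \<Longrightarrow> (x + x', y + y') \<in> G"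
    "(x, y) \<in> G \<Longrightarrow> (x', y') \<in> G \<Longrightarrow> (x - x', y - y') \<in> G"
    "(x, y) \<in> G \<Longrightarrow> (c *\<^sub>C x, c *\<^sub>C y) \<in> G"
    "(x, y) \<in> G \<Longrightarrow> (r *\<^sub>R x, r *\<^sub>R y) \<in> G"
proof -
  have lin: "(x, y) \<in> G \<Longrightarrow> (x', y') \<in> G \<Longrightarrow> (x + c *\<^sub>C x', y + c *\<^sub>C y') \<in> G" for x y x' y' c
    using assms by (auto simp: complex_linear_def)
  show z: "(0, 0) \<in> G" using assms by (auto simp: complex_linear_def)
  show "(x, y) \<in> G \<Longrightarrow> (x', y') \<in> G \<Longrightarrow> (x + x', y + y') \<in> G" using lin[of x y x' y' 1] by simp
  show "(x, y) \<in> G \<Longrightarrow> (x', y') \<in> G \<Longrightarrow> (x - x', y - y') \<in> G"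
    using lin[of x y x' y' "-1"] scaleC_of_real[of "-1"] by simp
  show "(x, y) \<in> G \<Longrightarrow> (c *\<^sub>C x, c *\<^sub>C y) \<in> G" for c using lin[OF z, of x y c] by simp
  from this[of "complex_of_real r"] show "(x, y) \<in> G \<Longrightarrow> (r *\<^sub>R x, r *\<^sub>R y) \<in> G" by (simp add: scaleC_of_real)
qed

lemma complex_linear_sum:
  assumes "complex_linear G" "\<And>i. i \<in> I \<Longrightarrow> (x i, y i) \<in> G"
  shows "(sum x I, sum y I) \<in> G"
  using assms(2) by (induction I rule: infinite_finite_induct) (auto intro: complex_linearD[OF assms(1)])

text \<open>The lower bound turns convergence of images into convergence of preimages, so the range
  of G - z is closed; \<open>dense\<close> says that its orthogonal complement is trivial. The
  projection of w onto the range is therefore w itself.\<close>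

lemma surj_of_bounded_below:
  assumes lin: "complex_linear G" and cl: "closed G"
    and bound: "\<And>x y. (x, y) \<in> G \<Longrightarrow> norm x \<le> C * norm (y - z *\<^sub>C x)"
    and dense: "\<And>w. (\<And>x y. (x, y) \<in> G \<Longrightarrow> cinner (y - z *\<^sub>C x) w = 0) \<Longrightarrow> w = 0"
  shows "\<exists>x. (x, w + z *\<^sub>C x) \<in> G"
proof -
  define R where "R = (\<lambda>(x, y). y - z *\<^sub>C x) ` G"
  have scale: "c *\<^sub>C s \<in> R" if "s \<in> R" for c s
  proof -
    from that obtain x y where xy: "(x, y) \<in> G" "s = y - z *\<^sub>C x" by (auto simp: R_def)
    have "c *\<^sub>C s = c *\<^sub>C y - z *\<^sub>C (c *\<^sub>C x)" by (simp add: xy scaleC_algebra mult.commute)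
    then show ?thesis using complex_linearD(4)[OF lin xy(1), of c] unfolding R_def by force
  qed
  have "subspace R"
    unfolding subspace_def
  proof (intro conjI ballI allI)
    show "0 \<in> R" using complex_linearD(1)[OF lin] by (force simp: R_def)
    show "c *\<^sub>R s \<in> R" if "s \<in> R" for c s using scale[OF that, of "complex_of_real c"] by (simp add: scaleC_of_real)
    fix s t assume "s \<in> R" "t \<in> R"
    then obtain x y x' y' where xy: "(x, y) \<in> G" "s = y - z *\<^sub>C x" "(x', y') \<in> G" "t = y' - z *\<^sub>C x'"
      by (auto simp: R_def)
    have "s + t = (y + y') - z *\<^sub>C (x + x')" by (simp add: xy scaleC_algebra)
    then show "s + t \<in> R" using complex_linearD(2)[OF lin xy(1,3)] unfolding R_def by force
  qed
  moreover have "closed R"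
    unfolding closed_sequential_limits
  proof (intro allI impI, elim conjE)
    fix s l assume s: "\<forall>n. s n \<in> R" and l: "s \<longlonglongrightarrow> l"
    from s have "\<forall>n. \<exists>x y. (x, y) \<in> G \<and> s n = y - z *\<^sub>C x" by (force simp: R_def)
    then obtain X Y where XY: "\<And>n. (X n, Y n) \<in> G" "\<And>n. s n = Y n - z *\<^sub>C X n" by metis
    have "Cauchy X"
    proof (rule metric_CauchyI)
      fix e :: real assume e: "e > 0"
      have "Cauchy s" using l by (rule LIMSEQ_imp_Cauchy)
      then obtain M where M: "\<And>m n. m \<ge> M \<Longrightarrow> n \<ge> M \<Longrightarrow> dist (s m) (s n) < e / (\<bar>C\<bar> + 1)"
        using metric_CauchyD[of s "e / (\<bar>C\<bar> + 1)"] e by (metis abs_ge_zero add_nonneg_pos divide_pos_pos zero_less_one)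
      have "dist (X m) (X n) < e" if "m \<ge> M" "n \<ge> M" for m n
      proof -
        have "norm (X m - X n) \<le> C * norm ((Y m - Y n) - z *\<^sub>C (X m - X n))"
          by (intro bound complex_linearD(3)[OF lin] XY)
        also have "(Y m - Y n) - z *\<^sub>C (X m - X n) = s m - s n" by (simp add: XY scaleC_algebra)
        also have "C * norm (s m - s n) \<le> (\<bar>C\<bar> + 1) * norm (s m - s n)" by (intro mult_right_mono) auto
        also have "\<dots> < (\<bar>C\<bar> + 1) * (e / (\<bar>C\<bar> + 1))"
          using M[OF that] by (intro mult_strict_left_mono) (auto simp: dist_norm)
        also have "\<dots> = e" by simp
        finally show ?thesis by (simp add: dist_norm)
      qed
      then show "\<exists>M. \<forall>m\<ge>M. \<forall>n\<ge>M. dist (X m) (X n) < e" by blast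
    qed
    then obtain x where x: "X \<longlonglongrightarrow> x" by (auto simp: Cauchy_convergent_iff convergent_def)
    have "(\<lambda>n. s n + z *\<^sub>C X n) \<longlonglongrightarrow> l + z *\<^sub>C x" by (intro tendsto_add l tendsto_scaleC x)
    then have "Y \<longlonglongrightarrow> l + z *\<^sub>C x" by (simp add: XY)
    then have "(\<lambda>n. (X n, Y n)) \<longlonglongrightarrow> (x, l + z *\<^sub>C x)" by (intro tendsto_Pair x)
    then have "(x, l + z *\<^sub>C x) \<in> G" using closed_sequentially[OF cl, of "\<lambda>n. (X n, Y n)"] XY(1) by blast
    then show "l \<in> R" unfolding R_def by force
  qed
  ultimately obtain p where p: "p \<in> R" "\<And>s. s \<in> R \<Longrightarrow> inner (w - p) s = 0"
    using orthogonal_projection_exists[of R w] by blast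
  have "w - p = 0"
  proof (rule dense)
    fix x y assume "(x, y) \<in> G"
    then have "y - z *\<^sub>C x \<in> R" by (force simp: R_def)
    \<comment> \<open>The projection is orthogonal only for the real product, but the range is
      invariant under multiplication by i, which yields the imaginary part as well.\<close>
    then have "cinner (w - p) (y - z *\<^sub>C x) = 0"
      unfolding cinner_eq_inner using p(2) scale by (simp add: zero_complex.code)
    then show "cinner (y - z *\<^sub>C x) (w - p) = 0" by (subst cinner_commute) simp
  qed
  with p(1) obtain x y where "(x, y) \<in> G" "w = y - z *\<^sub>C x" by (auto simp: R_def)
  then show ?thesis by (intro exI[of _ x]) simp
qed

definition adjoint_graph :: "(l2 \<times> l2) set \<Rightarrow> (l2 \<times> l2) set" where
  "adjoint_graph G = {(v, w). \<forall>(x, y)\<in>G. cinner y v = cinner x w}"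

lemma closed_adjoint_graph: "closed (adjoint_graph G)"
  unfolding closed_sequential_limits
proof (intro allI impI, elim conjE)
  fix s l assume s: "\<forall>n. s n \<in> adjoint_graph G" and l: "s \<longlonglongrightarrow> l"
  have "cinner y (fst l) = cinner x (snd l)" if xy: "(x, y) \<in> G" for x y
  proof (rule LIMSEQ_unique)
    show "(\<lambda>n. cinner y (fst (s n))) \<longlonglongrightarrow> cinner y (fst l)"
      by (intro tendsto_cinner tendsto_const tendsto_fst l)
    have "cinner y (fst (s n)) = cinner x (snd (s n))" for n
      using s[rule_format, of n] xy by (auto simp: adjoint_graph_def split: prod.splits)
    then show "(\<lambda>n. cinner y (fst (s n))) \<longlonglongrightarrow> cinner x (snd l)"
      by simp (intro tendsto_cinner tendsto_const tendsto_snd l)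
  qed
  then show "l \<in> adjoint_graph G" by (auto simp: adjoint_graph_def split: prod.splits)
qed

lemma complex_linear_adjoint_graph: "complex_linear (adjoint_graph G)"
  unfolding complex_linear_def adjoint_graph_def
  by (fastforce simp: cinner_add_right cinner_scaleC_right)

text \<open>For a symmetric pair \<open>cinner y x\<close> is real, so the imaginary part of
  \<open>cinner (y - z *\<^sub>C x) x\<close> is exactly -Im z |x|^2. It gives both the reality of
  eigenvalues and the lower bound at nonreal z.\<close>

lemma symmetric_norm_diff_ge:
  assumes "cinner y x = cinner x y"
  shows "\<bar>Im z\<bar> * norm x \<le> norm (y - z *\<^sub>C x)"
proof (cases "x = 0")
  case False
  have "cinner y x = cnj (cinner y x)" using assms cinner_commute[of y x] by simp
  then have "Im (cinner y x) = 0" by (simp add: complex_eq_iff)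
  then have "Im (cinner (y - z *\<^sub>C x) x) = - Im z * (norm x)\<^sup>2"
    by (simp add: cinner_diff_left cinner_scaleC_left cinner_norm)
  moreover have "\<bar>Im (cinner (y - z *\<^sub>C x) x)\<bar> \<le> norm (y - z *\<^sub>C x) * norm x"
  proof -
    have "Im (cinner a b) = inner a (\<i> *\<^sub>C b)" for a b by (simp add: cinner_eq_inner)
    then show ?thesis
      using Cauchy_Schwarz_ineq2[of "y - z *\<^sub>C x" "\<i> *\<^sub>C x"] by (simp add: norm_scaleC)
  qed
  ultimately have "(\<bar>Im z\<bar> * norm x) * norm x \<le> norm (y - z *\<^sub>C x) * norm x"
    by (simp add: abs_mult power2_eq_square)
  then show ?thesis using False by simp
qed simp

text \<open>Von Neumann's criterion. The kernel at -i is the orthogonal complement of the range of G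
  - i, so G - i is onto. A pair of the adjoint thus has the same image under (adjoint - i) as some
  pair of G, and their difference lies in the kernel at i.\<close>

lemma adjoint_eq_of_trivial_kernels:
  assumes lin: "complex_linear G" and cl: "closed G" and sym: "G \<subseteq> adjoint_graph G"
    and ker: "\<And>w. (w, \<i> *\<^sub>C w) \<in> adjoint_graph G \<Longrightarrow> w = 0" "\<And>w. (w, (-\<i>) *\<^sub>C w) \<in> adjoint_graph G \<Longrightarrow> w = 0"
  shows "adjoint_graph G = G"
proof
  have surj: "\<exists>x. (x, w + \<i> *\<^sub>C x) \<in> G" for w
  proof (rule surj_of_bounded_below[OF lin cl])
    show "norm x \<le> 1 * norm (y - \<i> *\<^sub>C x)" if "(x, y) \<in> G" for x y
      using symmetric_norm_diff_ge[of y x \<i>] that sym by (force simp: adjoint_graph_def)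
    show "w = 0" if w: "\<And>x y. (x, y) \<in> G \<Longrightarrow> cinner (y - \<i> *\<^sub>C x) w = 0" for w
    proof (rule ker(2))
      show "(w, (-\<i>) *\<^sub>C w) \<in> adjoint_graph G"
        using w by (force simp: adjoint_graph_def cinner_diff_left cinner_scaleC_left cinner_scaleC_right)
    qed
  qed
  show "adjoint_graph G \<subseteq> G"
  proof
    fix p assume "p \<in> adjoint_graph G"
    moreover obtain u v where p: "p = (u, v)" by force
    ultimately have uv: "(u, v) \<in> adjoint_graph G" by simp
    obtain x where x: "(x, (v - \<i> *\<^sub>C u) + \<i> *\<^sub>C x) \<in> G" using surj by blast
    then have "(u - x, v - ((v - \<i> *\<^sub>C u) + \<i> *\<^sub>C x)) \<in> adjoint_graph G"
      using sym by (intro complex_linearD(3)[OF complex_linear_adjoint_graph] uv) auto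
    then have "(u - x, \<i> *\<^sub>C (u - x)) \<in> adjoint_graph G" by (simp add: scaleC_algebra)
    then have "u = x" using ker(1) by fastforce
    then show "p \<in> G" using x p by simp
  qed
qed (fact sym)

section \<open>Orthogonal systems, and spectral theory from a compactly embedded domain\<close>

lemma orthogonal_norm_sum:
  assumes "finite I" "\<And>i j. i \<in> I \<Longrightarrow> j \<in> I \<Longrightarrow> i \<noteq> j \<Longrightarrow> cinner (e i) (e j) = 0"
  shows "(norm (\<Sum>i\<in>I. c i *\<^sub>C e i))\<^sup>2 = (\<Sum>i\<in>I. (cmod (c i))\<^sup>2 * (norm (e i))\<^sup>2)"
proof -
  have "complex_of_real ((norm (\<Sum>i\<in>I. c i *\<^sub>C e i))\<^sup>2) = (\<Sum>i\<in>I. \<Sum>j\<in>I. c i * cnj (c j) * cinner (e i) (e j))"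
    unfolding cinner_norm[symmetric]
    by (simp add: cinner_sum_left cinner_sum_right cinner_scaleC_left cinner_scaleC_right sum_distrib_left mult_ac)
       (rule sum.swap)
  also have "\<dots> = (\<Sum>i\<in>I. \<Sum>j\<in>I. if i = j then c i * cnj (c i) * cinner (e i) (e i) else 0)"
    by (intro sum.cong) (use assms(2) in auto)
  also have "\<dots> = (\<Sum>i\<in>I. c i * cnj (c i) * cinner (e i) (e i))"
    using assms(1) by simp
  also have "\<dots> = complex_of_real (\<Sum>i\<in>I. (cmod (c i))\<^sup>2 * (norm (e i))\<^sup>2)"
    unfolding of_real_sum of_real_mult cinner_norm complex_norm_square ..
  finally show ?thesis by (simp only: of_real_eq_iff)
qed

lemma norm_sum_orthogonal_eigenvectors_le:
  assumes "finite I" "\<And>i j. i \<in> I \<Longrightarrow> j \<in> I \<Longrightarrow> i \<noteq> j \<Longrightarrow> cinner (e i) (e j) = 0"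
    and "\<And>i. i \<in> I \<Longrightarrow> \<bar>\<mu> i\<bar> \<le> t" "t \<ge> 0"
  shows "norm (\<Sum>i\<in>I. (c i * complex_of_real (\<mu> i)) *\<^sub>C e i) \<le> t * norm (\<Sum>i\<in>I. c i *\<^sub>C e i)"
proof -
  have "(cmod (c i * complex_of_real (\<mu> i)))\<^sup>2 * (norm (e i))\<^sup>2 \<le> t\<^sup>2 * ((cmod (c i))\<^sup>2 * (norm (e i))\<^sup>2)"
    if "i \<in> I" for i
  proof -
    have "(\<mu> i)\<^sup>2 \<le> t\<^sup>2" using assms(3)[OF that] assms(4) by (simp add: abs_le_square_iff[symmetric])
    then have "(\<mu> i)\<^sup>2 * ((cmod (c i))\<^sup>2 * (norm (e i))\<^sup>2) \<le> t\<^sup>2 * ((cmod (c i))\<^sup>2 * (norm (e i))\<^sup>2)"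
      by (intro mult_right_mono) auto
    then show ?thesis by (simp add: norm_mult power_mult_distrib mult_ac)
  qed
  moreover have "(norm (\<Sum>i\<in>I. c i *\<^sub>C e i))\<^sup>2 = (\<Sum>i\<in>I. (cmod (c i))\<^sup>2 * (norm (e i))\<^sup>2)" for c
    by (rule orthogonal_norm_sum) (use assms in auto)
  ultimately have "(norm (\<Sum>i\<in>I. (c i * complex_of_real (\<mu> i)) *\<^sub>C e i))\<^sup>2 \<le> t\<^sup>2 * (norm (\<Sum>i\<in>I. c i *\<^sub>C e i))\<^sup>2"
    by (simp add: sum_distrib_left sum_mono)
  then show ?thesis
    using assms(4) by (simp add: power_mult_distrib[symmetric] power2_le_iff_abs_le abs_mult)
qed

text \<open>The second axiom states compactness of the resolvent without a resolvent: sets bounded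
  in the graph norm are relatively compact in the space. Only the first components are asked to
  converge.\<close>

locale compact_selfadjoint =
  fixes G :: "(l2 \<times> l2) set"
  assumes adjoint: "adjoint_graph G = G"
    and compact: "(\<And>k. (X k, Y k) \<in> G) \<Longrightarrow> (\<And>k. norm (X k) \<le> 1) \<Longrightarrow> (\<And>k. norm (Y k) \<le> B) \<Longrightarrow>
      \<exists>r x. strict_mono (r :: nat \<Rightarrow> nat) \<and> (\<lambda>k. X (r k)) \<longlonglongrightarrow> x"
begin

lemma linear: "complex_linear G"
  using complex_linear_adjoint_graph[of G] by (simp add: adjoint)

lemma closed_graph: "closed G"
  using closed_adjoint_graph[of G] by (simp add: adjoint)

lemma graph_iff: "(v, w) \<in> G \<longleftrightarrow> (\<forall>(x, y)\<in>G. cinner y v = cinner x w)"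
proof -
  have "(v, w) \<in> G \<longleftrightarrow> (v, w) \<in> adjoint_graph G" by (simp add: adjoint)
  then show ?thesis by (simp add: adjoint_graph_def)
qed

lemma symmetric: "(x, y) \<in> G \<Longrightarrow> (x', y') \<in> G \<Longrightarrow> cinner y x' = cinner x y'"
  using graph_iff[of x' y'] by blast

lemma graph_limit:
  assumes "\<And>k. (X k, Y k) \<in> G" "X \<longlonglongrightarrow> x" "Y \<longlonglongrightarrow> y"
  shows "(x, y) \<in> G"
  using closed_sequentially[OF closed_graph, of "\<lambda>k. (X k, Y k)"] assms tendsto_Pair by blast

lemma eigenvalue_real:
  assumes "(x, z *\<^sub>C x) \<in> G" "x \<noteq> 0"
  shows "z \<in> \<real>"
  using symmetric_norm_diff_ge[OF symmetric[OF assms(1,1)], of z] assms(2)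
  by (auto simp: complex_is_Real_iff mult_le_0_iff)

lemma eigenvectors_orthogonal:
  assumes "(x, complex_of_real \<mu> *\<^sub>C x) \<in> G" "(y, complex_of_real \<nu> *\<^sub>C y) \<in> G" "\<mu> \<noteq> \<nu>"
  shows "cinner x y = 0"
  using symmetric[OF assms(1,2)] assms(3) by (simp add: cinner_scaleC_left cinner_scaleC_right)

text \<open>If the bound fails, normalized pairs with y - z x tending to 0 exist. Compactness
  extracts a limit of x, then y converges too, and closedness of the graph makes the limit a unit
  eigenvector.\<close>

lemma bounded_below_of_not_eigenvalue:
  assumes no: "\<And>x. (x, z *\<^sub>C x) \<in> G \<Longrightarrow> x = 0"
  shows "\<exists>C. \<forall>(x, y)\<in>G. norm x \<le> C * norm (y - z *\<^sub>C x)"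
proof (rule ccontr)
  assume "\<not> ?thesis"
  then have "\<forall>k::nat. \<exists>x y. (x, y) \<in> G \<and> norm x > real (Suc k) * norm (y - z *\<^sub>C x)"
    by (force simp: not_le)
  then obtain X Y where XY: "\<And>k. (X k, Y k) \<in> G" "\<And>k. norm (X k) > real (Suc k) * norm (Y k - z *\<^sub>C X k)"
    by metis
  define x where "x k = (1 / norm (X k)) *\<^sub>R X k" for k
  define y where "y k = (1 / norm (X k)) *\<^sub>R Y k" for k
  have pos: "norm (X k) > 0" for k
    using XY(2)[of k] by (meson le_less_trans mult_nonneg_nonneg norm_ge_zero of_nat_0_le_iff)
  have xy: "(x k, y k) \<in> G" for k
    unfolding x_def y_def by (rule complex_linearD(5)[OF linear XY(1)])
  have nx: "norm (x k) = 1" for k using pos[of k] by (simp add: x_def)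
  have d: "norm (y k - z *\<^sub>C x k) \<le> 1 / Suc k" for k
  proof -
    have "y k - z *\<^sub>C x k = (1 / norm (X k)) *\<^sub>R (Y k - z *\<^sub>C X k)"
      by (rule l2_eqI) (simp add: x_def y_def algebra_simps)
    then have "norm (y k - z *\<^sub>C x k) = norm (Y k - z *\<^sub>C X k) / norm (X k)" by simp
    also have "\<dots> \<le> 1 / Suc k" using XY(2)[of k] pos[of k] by (simp add: field_simps)
    finally show ?thesis .
  qed
  have "norm (y k) \<le> 1 + cmod z" for k
  proof -
    have "norm (y k) \<le> norm (y k - z *\<^sub>C x k) + norm (z *\<^sub>C x k)"
      using norm_triangle_ineq[of "y k - z *\<^sub>C x k" "z *\<^sub>C x k"] by simp
    moreover have "norm (y k - z *\<^sub>C x k) \<le> 1" by (rule order_trans[OF d]) simp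
    ultimately show ?thesis by (simp add: norm_scaleC nx)
  qed
  then obtain r u where r: "strict_mono r" "(\<lambda>k. x (r k)) \<longlonglongrightarrow> u"
    using compact[of x y "1 + cmod z"] xy nx by auto
  have "(\<lambda>k. y k - z *\<^sub>C x k) \<longlonglongrightarrow> 0"
    by (rule Lim_null_comparison[OF always_eventually[OF allI[OF d]] LIMSEQ_Suc[OF lim_1_over_n]])
  then have "(\<lambda>k. y (r k) - z *\<^sub>C x (r k)) \<longlonglongrightarrow> 0"
    using LIMSEQ_subseq_LIMSEQ[OF _ r(1)] by (simp add: o_def)
  from tendsto_add[OF this tendsto_scaleC[OF r(2), of z]] have "(\<lambda>k. y (r k)) \<longlonglongrightarrow> z *\<^sub>C u" by simp
  then have "(u, z *\<^sub>C u) \<in> G" by (intro graph_limit[OF xy r(2)])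
  moreover have "norm u = 1"
    using tendsto_norm[OF r(2)] LIMSEQ_unique[OF _ tendsto_const] by (simp add: nx)
  ultimately show False using no[of u] by simp
qed

text \<open>A vector orthogonal to the range of A - z is an eigenvector for the conjugate of z.
  Eigenvalues are real, so this would be an eigenvector for z itself.\<close>

lemma surj_of_not_eigenvalue:
  assumes no: "\<And>x. (x, z *\<^sub>C x) \<in> G \<Longrightarrow> x = 0"
  shows "\<exists>x. (x, w + z *\<^sub>C x) \<in> G"
proof -
  obtain C where C: "\<forall>(x, y)\<in>G. norm x \<le> C * norm (y - z *\<^sub>C x)"
    using bounded_below_of_not_eigenvalue[OF no] by blast
  show ?thesis
  proof (rule surj_of_bounded_below[OF linear closed_graph])
    show "norm x \<le> C * norm (y - z *\<^sub>C x)" if "(x, y) \<in> G" for x y using C that by blast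
    fix w assume w: "\<And>x y. (x, y) \<in> G \<Longrightarrow> cinner (y - z *\<^sub>C x) w = 0"
    have "(w, cnj z *\<^sub>C w) \<in> G"
      unfolding graph_iff using w
      by (force simp: cinner_diff_left cinner_scaleC_left cinner_scaleC_right)
    then show "w = 0" using no[of w] eigenvalue_real[of w "cnj z"] by (cases "w = 0") (auto simp: Reals_cnj_iff)
  qed
qed

text \<open>Minimizing \<open>\<parallel>Ax\<parallel> / \<parallel>x\<parallel>\<close> on the orthogonal complement of the eigenvectors yields a further
  eigenvalue \<open>m\<close> or \<open>-m\<close>, since a minimizer satisfies \<open>(A - m)(A + m)x = 0\<close>.\<close>

lemma norm_gt_of_orthogonal_eigenvectors:
  assumes fin: "finite M" and eig: "\<And>\<mu>. \<mu> \<in> M \<Longrightarrow> (e \<mu>, complex_of_real \<mu> *\<^sub>C e \<mu>) \<in> G"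
    and ne: "\<And>\<mu>. \<mu> \<in> M \<Longrightarrow> e \<mu> \<noteq> 0"
    and all: "\<And>\<mu> x. \<bar>\<mu>\<bar> \<le> t \<Longrightarrow> (x, complex_of_real \<mu> *\<^sub>C x) \<in> G \<Longrightarrow> x \<noteq> 0 \<Longrightarrow>
      \<mu> \<in> M \<and> (\<exists>c. x = c *\<^sub>C e \<mu>)"
    and xy: "(x, y) \<in> G" "x \<noteq> 0" and orth: "\<And>\<mu>. \<mu> \<in> M \<Longrightarrow> cinner x (e \<mu>) = 0"
  shows "norm y > t * norm x"
proof (rule ccontr)
  assume "\<not> ?thesis"
  then have le: "norm y \<le> t * norm x" by simp
  define D where "D = {(x, y) \<in> G. \<forall>\<mu>\<in>M. cinner x (e \<mu>) = 0}"
  have Dlin: "complex_linear D"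
    using linear unfolding complex_linear_def D_def by (auto simp: cinner_add_left cinner_scaleC_left)
  define Q where "Q = {norm y | x y. (x, y) \<in> D \<and> norm x = 1}"
  define m where "m = Inf Q"
  have no_eig: "x = 0" if D: "(x, complex_of_real \<mu> *\<^sub>C x) \<in> D" "\<bar>\<mu>\<bar> \<le> t" for x \<mu>
  proof (rule ccontr)
    assume "x \<noteq> 0"
    then obtain c where "\<mu> \<in> M" "x = c *\<^sub>C e \<mu>" using all[of \<mu> x] D by (auto simp: D_def)
    then have "cinner x x = 0" using D(1) by (auto simp: D_def cinner_scaleC_right)
    then show False using \<open>x \<noteq> 0\<close> by (simp add: cinner_norm)
  qed
  have y1: "norm y / norm x \<in> Q"
  proof -
    have "((1 / norm x) *\<^sub>R x, (1 / norm x) *\<^sub>R y) \<in> D"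
      by (rule complex_linearD(5)[OF Dlin]) (use xy orth in \<open>auto simp: D_def\<close>)
    then show ?thesis unfolding Q_def using xy(2) by force
  qed
  have bdd: "bdd_below Q" by (auto simp: Q_def intro!: bdd_belowI[of _ 0])
  have m0: "m \<ge> 0" unfolding m_def by (rule cInf_greatest) (use y1 in \<open>auto simp: Q_def\<close>)
  have "m \<le> norm y / norm x" unfolding m_def by (rule cInf_lower[OF y1 bdd])
  also have "\<dots> \<le> t" using le xy(2) by (simp add: field_simps)
  finally have mt: "m \<le> t" .
  have m_le: "m * norm a \<le> norm b" if "(a, b) \<in> D" for a b
  proof (cases "a = 0")
    case False
    have "((1 / norm a) *\<^sub>R a, (1 / norm a) *\<^sub>R b) \<in> D" by (rule complex_linearD(5)[OF Dlin that])
    then have "norm ((1 / norm a) *\<^sub>R b) \<in> Q" unfolding Q_def using False by force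
    then have "m \<le> norm ((1 / norm a) *\<^sub>R b)" unfolding m_def by (rule cInf_lower[OF _ bdd])
    then show ?thesis using False by (simp add: field_simps)
  qed simp
  have "\<exists>a b. (a, b) \<in> D \<and> norm a = 1 \<and> norm b < m + 1 / Suc k" for k
    using cInf_lessD[of Q "m + 1 / Suc k"] y1 unfolding m_def Q_def by force
  then obtain X Y where XY: "\<And>k. (X k, Y k) \<in> D" "\<And>k. norm (X k) = 1" "\<And>k. norm (Y k) < m + 1 / Suc k"
    by metis
  have "norm (Y k) \<le> m + 1" for k
    by (rule order_trans[OF less_imp_le[OF XY(3)]]) simp
  then obtain r u where r: "strict_mono r" and u: "(\<lambda>k. X (r k)) \<longlonglongrightarrow> u"
    using compact[of X Y "m + 1"] XY by (force simp: D_def)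
  have nu: "norm u = 1"
    using tendsto_norm[OF u] LIMSEQ_unique[OF _ tendsto_const] by (simp add: XY)
  have limY: "(\<lambda>k. norm (Y k)) \<longlonglongrightarrow> m"
  proof (rule real_tendsto_sandwich)
    show "\<forall>\<^sub>F k in sequentially. m \<le> norm (Y k)" using m_le[OF XY(1)] XY(2) by simp
    show "\<forall>\<^sub>F k in sequentially. norm (Y k) \<le> m + 1 / Suc k"
      using XY(3) by (intro always_eventually allI less_imp_le)
    show "(\<lambda>k. m + 1 / real (Suc k)) \<longlonglongrightarrow> m" using tendsto_add[OF tendsto_const LIMSEQ_Suc[OF lim_1_over_n]] by simp
  qed simp
  \<comment> \<open>Compactness controls only the first components. In the parallelogram law for Y
    the term |Y_k + Y_l|^2 is at least m^2 |X_k + X_l|^2, which approaches 4 m^2 because X converges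
    to a unit vector, while |Y_k| tends to m. \<open>F k\<close> collects the error belonging to one
    index.\<close>
  have "Cauchy (\<lambda>k. Y (r k))"
  proof (rule metric_CauchyI)
    fix d :: real assume d: "d > 0"
    define F where "F k = 2 * (norm (Y (r k)))\<^sup>2 - 2 * m\<^sup>2 + m\<^sup>2 * 4 * norm (X (r k) - u)" for k
    have "(\<lambda>k. norm (Y (r k))) \<longlonglongrightarrow> m"
      using LIMSEQ_subseq_LIMSEQ[OF limY r] by (simp add: o_def)
    then have "F \<longlonglongrightarrow> 2 * m\<^sup>2 - 2 * m\<^sup>2 + m\<^sup>2 * 4 * norm (u - u)"
      unfolding F_def by (intro tendsto_intros u)
    then have "F \<longlonglongrightarrow> 0" by simp
    from order_tendstoD(2)[OF this, of "d\<^sup>2 / 2"] obtain K where K: "\<And>k. k \<ge> K \<Longrightarrow> F k < d\<^sup>2 / 2"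
      using d unfolding eventually_sequentially by auto
    have "dist (Y (r k)) (Y (r l)) < d" if kl: "k \<ge> K" "l \<ge> K" for k l
    proof -
      let ?X = "\<lambda>k. X (r k)" and ?Y = "\<lambda>k. Y (r k)"
      have par: "(norm (a - b))\<^sup>2 = 2 * (norm a)\<^sup>2 + 2 * (norm b)\<^sup>2 - (norm (a + b))\<^sup>2" for a b :: l2
        unfolding power2_norm_eq_inner by (simp add: inner_diff_left inner_diff_right inner_add_left inner_add_right inner_commute[of b a])
      have "(m * norm (?X k + ?X l))\<^sup>2 \<le> (norm (?Y k + ?Y l))\<^sup>2"
        using m_le[OF complex_linearD(2)[OF Dlin XY(1) XY(1)]] m0 by (intro power_mono) auto
      then have 1: "(norm (?Y k - ?Y l))\<^sup>2 \<le> 2 * (norm (?Y k))\<^sup>2 + 2 * (norm (?Y l))\<^sup>2 - m\<^sup>2 * (norm (?X k + ?X l))\<^sup>2"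
        by (simp add: par power_mult_distrib)
      have "norm (?X k - ?X l) \<le> norm (?X k - u) + norm (?X l - u)"
        using norm_triangle_ineq4[of "?X k - u" "?X l - u"] by simp
      moreover have "norm (?X k - ?X l) \<le> 2" using norm_triangle_ineq4[of "?X k" "?X l"] by (simp add: XY)
      ultimately have "(norm (?X k - ?X l))\<^sup>2 \<le> 2 * (norm (?X k - u) + norm (?X l - u))"
        unfolding power2_eq_square by (intro mult_mono) auto
      moreover have "(norm (?X k - ?X l))\<^sup>2 = 4 - (norm (?X k + ?X l))\<^sup>2"
        using par[of "?X k" "?X l"] by (simp add: XY)
      ultimately have "4 - (norm (?X k + ?X l))\<^sup>2 \<le> 2 * (norm (?X k - u) + norm (?X l - u))"
        by simp
      also have "\<dots> \<le> 4 * (norm (?X k - u) + norm (?X l - u))" by (intro mult_right_mono) auto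
      finally have "4 - (norm (?X k + ?X l))\<^sup>2 \<le> 4 * (norm (?X k - u) + norm (?X l - u))" .
      then have "m\<^sup>2 * (4 - (norm (?X k + ?X l))\<^sup>2) \<le> m\<^sup>2 * (4 * (norm (?X k - u) + norm (?X l - u)))"
        by (intro mult_left_mono) auto
      with 1 have "(norm (?Y k - ?Y l))\<^sup>2 \<le> F k + F l"
        by (simp add: F_def algebra_simps)
      also have "\<dots> < d\<^sup>2" using K[OF kl(1)] K[OF kl(2)] by simp
      finally show ?thesis using d by (simp add: dist_norm power2_less_imp_less)
    qed
    then show "\<exists>K. \<forall>k\<ge>K. \<forall>l\<ge>K. dist (Y (r k)) (Y (r l)) < d" by blast
  qed
  then obtain v where v: "(\<lambda>k. Y (r k)) \<longlonglongrightarrow> v" by (auto simp: Cauchy_convergent_iff convergent_def)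
  have nv: "norm v = m"
    using LIMSEQ_subseq_LIMSEQ[OF limY r] tendsto_norm[OF v] LIMSEQ_unique by (auto simp: o_def)
  have uvG: "(u, v) \<in> G" by (rule graph_limit[OF _ u v]) (use XY(1) in \<open>auto simp: D_def\<close>)
  have uorth: "cinner u (e \<mu>) = 0" if "\<mu> \<in> M" for \<mu>
  proof -
    have "(\<lambda>k. cinner (X (r k)) (e \<mu>)) \<longlonglongrightarrow> cinner u (e \<mu>)" by (intro tendsto_cinner u tendsto_const)
    moreover have "cinner (X (r k)) (e \<mu>) = 0" for k using XY(1)[of "r k"] that by (auto simp: D_def)
    ultimately show ?thesis using LIMSEQ_unique[OF _ tendsto_const] by simp
  qed
  have uvD: "(u, v) \<in> D" using uvG uorth by (auto simp: D_def)
  have vorth: "cinner v (e \<mu>) = 0" if "\<mu> \<in> M" for \<mu>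
    using symmetric[OF uvG eig[OF that]] uorth[OF that] by (simp add: cinner_scaleC_right)
  \<comment> \<open>The first variation at the minimizer (u, v) of the quadratic form |b|^2 - m^2
    |a|^2, which is nonnegative on D and vanishes at (u, v).\<close>
  have stat: "inner b v = m\<^sup>2 * inner a u" if ab: "(a, b) \<in> D" for a b
  proof -
    have ineq: "0 \<le> 2 * s * (inner b v - m\<^sup>2 * inner a u) + s\<^sup>2 * ((norm b)\<^sup>2 - m\<^sup>2 * (norm a)\<^sup>2)" for s
    proof -
      have "(u + s *\<^sub>R a, v + s *\<^sub>R b) \<in> D"
        by (intro complex_linearD(2)[OF Dlin] uvD complex_linearD(5)[OF Dlin] ab)
      then have "(m * norm (u + s *\<^sub>R a))\<^sup>2 \<le> (norm (v + s *\<^sub>R b))\<^sup>2"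
        using m_le m0 by (intro power_mono) auto
      moreover have ex: "(norm (p + s *\<^sub>R q))\<^sup>2 = (norm p)\<^sup>2 + 2 * s * inner q p + s\<^sup>2 * (norm q)\<^sup>2" for p q :: l2
        unfolding power2_norm_eq_inner
        by (simp add: inner_add_left inner_add_right inner_commute[of p q] power2_eq_square ring_distribs)
      ultimately show ?thesis by (simp add: power_mult_distrib nv nu algebra_simps)
    qed
    show ?thesis
    proof (rule ccontr)
      assume neq: "\<not> ?thesis"
      define g where "g = inner b v - m\<^sup>2 * inner a u"
      define h where "h = (norm b)\<^sup>2 - m\<^sup>2 * (norm a)\<^sup>2"
      have g: "g \<noteq> 0" using neq by (simp add: g_def)
      have h: "h \<ge> 0"
        using power_mono[OF m_le[OF ab], of 2] m0 by (simp add: h_def power_mult_distrib)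
      \<comment> \<open>With g nonzero this step length makes the quadratic polynomial in s
        negative; h + 1 in place of h also covers the case h = 0.\<close>
      have "0 \<le> 2 * (- g / (h + 1)) * g + (- g / (h + 1))\<^sup>2 * h"
        using ineq[of "- g / (h + 1)"] by (simp add: g_def h_def)
      also have "\<dots> = g\<^sup>2 / (h + 1)\<^sup>2 * (h - 2 * (h + 1))"
      proof -
        have "2 * (- g / k) * g + (- g / k)\<^sup>2 * h = g\<^sup>2 / k\<^sup>2 * (h - 2 * k)" if "k \<noteq> 0" for k
          using that by (simp add: field_simps power2_eq_square)
        from this[of "h + 1"] h show ?thesis by simp
      qed
      also have "\<dots> < 0" using g h by (intro mult_pos_neg) auto
      finally show False by simp
    qed
  qed
  have "(v, complex_of_real (m\<^sup>2) *\<^sub>C u) \<in> G"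
    unfolding graph_iff
  proof safe
    fix a b assume ab: "(a, b) \<in> G"
    \<comment> \<open>Stationarity tests only against D. An arbitrary pair of G is moved into D by
      removing its eigenvector components, which changes neither side because u and v are orthogonal
      to them.\<close>
    define a' where "a' = a - (\<Sum>\<mu>\<in>M. (cinner a (e \<mu>) / cinner (e \<mu>) (e \<mu>)) *\<^sub>C e \<mu>)"
    define b' where "b' = b - (\<Sum>\<mu>\<in>M. (cinner a (e \<mu>) / cinner (e \<mu>) (e \<mu>)) *\<^sub>C complex_of_real \<mu> *\<^sub>C e \<mu>)"
    have "(a', b') \<in> G"
      unfolding a'_def b'_def
      by (intro complex_linearD(3)[OF linear ab] complex_linear_sum[OF linear] complex_linearD(4)[OF linear] eig)
    moreover have "cinner a' (e \<nu>) = 0" if \<nu>: "\<nu> \<in> M" for \<nu>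
    proof -
      have "cinner (\<Sum>\<mu>\<in>M. (cinner a (e \<mu>) / cinner (e \<mu>) (e \<mu>)) *\<^sub>C e \<mu>) (e \<nu>) =
          (\<Sum>\<mu>\<in>M. if \<mu> = \<nu> then cinner a (e \<nu>) else 0)"
        unfolding cinner_sum_left
      proof (intro sum.cong refl)
        fix \<mu> assume "\<mu> \<in> M"
        then show "cinner ((cinner a (e \<mu>) / cinner (e \<mu>) (e \<mu>)) *\<^sub>C e \<mu>) (e \<nu>) = (if \<mu> = \<nu> then cinner a (e \<nu>) else 0)"
          using eigenvectors_orthogonal[OF eig eig[OF \<nu>], of \<mu>] ne[of \<mu>]
          by (simp add: cinner_scaleC_left cinner_norm)
      qed
      also have "\<dots> = cinner a (e \<nu>)" using fin \<nu> by simp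
      finally show ?thesis by (simp add: a'_def cinner_diff_left)
    qed
    ultimately have D': "(a', b') \<in> D" by (simp add: D_def)
    have "cinner b' v = cinner a' (complex_of_real (m\<^sup>2) *\<^sub>C u)"
    proof (rule complex_eqI)
      show "Re (cinner b' v) = Re (cinner a' (complex_of_real (m\<^sup>2) *\<^sub>C u))"
        using stat[OF D'] by (simp add: cinner_scaleC_right inner_l2_def del: of_real_power)
      have "Im (cinner p q) = - inner (\<i> *\<^sub>C p) q" for p q by (simp add: inner_l2_def cinner_scaleC_left)
      then show "Im (cinner b' v) = Im (cinner a' (complex_of_real (m\<^sup>2) *\<^sub>C u))"
        using stat[OF complex_linearD(4)[OF Dlin D', of \<i>]] by (simp add: scaleC_of_real del: of_real_power)
    qed
    moreover have "cinner b' v = cinner b v"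
    proof -
      have "cinner (e \<mu>) v = 0" if "\<mu> \<in> M" for \<mu> using vorth[OF that] by (subst cinner_commute) simp
      then show ?thesis by (simp add: b'_def cinner_diff_left cinner_sum_left cinner_scaleC_left)
    qed
    moreover have "cinner a' u = cinner a u"
    proof -
      have "cinner (e \<mu>) u = 0" if "\<mu> \<in> M" for \<mu> using uorth[OF that] by (subst cinner_commute) simp
      then show ?thesis by (simp add: a'_def cinner_diff_left cinner_sum_left cinner_scaleC_left)
    qed
    ultimately show "cinner b v = cinner a (complex_of_real (m\<^sup>2) *\<^sub>C u)" by (simp add: cinner_scaleC_right)
  qed
  then have "(v, complex_of_real (m\<^sup>2) *\<^sub>C u) \<in> D" using vorth by (simp add: D_def)
  from complex_linearD(2)[OF Dlin this complex_linearD(4)[OF Dlin uvD, of "complex_of_real m"]]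
  have "(v + complex_of_real m *\<^sub>C u, complex_of_real m *\<^sub>C (v + complex_of_real m *\<^sub>C u)) \<in> D"
    by (simp add: scaleC_algebra power2_eq_square add.commute)
  then have "v + complex_of_real m *\<^sub>C u = 0" using no_eig[of _ m] m0 mt by auto
  then have "v = complex_of_real (- m) *\<^sub>C u"
    unfolding scaleC_of_real by (simp add: eq_neg_iff_add_eq_0)
  then have "u = 0" using no_eig[of u "- m"] uvD m0 mt by auto
  then show False using nu by simp
qed

end


section \<open>Graphs of operators in the space of square summable sequences\<close>

text \<open>Transports an operator on functions to the Hilbert space type. It sees only pairs inside
  \<open>ell2\<close>, which is why statements about it carry an inclusion in
  \<open>ell2 \<times> ell2\<close>.\<close>

definition graph_of :: "oper \<Rightarrow> (l2 \<times> l2) set" where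
  "graph_of A = {(x, y). (seq_of x, seq_of y) \<in> A}"

lemma graph_of_iff: "(x, y) \<in> graph_of A \<longleftrightarrow> (seq_of x, seq_of y) \<in> A"
  by (simp add: graph_of_def)

lemma graph_of_inject:
  assumes "A \<subseteq> ell2 \<times> ell2" "B \<subseteq> ell2 \<times> ell2" "graph_of A = graph_of B"
  shows "A = B"
proof -
  have "(u, v) \<in> A \<longleftrightarrow> (u, v) \<in> B" if "u \<in> ell2" "v \<in> ell2" for u v
    using assms(3) graph_of_iff[of "l2_of u" "l2_of v" A] graph_of_iff[of "l2_of u" "l2_of v" B] that by (simp add: l2_of_inverse)
  then show ?thesis using assms(1,2) by auto
qed

lemma op_closure_subset: "op_closure T \<subseteq> ell2 \<times> ell2"
  by (auto simp: op_closure_def)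

lemma op_adjoint_subset: "op_adjoint T \<subseteq> ell2 \<times> ell2"
  by (auto simp: op_adjoint_def)

lemma graph_of_op_closure:
  assumes "T \<subseteq> ell2 \<times> ell2"
  shows "graph_of (op_closure T) = closure (graph_of T)"
proof -
  have "(x, y) \<in> graph_of (op_closure T) \<longleftrightarrow> (x, y) \<in> closure (graph_of T)" for x y
  proof
    assume "(x, y) \<in> graph_of (op_closure T)"
    then obtain X Y where XY: "\<And>k. (X k, Y k) \<in> T" "(\<lambda>k. ell2_norm (X k - seq_of x)) \<longlonglongrightarrow> 0"
        "(\<lambda>k. ell2_norm (Y k - seq_of y)) \<longlonglongrightarrow> 0"
      by (auto simp: graph_of_def op_closure_def)
    have e: "X k \<in> ell2" "Y k \<in> ell2" for k using XY(1)[of k] assms by auto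
    have lim: "(\<lambda>k. l2_of (Z k)) \<longlonglongrightarrow> z"
      if "\<And>k. Z k \<in> ell2" "(\<lambda>k. ell2_norm (Z k - seq_of z)) \<longlonglongrightarrow> 0" for Z z
    proof -
      have "l2_of (Z k - seq_of z) = l2_of (Z k) - z" for k
        by (rule l2_eqI) (simp add: l2_of_inverse that ell2_minus seq_of)
      then have "ell2_norm (Z k - seq_of z) = norm (l2_of (Z k) - z)" for k
        by (subst ell2_norm_l2_of) (auto simp: that ell2_minus seq_of)
      then show ?thesis using that(2) by (simp add: tendsto_norm_zero_iff LIM_zero_iff)
    qed
    have "(\<lambda>k. (l2_of (X k), l2_of (Y k))) \<longlonglongrightarrow> (x, y)"
      by (intro tendsto_Pair lim e XY)
    moreover have "(l2_of (X k), l2_of (Y k)) \<in> graph_of T" for k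
      using XY(1) e by (simp add: graph_of_def l2_of_inverse)
    ultimately show "(x, y) \<in> closure (graph_of T)"
      unfolding closure_sequential by (intro exI[of _ "\<lambda>k. (l2_of (X k), l2_of (Y k))"]) auto
  next
    assume "(x, y) \<in> closure (graph_of T)"
    then obtain Z where Z: "\<And>k. Z k \<in> graph_of T" "Z \<longlonglongrightarrow> (x, y)" unfolding closure_sequential by blast
    have "(\<lambda>k. norm (fst (Z k) - x)) \<longlonglongrightarrow> 0" "(\<lambda>k. norm (snd (Z k) - y)) \<longlonglongrightarrow> 0"
      using tendsto_fst[OF Z(2)] tendsto_snd[OF Z(2)] by (simp_all add: tendsto_norm_zero_iff LIM_zero_iff)
    moreover have "seq_of (a - b) = seq_of a - seq_of b" for a b by (rule ext) simp
    moreover have "(seq_of (fst (Z k)), seq_of (snd (Z k))) \<in> T" for k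
      using Z(1)[of k] by (simp add: graph_of_def case_prod_beta)
    ultimately have "\<exists>X Y. (\<forall>k. (X k, Y k) \<in> T) \<and> (\<lambda>k. ell2_norm (X k - seq_of x)) \<longlonglongrightarrow> 0 \<and>
        (\<lambda>k. ell2_norm (Y k - seq_of y)) \<longlonglongrightarrow> 0"
      by (rule_tac x = "\<lambda>k. seq_of (fst (Z k))" in exI, rule_tac x = "\<lambda>k. seq_of (snd (Z k))" in exI)
         (auto simp: norm_eq_ell2_norm)
    then show "(x, y) \<in> graph_of (op_closure T)"
      by (simp add: graph_of_def op_closure_def seq_of)
  qed
  then show ?thesis by auto
qed

lemma graph_of_op_adjoint:
  assumes "T \<subseteq> ell2 \<times> ell2"
  shows "graph_of (op_adjoint T) = adjoint_graph (graph_of T)"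
proof -
  have "(v, w) \<in> graph_of (op_adjoint T) \<longleftrightarrow> (v, w) \<in> adjoint_graph (graph_of T)" for v w
  proof
    assume "(v, w) \<in> graph_of (op_adjoint T)"
    then show "(v, w) \<in> adjoint_graph (graph_of T)"
      by (auto simp: graph_of_def op_adjoint_def adjoint_graph_def cinner.rep_eq)
  next
    assume *: "(v, w) \<in> adjoint_graph (graph_of T)"
    have "ell2_inner y (seq_of v) = ell2_inner x (seq_of w)" if xy: "(x, y) \<in> T" for x y
    proof -
      have "x \<in> ell2" "y \<in> ell2" using xy assms by auto
      moreover from this have "(l2_of x, l2_of y) \<in> graph_of T" using xy by (simp add: graph_of_def l2_of_inverse)
      ultimately show ?thesis using * by (auto simp: adjoint_graph_def cinner.rep_eq l2_of_inverse)
    qed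
    then show "(v, w) \<in> graph_of (op_adjoint T)" by (auto simp: graph_of_def op_adjoint_def seq_of)
  qed
  then show ?thesis by auto
qed

lemma adjoint_graph_closure: "adjoint_graph (closure G) = adjoint_graph G"
proof
  show "adjoint_graph (closure G) \<subseteq> adjoint_graph G"
    using closure_subset by (force simp: adjoint_graph_def)
  show "adjoint_graph G \<subseteq> adjoint_graph (closure G)"
  proof
    fix p assume p: "p \<in> adjoint_graph G"
    have "cinner (snd q) (fst p) = cinner (fst q) (snd p)" if q: "q \<in> closure G" for q
    proof -
      obtain Z where Z: "\<And>k. Z k \<in> G" "Z \<longlonglongrightarrow> q" using q unfolding closure_sequential by blast
      have "(\<lambda>k. cinner (snd (Z k)) (fst p)) \<longlonglongrightarrow> cinner (snd q) (fst p)"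
        by (intro tendsto_cinner tendsto_const tendsto_snd Z)
      moreover have "(\<lambda>k. cinner (fst (Z k)) (snd p)) \<longlonglongrightarrow> cinner (fst q) (snd p)"
        by (intro tendsto_cinner tendsto_const tendsto_fst Z)
      moreover have "cinner (snd (Z k)) (fst p) = cinner (fst (Z k)) (snd p)" for k
        using p Z(1)[of k] by (force simp: adjoint_graph_def split: prod.splits)
      ultimately show ?thesis using LIMSEQ_unique by auto
    qed
    then show "p \<in> adjoint_graph (closure G)" by (force simp: adjoint_graph_def split: prod.splits)
  qed
qed

lemma finsupp_bound:
  assumes "u \<in> finsupp"
  obtains N where "\<And>n. n \<ge> N \<Longrightarrow> u n = 0"
proof -
  have fin: "finite {n. u n \<noteq> 0}" using assms by (simp add: finsupp_def)
  then obtain N where "\<forall>n\<in>{n. u n \<noteq> 0}. n < N" using finite_nat_bounded[OF fin] by auto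
  then show ?thesis by (intro that[of N]) (auto simp: not_less[symmetric])
qed

lemma finsuppI: "(\<And>n. n \<ge> N \<Longrightarrow> u n = 0) \<Longrightarrow> u \<in> finsupp"
  unfolding finsupp_def by (auto intro!: finite_subset[of _ "{..<N}"] simp: not_less[symmetric])

lemma cinner_finite:
  assumes "\<And>n. n \<ge> N \<Longrightarrow> seq_of x n = 0"
  shows "cinner x y = (\<Sum>n<N. seq_of x n * cnj (seq_of y n))"
  unfolding cinner_def' by (rule suminf_finite) (use assms in \<open>auto simp: not_less\<close>)

lemma finsupp_dense:
  assumes "e > 0"
  obtains y where "seq_of y \<in> finsupp" "norm (y - x) < e"
proof -
  define t where "t N = l2_of (\<lambda>n. if n < N then seq_of x n else 0)" for N
  have fs: "(\<lambda>n. if n < N then seq_of x n else 0) \<in> finsupp" for N by (rule finsuppI[of N]) auto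
  then have t: "seq_of (t N) = (\<lambda>n. if n < N then seq_of x n else 0)" for N
    using fs[of N] finsupp_subset_ell2 unfolding t_def by (intro l2_of_inverse) auto
  have "(norm (t N - x))\<^sup>2 = (norm x)\<^sup>2 - (\<Sum>n<N. (cmod (seq_of x n))\<^sup>2)" for N
  proof -
    have "(\<lambda>n. (cmod (seq_of x n))\<^sup>2 - (if n \<in> {..<N} then (cmod (seq_of x n))\<^sup>2 else 0)) sums
        ((norm x)\<^sup>2 - (\<Sum>n<N. (cmod (seq_of x n))\<^sup>2))"
      by (intro sums_diff sums_If_finite_set) (auto simp: norm_l2_squared intro: summable_sums summable_norm2)
    also have "(\<lambda>n. (cmod (seq_of x n))\<^sup>2 - (if n \<in> {..<N} then (cmod (seq_of x n))\<^sup>2 else 0)) =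
        (\<lambda>n. (cmod (seq_of (t N - x) n))\<^sup>2)" by (auto simp: t)
    finally show ?thesis by (simp add: norm_l2_squared sums_iff)
  qed
  moreover have "(\<lambda>N. (norm x)\<^sup>2 - (\<Sum>n<N. (cmod (seq_of x n))\<^sup>2)) \<longlonglongrightarrow> (norm x)\<^sup>2 - (norm x)\<^sup>2"
    unfolding norm_l2_squared by (intro tendsto_intros summable_LIMSEQ summable_norm2)
  ultimately have "(\<lambda>N. (norm (t N - x))\<^sup>2) \<longlonglongrightarrow> 0" by simp
  from order_tendstoD(2)[OF this, of "e\<^sup>2"] obtain N where "(norm (t N - x))\<^sup>2 < e\<^sup>2"
    using assms unfolding eventually_sequentially by auto
  then have "norm (t N - x) < e" using assms by (simp add: power2_less_imp_less)
  then show ?thesis using that[of "t N"] fs by (simp add: t)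
qed


section \<open>The difference expression and the orthogonal polynomials\<close>

text \<open>\<open>jacobi_apply\<close> sums over the support and has its meaning only when that is
  finite. The three-term expression acts on every sequence, as is needed for elements of the maximal
  domain and for solutions that need not be square summable.\<close>

definition jacobi_diff :: "(nat \<Rightarrow> real) \<Rightarrow> (nat \<Rightarrow> real) \<Rightarrow> cseq \<Rightarrow> cseq" where
  "jacobi_diff \<rho> q u n = (case n of 0 \<Rightarrow> 0 | Suc m \<Rightarrow> complex_of_real (\<rho> m) * u m) +
     complex_of_real (q n) * u n + complex_of_real (\<rho> n) * u (Suc n)"

lemma jacobi_diff_simps:
  "jacobi_diff \<rho> q u 0 = complex_of_real (q 0) * u 0 + complex_of_real (\<rho> 0) * u (Suc 0)"
  "jacobi_diff \<rho> q u (Suc n) = complex_of_real (\<rho> n) * u n + complex_of_real (q (Suc n)) * u (Suc n) +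
     complex_of_real (\<rho> (Suc n)) * u (Suc (Suc n))"
  by (simp_all add: jacobi_diff_def)

lemma jacobi_apply_finsupp:
  assumes "u \<in> finsupp"
  shows "jacobi_apply \<rho> q u = jacobi_diff \<rho> q u"
proof
  fix i
  have fin: "finite {j. u j \<noteq> 0}" using assms by (simp add: finsupp_def)
  show "jacobi_apply \<rho> q u i = jacobi_diff \<rho> q u i"
  proof (cases i)
    case 0
    have "jacobi_apply \<rho> q u i = (\<Sum>j\<in>{0, 1}. complex_of_real (jacobi_entry \<rho> q i j) * u j)"
      unfolding jacobi_apply_def by (rule sum.mono_neutral_cong) (auto simp: fin 0 jacobi_entry_def)
    then show ?thesis by (simp add: 0 jacobi_diff_simps jacobi_entry_def)
  next
    case (Suc m)
    have "jacobi_apply \<rho> q u i = (\<Sum>j\<in>{m, Suc m, Suc (Suc m)}. complex_of_real (jacobi_entry \<rho> q i j) * u j)"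
      unfolding jacobi_apply_def by (rule sum.mono_neutral_cong) (auto simp: fin Suc jacobi_entry_def)
    then show ?thesis by (simp add: Suc jacobi_diff_simps jacobi_entry_def)
  qed
qed

lemma jacobi_diff_finsupp:
  assumes "u \<in> finsupp"
  shows "jacobi_diff \<rho> q u \<in> finsupp"
proof -
  obtain N where N: "\<And>n. n \<ge> N \<Longrightarrow> u n = 0" using finsupp_bound[OF assms] by blast
  show ?thesis
    by (rule finsuppI[of "Suc N"]) (auto simp: jacobi_diff_def N split: nat.splits)
qed

lemma jacobi_diff_scale: "jacobi_diff \<rho> q (\<lambda>n. c * u n) k = c * jacobi_diff \<rho> q u k"
  by (simp add: jacobi_diff_def algebra_simps split: nat.splits)

section \<open>Minimal and maximal operators\<close>

lemma green_identity:
  "(\<Sum>k<Suc n. jacobi_diff \<rho> q u k * cnj (v k) - u k * cnj (jacobi_diff \<rho> q v k)) =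
     complex_of_real (\<rho> n) * (u (Suc n) * cnj (v n) - u n * cnj (v (Suc n)))"
  by (induction n) (simp_all add: jacobi_diff_simps algebra_simps)

text \<open>That J x is square summable is expressed by the type of y.\<close>

definition maximal_graph :: "(nat \<Rightarrow> real) \<Rightarrow> (nat \<Rightarrow> real) \<Rightarrow> (l2 \<times> l2) set" where
  "maximal_graph \<rho> q = {(x, y). seq_of y = jacobi_diff \<rho> q (seq_of x)}"

definition minimal_graph :: "(nat \<Rightarrow> real) \<Rightarrow> (nat \<Rightarrow> real) \<Rightarrow> (l2 \<times> l2) set" where
  "minimal_graph \<rho> q = {(x, y) \<in> maximal_graph \<rho> q. seq_of x \<in> finsupp}"

lemma adjoint_minimal_graph: "adjoint_graph (minimal_graph \<rho> q) = maximal_graph \<rho> q"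
proof -
  have green: "\<exists>N. (\<forall>n\<ge>N. seq_of x n = 0 \<and> seq_of y n = 0) \<and>
      (\<Sum>k<N. seq_of y k * cnj (v k)) = (\<Sum>k<N. seq_of x k * cnj (jacobi_diff \<rho> q v k))"
    if xy: "(x, y) \<in> minimal_graph \<rho> q" for x y v
  proof -
    have y: "seq_of y = jacobi_diff \<rho> q (seq_of x)" and x: "seq_of x \<in> finsupp"
      using xy by (auto simp: minimal_graph_def maximal_graph_def)
    obtain N where N: "\<And>n. n \<ge> N \<Longrightarrow> seq_of x n = 0" using finsupp_bound[OF x] by blast
    obtain M where M: "\<And>n. n \<ge> M \<Longrightarrow> seq_of y n = 0"
      using finsupp_bound[OF jacobi_diff_finsupp[OF x]] unfolding y by blast
    have "(\<Sum>k<Suc (max N M). seq_of y k * cnj (v k) - seq_of x k * cnj (jacobi_diff \<rho> q v k)) = 0"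
      unfolding y green_identity by (simp add: N)
    then show ?thesis
      by (intro exI[of _ "Suc (max N M)"]) (auto simp: N M sum_subtractf)
  qed
  have "(v, w) \<in> adjoint_graph (minimal_graph \<rho> q) \<longleftrightarrow> seq_of w = jacobi_diff \<rho> q (seq_of v)" for v w
  proof
    assume *: "(v, w) \<in> adjoint_graph (minimal_graph \<rho> q)"
    show "seq_of w = jacobi_diff \<rho> q (seq_of v)"
    proof
      fix m
      \<comment> \<open>Testing the adjoint relation with the m-th unit vector reads off coordinate
        m.\<close>
      define d :: cseq where "d n = (if n = m then 1 else 0)" for n
      have d: "d \<in> finsupp" by (rule finsuppI[of "Suc m"]) (auto simp: d_def)
      have d2: "d \<in> ell2" "jacobi_diff \<rho> q d \<in> ell2"
        using d jacobi_diff_finsupp[OF d] finsupp_subset_ell2 by auto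
      have mem: "(l2_of d, l2_of (jacobi_diff \<rho> q d)) \<in> minimal_graph \<rho> q"
        using d by (simp add: minimal_graph_def maximal_graph_def l2_of_inverse d2)
      from green[OF this, of "seq_of v"] obtain N where
        N: "\<And>n. n \<ge> N \<Longrightarrow> d n = 0" "\<And>n. n \<ge> N \<Longrightarrow> jacobi_diff \<rho> q d n = 0"
          "(\<Sum>k<N. jacobi_diff \<rho> q d k * cnj (seq_of v k)) = (\<Sum>k<N. d k * cnj (jacobi_diff \<rho> q (seq_of v) k))"
        by (auto simp: l2_of_inverse d2)
      have mN: "m < N" using N(1)[of m] by (force simp: d_def)
      have ds: "(\<Sum>k<N. d k * f k) = f m" for f
      proof -
        have "(\<Sum>k<N. d k * f k) = (\<Sum>k<N. if k = m then f m else 0)" by (intro sum.cong) (auto simp: d_def)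
        also have "\<dots> = f m" using mN by simp
        finally show ?thesis .
      qed
      have "cinner (l2_of (jacobi_diff \<rho> q d)) v = cinner (l2_of d) w"
        using * mem by (auto simp: adjoint_graph_def)
      then have "cnj (jacobi_diff \<rho> q (seq_of v) m) = cnj (seq_of w m)"
        using N by (simp add: cinner_finite[of N] l2_of_inverse d2 ds)
      then show "seq_of w m = jacobi_diff \<rho> q (seq_of v) m" by simp
    qed
  next
    assume w: "seq_of w = jacobi_diff \<rho> q (seq_of v)"
    have "cinner y v = cinner x w" if xy: "(x, y) \<in> minimal_graph \<rho> q" for x y
    proof -
      obtain N where "\<And>n. n \<ge> N \<Longrightarrow> seq_of x n = 0" "\<And>n. n \<ge> N \<Longrightarrow> seq_of y n = 0"
          "(\<Sum>k<N. seq_of y k * cnj (seq_of v k)) = (\<Sum>k<N. seq_of x k * cnj (jacobi_diff \<rho> q (seq_of v) k))"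
        using green[OF xy, of "seq_of v"] by blast
      then show ?thesis by (simp add: cinner_finite[of N] w)
    qed
    then show "(v, w) \<in> adjoint_graph (minimal_graph \<rho> q)" by (auto simp: adjoint_graph_def)
  qed
  then show ?thesis by (auto simp: maximal_graph_def)
qed

lemma minimal_subset_maximal: "minimal_graph \<rho> q \<subseteq> maximal_graph \<rho> q"
  by (auto simp: minimal_graph_def)

lemma finite_operator_subset: "{(u, jacobi_apply \<rho> q u) |u. u \<in> finsupp} \<subseteq> ell2 \<times> ell2"
  using finsupp_subset_ell2 jacobi_diff_finsupp by (force simp: jacobi_apply_finsupp)

lemma graph_of_finite_operator: "graph_of {(u, jacobi_apply \<rho> q u) |u. u \<in> finsupp} = minimal_graph \<rho> q"
  by (auto simp: graph_of_def minimal_graph_def maximal_graph_def jacobi_apply_finsupp)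

lemma graph_of_jacobi_op: "graph_of (jacobi_op \<rho> q) = closure (minimal_graph \<rho> q)"
  unfolding jacobi_op_def by (simp add: graph_of_op_closure finite_operator_subset graph_of_finite_operator)

lemma jacobi_op_subset: "jacobi_op \<rho> q \<subseteq> ell2 \<times> ell2"
  unfolding jacobi_op_def by (rule op_closure_subset)

lemma graph_of_adjoint_jacobi_op: "graph_of (op_adjoint (jacobi_op \<rho> q)) = maximal_graph \<rho> q"
  by (simp add: graph_of_op_adjoint jacobi_op_subset graph_of_jacobi_op adjoint_graph_closure adjoint_minimal_graph)

text \<open>Taking adjoints reverses inclusions, so a selfadjoint extension of the minimal operator
  is contained in its adjoint, the maximal operator. Estimates on the maximal graph therefore hold
  for every extension at once.\<close>

lemma canonical_extensionD:
  assumes "canonical_extension \<rho> q A"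
  shows "A \<subseteq> ell2 \<times> ell2" "adjoint_graph (graph_of A) = graph_of A"
    "minimal_graph \<rho> q \<subseteq> graph_of A" "graph_of A \<subseteq> maximal_graph \<rho> q"
proof -
  have A: "op_adjoint A = A" "jacobi_op \<rho> q \<subseteq> A"
    using assms by (auto simp: canonical_extension_def selfadjoint_def)
  show sub: "A \<subseteq> ell2 \<times> ell2" using op_adjoint_subset[of A] A by simp
  show adj: "adjoint_graph (graph_of A) = graph_of A"
    using graph_of_op_adjoint[OF sub] A(1) by simp
  have "graph_of (jacobi_op \<rho> q) \<subseteq> graph_of A" using A(2) by (auto simp: graph_of_def)
  then show min: "minimal_graph \<rho> q \<subseteq> graph_of A"
    using closure_subset[of "minimal_graph \<rho> q"] by (simp add: graph_of_jacobi_op)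
  then have "adjoint_graph (graph_of A) \<subseteq> adjoint_graph (minimal_graph \<rho> q)"
    by (force simp: adjoint_graph_def)
  then show "graph_of A \<subseteq> maximal_graph \<rho> q" by (simp add: adj adjoint_minimal_graph)
qed

text \<open>The orthonormal polynomials of the matrix, normalized by p_0 = 1. Complex coefficients
  are chosen because they are evaluated at i and split into linear factors.\<close>

fun jacobi_poly :: "(nat \<Rightarrow> real) \<Rightarrow> (nat \<Rightarrow> real) \<Rightarrow> nat \<Rightarrow> complex poly" where
  "jacobi_poly \<rho> q 0 = 1"
| "jacobi_poly \<rho> q (Suc 0) = smult (1 / complex_of_real (\<rho> 0)) [:- complex_of_real (q 0), 1:]"
| "jacobi_poly \<rho> q (Suc (Suc n)) = smult (1 / complex_of_real (\<rho> (Suc n)))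
     ([:- complex_of_real (q (Suc n)), 1:] * jacobi_poly \<rho> q (Suc n) -
      smult (complex_of_real (\<rho> n)) (jacobi_poly \<rho> q n))"

section \<open>Solutions of the recurrence, defect spaces and selfadjointness\<close>

locale jacobi =
  fixes \<rho> q :: "nat \<Rightarrow> real"
  assumes \<rho>_pos: "\<rho> n > 0"
begin

abbreviation "J \<equiv> jacobi_diff \<rho> q"

definition sol :: "complex \<Rightarrow> cseq" where
  "sol z n = poly (jacobi_poly \<rho> q n) z"

lemma \<rho>_ne: "\<rho> n \<noteq> 0"
  using \<rho>_pos[of n] by simp

lemma sol_0 [simp]: "sol z 0 = 1"
  by (simp add: sol_def)

lemma J_sol: "J (sol z) n = z * sol z n"
  by (cases n) (auto simp: jacobi_diff_simps sol_def \<rho>_ne field_simps)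

text \<open>Row 0 has no left neighbour and all \<rho>_n are nonzero, so each row determines the
  next entry and u_0 determines everything.\<close>

lemma solution_unique:
  assumes "\<And>n. J u n = z * u n"
  shows "u n = u 0 * sol z n"
proof -
  have "u n = u 0 * sol z n \<and> u (Suc n) = u 0 * sol z (Suc n)"
  proof (induction n)
    case 0
    have "complex_of_real (\<rho> 0) * u 1 = u 0 * (z - complex_of_real (q 0))"
      using assms[of 0] by (simp add: jacobi_diff_simps algebra_simps)
    also have "z - complex_of_real (q 0) = complex_of_real (\<rho> 0) * sol z 1"
      using J_sol[of z 0] by (simp add: jacobi_diff_simps algebra_simps)
    finally show ?case using \<rho>_ne by simp
  next
    case (Suc n)
    have "complex_of_real (\<rho> (Suc n)) * u (Suc (Suc n)) =
        (z - complex_of_real (q (Suc n))) * u (Suc n) - complex_of_real (\<rho> n) * u n"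
      using assms[of "Suc n"] by (simp add: jacobi_diff_simps algebra_simps)
    also have "\<dots> = u 0 * ((z - complex_of_real (q (Suc n))) * sol z (Suc n) - complex_of_real (\<rho> n) * sol z n)"
      using Suc by (simp add: algebra_simps)
    also have "(z - complex_of_real (q (Suc n))) * sol z (Suc n) - complex_of_real (\<rho> n) * sol z n =
        complex_of_real (\<rho> (Suc n)) * sol z (Suc (Suc n))"
      using J_sol[of z "Suc n"] by (simp add: jacobi_diff_simps algebra_simps)
    finally show ?case using \<rho>_ne Suc by simp
  qed
  then show ?thesis by simp
qed

lemma cnj_sol: "cnj (sol z n) = sol (cnj z) n"
proof -
  have "J (\<lambda>n. cnj (sol z n)) n = cnj (J (sol z) n)" for n
    by (simp add: jacobi_diff_def split: nat.splits)
  then have "J (\<lambda>n. cnj (sol z n)) n = cnj z * cnj (sol z n)" for n by (simp add: J_sol)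
  from solution_unique[OF this, of n] show ?thesis by simp
qed

text \<open>Green's identity for p(x) and the conjugate of p(y). As the coefficients are real, the
  latter is again a solution, at the conjugate point.\<close>

lemma christoffel_darboux:
  "(x - y) * (\<Sum>k<Suc n. sol x k * sol y k) =
     complex_of_real (\<rho> n) * (sol x (Suc n) * sol y n - sol x n * sol y (Suc n))"
  using green_identity[of \<rho> q "sol x" "sol (cnj y)" n]
  by (simp add: J_sol cnj_sol sum_distrib_left algebra_simps sum_subtractf)

text \<open>The Christoffel-Darboux formula at i and -i has 2 i times the sum of squares on the
  left. It bounds consecutive values from below, since the sum contains |p_0|^2 = 1; both limit
  point criteria rest on this.\<close>

lemma sum_sol_i: "(\<Sum>k<Suc n. (cmod (sol \<i> k))\<^sup>2) \<le> \<rho> n * cmod (sol \<i> (Suc n)) * cmod (sol \<i> n)"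
proof -
  let ?s = "\<Sum>k<Suc n. (cmod (sol \<i> k))\<^sup>2"
  have "2 * \<i> * complex_of_real ?s =
      complex_of_real (\<rho> n) * (sol \<i> (Suc n) * sol (-\<i>) n - sol \<i> n * sol (-\<i>) (Suc n))"
  proof -
    have "sol (-\<i>) k = cnj (sol \<i> k)" for k by (simp add: cnj_sol)
    then have "complex_of_real ?s = (\<Sum>k<Suc n. sol \<i> k * sol (-\<i>) k)"
      by (simp only: of_real_sum complex_norm_square)
    then show ?thesis using christoffel_darboux[of \<i> "-\<i>" n] by simp
  qed
  then have "2 * ?s = cmod (complex_of_real (\<rho> n) * (sol \<i> (Suc n) * sol (-\<i>) n - sol \<i> n * sol (-\<i>) (Suc n)))"
  proof -
    have "cmod (2 * \<i> * complex_of_real s) = 2 * s" if "s \<ge> 0" for s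
      using that by (simp add: norm_mult)
    from this[of ?s] show ?thesis
      unfolding \<open>2 * \<i> * complex_of_real ?s = _\<close> by (simp add: sum_nonneg)
  qed
  also have "\<dots> \<le> \<rho> n * (2 * (cmod (sol \<i> (Suc n)) * cmod (sol \<i> n)))"
  proof -
    have "cmod (sol (-\<i>) k) = cmod (sol \<i> k)" for k
      using arg_cong[OF cnj_sol[of \<i> k], of cmod] by simp
    then have "cmod (sol \<i> (Suc n) * sol (-\<i>) n - sol \<i> n * sol (-\<i>) (Suc n)) \<le>
        2 * (cmod (sol \<i> (Suc n)) * cmod (sol \<i> n))"
      using norm_triangle_ineq4[of "sol \<i> (Suc n) * sol (-\<i>) n" "sol \<i> n * sol (-\<i>) (Suc n)"]
      by (simp add: norm_mult mult.commute)
    then show ?thesis using \<rho>_pos[of n] by (simp add: norm_mult)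
  qed
  finally show ?thesis by simp
qed

lemma one_le_sol_i: "1 \<le> \<rho> n * cmod (sol \<i> (Suc n)) * cmod (sol \<i> n)"
proof -
  have "1 = (\<Sum>k\<in>{0}. (cmod (sol \<i> k))\<^sup>2)" by simp
  also have "\<dots> \<le> (\<Sum>k<Suc n. (cmod (sol \<i> k))\<^sup>2)" by (intro sum_mono2) auto
  finally show ?thesis using sum_sol_i[of n] by linarith
qed

text \<open>The adjoint is the maximal operator, whose eigenvectors at z are the square summable
  multiples of p(z).\<close>

lemma kernel_eq: "op_kernel (op_adjoint (jacobi_op \<rho> q)) z =
  (if sol z \<in> ell2 then range (\<lambda>c. cseq_scale c (sol z)) else {0})"
proof -
  have mem: "u \<in> op_kernel (op_adjoint (jacobi_op \<rho> q)) z \<longleftrightarrow> u \<in> ell2 \<and> (\<forall>n. J u n = z * u n)" for u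
  proof (cases "u \<in> ell2")
    case True
    have "(u, cseq_scale z u) \<in> op_adjoint (jacobi_op \<rho> q) \<longleftrightarrow>
        (l2_of u, l2_of (cseq_scale z u)) \<in> graph_of (op_adjoint (jacobi_op \<rho> q))"
      by (simp add: graph_of_def l2_of_inverse True ell2_scale)
    also have "\<dots> \<longleftrightarrow> (\<forall>n. J u n = z * u n)"
      unfolding graph_of_adjoint_jacobi_op
      by (simp add: maximal_graph_def l2_of_inverse True ell2_scale) (auto simp: cseq_scale_def fun_eq_iff)
    finally show ?thesis using True by (simp add: op_kernel_def)
  next
    case False
    then show ?thesis using op_adjoint_subset[of "jacobi_op \<rho> q"] by (auto simp: op_kernel_def)
  qed
  have sol: "J (cseq_scale c (sol z)) n = z * cseq_scale c (sol z) n" for c n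
    by (simp add: cseq_scale_def jacobi_diff_scale J_sol)
  have uniq: "u = cseq_scale (u 0) (sol z)" if "\<forall>n. J u n = z * u n" for u
    by (rule ext, unfold cseq_scale_def, rule solution_unique) (use that in auto)
  show ?thesis
  proof (cases "sol z \<in> ell2")
    case True
    have "u \<in> range (\<lambda>c. cseq_scale c (sol z))" if "\<forall>n. J u n = z * u n" for u
      using uniq[OF that] by blast
    then have "op_kernel (op_adjoint (jacobi_op \<rho> q)) z = range (\<lambda>c. cseq_scale c (sol z))"
      using True by (auto simp: mem sol ell2_scale)
    then show ?thesis using True by simp
  next
    case False
    have "u = 0" if u: "u \<in> ell2" "\<forall>n. J u n = z * u n" for u
    proof (rule ccontr)
      assume "u \<noteq> 0"
      have sc: "u n = u 0 * sol z n" for n by (rule solution_unique) (use u in auto)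
      have nz: "u 0 \<noteq> 0"
      proof
        assume "u 0 = 0"
        then have "u n = 0" for n using sc[of n] by simp
        then show False using \<open>u \<noteq> 0\<close> by auto
      qed
      have "sol z n = 1 / u 0 * u n" for n using sc[of n] nz by (simp add: field_simps)
      then have "sol z = cseq_scale (1 / u 0) u" by (auto simp: cseq_scale_def)
      then show False using False ell2_scale[OF u(1)] by metis
    qed
    moreover have "J 0 n = z * 0 n" for n by (simp add: jacobi_diff_def split: nat.splits)
    ultimately have "op_kernel (op_adjoint (jacobi_op \<rho> q)) z = {0}" by (auto simp: mem ell2_zero)
    then show ?thesis using False by simp
  qed
qed

lemma sol_ne_0: "sol z \<noteq> 0"
  using sol_0[of z] by (metis zero_fun_apply zero_neq_one)

lemma dim_kernel: "cseq.dim (op_kernel (op_adjoint (jacobi_op \<rho> q)) z) = (if sol z \<in> ell2 then 1 else 0)"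
proof (cases "sol z \<in> ell2")
  case True
  have "cseq.dim (range (\<lambda>c. cseq_scale c (sol z))) = card {sol z}"
    by (rule cseq.dim_eq_card)
       (simp_all add: cseq.span_singleton[symmetric] cseq.span_span sol_ne_0)
  then show ?thesis using True by (simp add: kernel_eq)
next
  case False
  have "cseq.dim {0} = card ({} :: cseq set)" by (rule cseq.dim_eq_card) (simp_all add: cseq.independent_empty)
  then show ?thesis using False by (simp add: kernel_eq)
qed

text \<open>Conjugation exchanges p(i) and p(-i), so both defect numbers are 1 or both are
  0.\<close>

lemma limit_circle_iff: "limit_circle \<rho> q \<longleftrightarrow> sol \<i> \<in> ell2"
proof -
  have "sol (-\<i>) = (\<lambda>n. cnj (sol \<i> n))" by (simp add: cnj_sol)
  then have "sol (-\<i>) \<in> ell2 \<longleftrightarrow> sol \<i> \<in> ell2" by (simp add: ell2_def)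
  then show ?thesis by (simp add: limit_circle_def defect_index_def dim_kernel)
qed

text \<open>The closure of the minimal graph has the maximal graph as adjoint, whose kernels at i
  and -i are trivial if p(i) is not square summable. Von Neumann's criterion applies.\<close>

lemma limit_point_of_not_ell2:
  assumes "sol \<i> \<notin> ell2"
  shows "limit_point \<rho> q"
proof -
  let ?G = "closure (minimal_graph \<rho> q)"
  have sol': "sol (-\<i>) \<notin> ell2"
  proof -
    have "sol (-\<i>) = (\<lambda>n. cnj (sol \<i> n))" by (simp add: cnj_sol)
    then show ?thesis using assms by (simp add: ell2_def)
  qed
  have ker: "w = 0" if "(w, z *\<^sub>C w) \<in> maximal_graph \<rho> q" "sol z \<notin> ell2" for w z
  proof -
    have "\<And>n. J (seq_of w) n = z * seq_of w n" using that(1) by (auto simp: maximal_graph_def fun_eq_iff)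
    from solution_unique[OF this] have w: "\<And>n. seq_of w n = seq_of w 0 * sol z n" .
    have "seq_of w 0 = 0"
    proof (rule ccontr)
      assume nz: "seq_of w 0 \<noteq> 0"
      have "sol z n = (1 / seq_of w 0) * seq_of w n" for n
        using w[of n] nz by (simp add: field_simps)
      then have "sol z = seq_of ((1 / seq_of w 0) *\<^sub>C w)"
        by (intro ext) simp
      then show False using that(2) seq_of by metis
    qed
    then have "seq_of w n = 0" for n using w[of n] by simp
    then show ?thesis by (intro l2_eqI) simp
  qed
  have adj: "adjoint_graph ?G = maximal_graph \<rho> q" by (simp add: adjoint_graph_closure adjoint_minimal_graph)
  have lin0: "complex_linear (minimal_graph \<rho> q)"
  proof -
    have "complex_linear (maximal_graph \<rho> q)"
      using complex_linear_adjoint_graph[of "minimal_graph \<rho> q"] by (simp add: adjoint_minimal_graph)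
    moreover have "(\<lambda>n. u n + c * v n) \<in> finsupp" if uv: "u \<in> finsupp" "v \<in> finsupp" for u v c
    proof -
      obtain N M where "\<And>n. n \<ge> N \<Longrightarrow> u n = 0" "\<And>n. n \<ge> M \<Longrightarrow> v n = 0"
        using finsupp_bound[OF uv(1)] finsupp_bound[OF uv(2)] by metis
      then show ?thesis by (intro finsuppI[of "max N M"]) simp
    qed
    moreover have "seq_of (x + c *\<^sub>C y) = (\<lambda>n. seq_of x n + c * seq_of y n)" for x y c by auto
    moreover have "seq_of 0 \<in> finsupp" by (rule finsuppI[of 0]) simp
    ultimately show ?thesis unfolding complex_linear_def minimal_graph_def by auto
  qed
  have "complex_linear ?G"
    unfolding complex_linear_def
  proof (intro conjI allI impI)
    show "(0, 0) \<in> ?G" using lin0 closure_subset by (force simp: complex_linear_def)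
    fix x y x' y' c assume "(x, y) \<in> ?G" "(x', y') \<in> ?G"
    then obtain Z Z' where Z: "\<And>k. Z k \<in> minimal_graph \<rho> q" "Z \<longlonglongrightarrow> (x, y)"
        "\<And>k. Z' k \<in> minimal_graph \<rho> q" "Z' \<longlonglongrightarrow> (x', y')"
      unfolding closure_sequential by metis
    have "(\<lambda>k. (fst (Z k) + c *\<^sub>C fst (Z' k), snd (Z k) + c *\<^sub>C snd (Z' k))) \<longlonglongrightarrow> (x + c *\<^sub>C x', y + c *\<^sub>C y')"
      using tendsto_fst[OF Z(2)] tendsto_snd[OF Z(2)] tendsto_fst[OF Z(4)] tendsto_snd[OF Z(4)]
      by (intro tendsto_Pair tendsto_add tendsto_scaleC) simp_all
    moreover have "(fst (Z k) + c *\<^sub>C fst (Z' k), snd (Z k) + c *\<^sub>C snd (Z' k)) \<in> minimal_graph \<rho> q" for k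
      using lin0 Z(1)[of k] Z(3)[of k] unfolding complex_linear_def by (metis prod.collapse)
    ultimately show "(x + c *\<^sub>C x', y + c *\<^sub>C y') \<in> ?G"
      unfolding closure_sequential
      by (intro exI[of _ "\<lambda>k. (fst (Z k) + c *\<^sub>C fst (Z' k), snd (Z k) + c *\<^sub>C snd (Z' k))"]) auto
  qed
  moreover have "?G \<subseteq> adjoint_graph ?G"
    unfolding adj
    by (rule closure_minimal[OF minimal_subset_maximal]) (metis closed_adjoint_graph adjoint_minimal_graph)
  ultimately have "adjoint_graph ?G = ?G"
    using ker[of _ \<i>] ker[of _ "-\<i>"] assms sol' by (intro adjoint_eq_of_trivial_kernels) (auto simp: adj)
  then have "graph_of (op_adjoint (jacobi_op \<rho> q)) = graph_of (jacobi_op \<rho> q)"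
    by (simp add: graph_of_adjoint_jacobi_op graph_of_jacobi_op adj)
  then have "op_adjoint (jacobi_op \<rho> q) = jacobi_op \<rho> q"
    by (intro graph_of_inject op_adjoint_subset jacobi_op_subset)
  moreover have "densely_defined (jacobi_op \<rho> q)"
    unfolding densely_defined_def
  proof (intro ballI allI impI)
    fix u :: cseq and e :: real assume u: "u \<in> ell2" and e: "e > 0"
    obtain y where y: "seq_of y \<in> finsupp" "norm (y - l2_of u) < e" using finsupp_dense[OF e] by blast
    have "jacobi_diff \<rho> q (seq_of y) \<in> ell2"
      using jacobi_diff_finsupp[OF y(1)] finsupp_subset_ell2 by auto
    then have "(y, l2_of (J (seq_of y))) \<in> minimal_graph \<rho> q"
      using y(1) by (simp add: minimal_graph_def maximal_graph_def l2_of_inverse)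
    then have "(y, l2_of (J (seq_of y))) \<in> graph_of (jacobi_op \<rho> q)"
      using closure_subset by (force simp: graph_of_jacobi_op)
    then have "seq_of y \<in> Domain (jacobi_op \<rho> q)" by (auto simp: graph_of_def)
    moreover have "ell2_norm (seq_of y - u) < e"
    proof -
      have "seq_of y - u = seq_of (y - l2_of u)" by (rule ext) (simp add: l2_of_inverse u)
      then show ?thesis using y(2) by (simp add: norm_eq_ell2_norm)
    qed
    ultimately show "\<exists>x\<in>Domain (jacobi_op \<rho> q). x \<in> ell2 \<and> ell2_norm (x - u) < e"
      using seq_of by blast
  qed
  ultimately show ?thesis by (simp add: limit_point_def selfadjoint_def)
qed

end


section \<open>Counting eigenvalues\<close>

text \<open>Fewer homogeneous equations than unknowns, by Gaussian elimination. All eigenvalue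
  counts reduce to this: a span of large dimension contains a nonzero vector obeying a smaller
  number of conditions.\<close>

lemma nontrivial_solution_exists:
  fixes f :: "'i \<Rightarrow> 'j \<Rightarrow> 'a :: field"
  assumes "finite Z" "finite I" "card Z < card I"
  shows "\<exists>c. (\<exists>i\<in>I. c i \<noteq> 0) \<and> (\<forall>z\<in>Z. (\<Sum>i\<in>I. c i * f i z) = 0)"
  using assms
proof (induction Z arbitrary: I f rule: finite_induct)
  case empty
  then have "I \<noteq> {}" by auto
  then show ?case by (intro exI[of _ "\<lambda>_. 1"]) auto
next
  case (insert z Z)
  show ?case
  proof (cases "\<forall>i\<in>I. f i z = 0")
    case True
    obtain c where "\<exists>i\<in>I. c i \<noteq> 0" "\<forall>w\<in>Z. (\<Sum>i\<in>I. c i * f i w) = 0"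
      using insert.IH[of I f] insert.prems insert.hyps by auto
    then show ?thesis using True by (intro exI[of _ c]) auto
  next
    case False
    then obtain i0 where i0: "i0 \<in> I" "f i0 z \<noteq> 0" by auto
    let ?I = "I - {i0}"
    have "finite ?I" "card Z < card ?I" using insert.prems insert.hyps i0 by auto
    then obtain c where c: "\<exists>i\<in>?I. c i \<noteq> 0" "\<forall>w\<in>Z. (\<Sum>i\<in>?I. c i * (f i w - f i z / f i0 z * f i0 w)) = 0"
      using insert.IH[of ?I "\<lambda>i w. f i w - f i z / f i0 z * f i0 w"] by blast
    \<comment> \<open>The pivot coefficient is chosen to satisfy the equation at z; the others solve
      the system from which the pivot has been eliminated.\<close>
    define d where "d i = (if i = i0 then - (\<Sum>i\<in>?I. c i * f i z) / f i0 z else c i)" for i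
    have sum: "(\<Sum>i\<in>I. d i * f i w) = (\<Sum>i\<in>?I. c i * f i w) - (\<Sum>i\<in>?I. c i * f i z) / f i0 z * f i0 w" for w
    proof -
      have "(\<Sum>i\<in>I. d i * f i w) = d i0 * f i0 w + (\<Sum>i\<in>?I. d i * f i w)"
        using insert.prems i0 by (simp add: sum.remove)
      also have "(\<Sum>i\<in>?I. d i * f i w) = (\<Sum>i\<in>?I. c i * f i w)" by (intro sum.cong) (auto simp: d_def)
      finally show ?thesis by (simp add: d_def)
    qed
    have "(\<Sum>i\<in>I. d i * f i w) = 0" if w: "w \<in> Z" for w
    proof -
      have "(\<Sum>i\<in>I. d i * f i w) = (\<Sum>i\<in>?I. c i * (f i w - f i z / f i0 z * f i0 w))"
        unfolding sum by (simp add: algebra_simps sum_subtractf sum_distrib_left sum_divide_distrib)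
      then show ?thesis using c(2) w by simp
    qed
    moreover have "(\<Sum>i\<in>I. d i * f i z) = 0" unfolding sum using i0 by simp
    moreover have "\<exists>i\<in>I. d i \<noteq> 0" using c(1) by (auto simp: d_def)
    ultimately show ?thesis by blast
  qed
qed

text \<open>Peeling off the largest value: if it is the (m + 1)-st, the counting bound gives m + 1
  \<le> L f^\<gamma> + 1, hence f \<ge> (m / L)^(1/\<gamma>). The counting bound says nothing below
  t0, so j0 of the factors are bounded only by 1.\<close>

lemma prod_ge_of_counting:
  fixes f :: "'i \<Rightarrow> real"
  assumes "finite \<Lambda>" "\<And>i. i \<in> \<Lambda> \<Longrightarrow> f i \<ge> 1" "L > 0" "\<gamma> > 0"
    and "\<And>t. t \<ge> t0 \<Longrightarrow> real (card {i \<in> \<Lambda>. f i \<le> t}) \<le> L * t powr \<gamma> + 1"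
    and "card {i \<in> \<Lambda>. f i \<le> t0} \<le> j0"
  shows "(\<Prod>j=j0..<card \<Lambda>. (real j / L) powr (1 / \<gamma>)) \<le> (\<Prod>i\<in>\<Lambda>. f i)"
  using assms
proof (induction "card \<Lambda>" arbitrary: \<Lambda>)
  case 0
  then show ?case by (simp add: prod_ge_1)
next
  case (Suc m)
  show ?case
  proof (cases "Suc m \<le> j0")
    case True
    have "1 \<le> (\<Prod>i\<in>\<Lambda>. f i)" by (intro prod_ge_1) (use Suc in auto)
    then show ?thesis using True Suc.hyps(2)[symmetric] by simp
  next
    case False
    have ne: "f ` \<Lambda> \<noteq> {}" "finite (f ` \<Lambda>)" using Suc by auto
    obtain i where i: "i \<in> \<Lambda>" "f i = Max (f ` \<Lambda>)" using Max_in[OF ne(2,1)] by auto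
    have max: "f k \<le> f i" if "k \<in> \<Lambda>" for k unfolding i(2) using that ne by (intro Max_ge) auto
    have all: "{k \<in> \<Lambda>. f k \<le> t} = \<Lambda>" if "f i \<le> t" for t using max that by force
    have "f i > t0"
    proof (rule ccontr)
      assume "\<not> ?thesis"
      then have "card \<Lambda> \<le> j0" using all[of t0] Suc.prems(6) by simp
      then show False using False Suc.hyps(2) by simp
    qed
    then have "real (card \<Lambda>) \<le> L * f i powr \<gamma> + 1" using Suc.prems(5)[of "f i"] all[of "f i"] by simp
    then have "real m / L \<le> f i powr \<gamma>" using Suc.hyps(2)[symmetric] Suc.prems(3) by (simp add: field_simps)
    then have "(real m / L) powr (1 / \<gamma>) \<le> (f i powr \<gamma>) powr (1 / \<gamma>)"
      using Suc.prems(3,4) by (intro powr_mono2) auto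
    also have "\<dots> = f i" using Suc.prems(2)[OF i(1)] Suc.prems(4) by (simp add: powr_powr)
    finally have top: "(real m / L) powr (1 / \<gamma>) \<le> f i" .
    have card: "m = card (\<Lambda> - {i})" using Suc.hyps(2) Suc.prems(1) i(1) by simp
    have sub: "card {k \<in> \<Lambda> - {i}. f k \<le> t} \<le> card {k \<in> \<Lambda>. f k \<le> t}" for t
      using Suc.prems(1) by (intro card_mono) auto
    have IH: "(\<Prod>j=j0..<m. (real j / L) powr (1 / \<gamma>)) \<le> (\<Prod>k\<in>\<Lambda>-{i}. f k)"
      unfolding card
    proof (rule Suc.hyps(1)[OF card])
      show "real (card {k \<in> \<Lambda> - {i}. f k \<le> t}) \<le> L * t powr \<gamma> + 1" if "t \<ge> t0" for t
        using sub[of t] Suc.prems(5)[OF that] by linarith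
      show "card {k \<in> \<Lambda> - {i}. f k \<le> t0} \<le> j0" using sub[of t0] Suc.prems(6) by linarith
    qed (use Suc.prems in auto)
    have "(\<Prod>j=j0..<card \<Lambda>. (real j / L) powr (1 / \<gamma>)) =
        (\<Prod>j=j0..<m. (real j / L) powr (1 / \<gamma>)) * (real m / L) powr (1 / \<gamma>)"
      using False by (simp add: Suc.hyps(2)[symmetric])
    also have "\<dots> \<le> (\<Prod>k\<in>\<Lambda>-{i}. f k) * f i"
      by (intro mult_mono IH top prod_nonneg) (use Suc.prems(2) in \<open>force+\<close>)
    also have "\<dots> = (\<Prod>k\<in>\<Lambda>. f k)" using Suc.prems(1) i(1) by (simp add: prod.remove mult.commute)
    finally show ?thesis .
  qed
qed

context jacobi
begin

section \<open>Zeros of the orthogonal polynomials\<close>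

lemma jacobi_poly_degree_coeff:
  "degree (jacobi_poly \<rho> q n) \<le> n \<and> coeff (jacobi_poly \<rho> q n) n = 1 / complex_of_real (\<Prod>k<n. \<rho> k)"
proof (induction n rule: induct_nat_012)
  case (ge2 n)
  let ?p = "[:- complex_of_real (q (Suc n)), 1:] * jacobi_poly \<rho> q (Suc n)"
  have "degree ?p \<le> Suc (Suc n)"
    using ge2.IH(2) degree_mult_le[of "[:- complex_of_real (q (Suc n)), 1:]" "jacobi_poly \<rho> q (Suc n)"] by simp
  moreover have "degree (smult (complex_of_real (\<rho> n)) (jacobi_poly \<rho> q n)) \<le> Suc (Suc n)"
    using ge2.IH(1) degree_smult_le[of "complex_of_real (\<rho> n)" "jacobi_poly \<rho> q n"] by linarith
  ultimately have "degree (jacobi_poly \<rho> q (Suc (Suc n))) \<le> Suc (Suc n)"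
    unfolding jacobi_poly.simps by - (rule order_trans[OF degree_smult_le], rule degree_diff_le)
  moreover have "coeff (jacobi_poly \<rho> q (Suc (Suc n))) (Suc (Suc n)) = 1 / complex_of_real (\<Prod>k<Suc (Suc n). \<rho> k)"
  proof -
    have "coeff (jacobi_poly \<rho> q (Suc n)) (Suc (Suc n)) = 0" "coeff (jacobi_poly \<rho> q n) (Suc (Suc n)) = 0"
      using ge2.IH by (simp_all add: coeff_eq_0)
    then show ?thesis using ge2.IH(2) by (simp add: mult.commute)
  qed
  ultimately show ?case ..
qed auto

lemma degree_jacobi_poly: "degree (jacobi_poly \<rho> q n) = n"
  and lead_coeff_jacobi_poly: "lead_coeff (jacobi_poly \<rho> q n) = 1 / complex_of_real (\<Prod>k<n. \<rho> k)"
proof -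
  have "coeff (jacobi_poly \<rho> q n) n \<noteq> 0"
    using jacobi_poly_degree_coeff[of n] \<rho>_ne by (auto simp del: of_real_prod)
  then have "n \<le> degree (jacobi_poly \<rho> q n)" by (rule le_degree)
  then show "degree (jacobi_poly \<rho> q n) = n"
    using jacobi_poly_degree_coeff[of n] by (intro antisym) auto
  then show "lead_coeff (jacobi_poly \<rho> q n) = 1 / complex_of_real (\<Prod>k<n. \<rho> k)"
    using jacobi_poly_degree_coeff[of n] by simp
qed

definition zeros :: "nat \<Rightarrow> complex set" where
  "zeros n = {z. sol z n = 0}"

lemma jacobi_poly_ne_0: "jacobi_poly \<rho> q n \<noteq> 0"
proof -
  have "lead_coeff (jacobi_poly \<rho> q n) \<noteq> 0"
    unfolding lead_coeff_jacobi_poly using \<rho>_ne by (auto simp del: of_real_prod)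
  then show ?thesis by auto
qed

lemma finite_zeros: "finite (zeros n)"
  unfolding zeros_def sol_def using jacobi_poly_ne_0 by (rule poly_roots_finite)

lemma sum_sol_sol_cnj: "(\<Sum>k<Suc n. sol z k * sol (cnj z) k) \<noteq> 0"
proof -
  have eq: "(\<Sum>k<Suc n. sol z k * sol (cnj z) k) = complex_of_real (\<Sum>k<Suc n. (cmod (sol z k))\<^sup>2)"
    by (simp only: of_real_sum complex_norm_square cnj_sol)
  have "(\<Sum>k\<in>{0}. (cmod (sol z k))\<^sup>2) \<le> (\<Sum>k<Suc n. (cmod (sol z k))\<^sup>2)" by (intro sum_mono2) auto
  then have "(\<Sum>k<Suc n. (cmod (sol z k))\<^sup>2) \<noteq> 0" by (auto simp del: sum.lessThan_Suc)
  then show ?thesis unfolding eq by (simp only: of_real_eq_0_iff not_False_eq_True)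
qed

text \<open>In the Christoffel-Darboux formula at z and its conjugate the right side vanishes, while
  the sum is at least |p_0|^2 = 1.\<close>

lemma zeros_real:
  assumes "z \<in> zeros n"
  shows "cnj z = z"
proof (cases n)
  case 0
  then show ?thesis using assms by (simp add: zeros_def)
next
  case (Suc m)
  have "sol z (Suc m) = 0" "sol (cnj z) (Suc m) = 0"
    using assms Suc by (simp_all add: zeros_def cnj_sol[symmetric])
  then have "(z - cnj z) * (\<Sum>k<Suc m. sol z k * sol (cnj z) k) = 0"
    unfolding christoffel_darboux by simp
  then show ?thesis using sum_sol_sol_cnj[of z m] by simp
qed

text \<open>At a zero a of p_n, with n = m + 1, the formula reads (x - a) Q(x) = \<rho>_m p_m(a)
  p_n(x). Differentiating at a double zero would give Q(a) = 0, but a is real and Q(a) is a sum of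
  squares containing p_0(a)^2 = 1.\<close>

lemma rsquarefree_jacobi_poly: "rsquarefree (jacobi_poly \<rho> q n)"
proof (cases n)
  case 0
  then show ?thesis by (simp add: rsquarefree_roots)
next
  case (Suc m)
  show ?thesis
    unfolding rsquarefree_roots
  proof safe
    fix a assume a: "poly (jacobi_poly \<rho> q n) a = 0" "poly (pderiv (jacobi_poly \<rho> q n)) a = 0"
    then have az: "a \<in> zeros n" by (simp add: zeros_def sol_def)
    define Q where "Q = (\<Sum>k<Suc m. smult (sol a k) (jacobi_poly \<rho> q k))"
    have Q: "poly Q x = (\<Sum>k<Suc m. sol x k * sol a k)" for x
      by (simp add: Q_def poly_sum sol_def mult.commute)
    have "poly ([:- a, 1:] * Q) x = poly (smult (complex_of_real (\<rho> m) * sol a m) (jacobi_poly \<rho> q n)) x" for x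
    proof -
      have "poly ([:- a, 1:] * Q) x = (x - a) * (\<Sum>k<Suc m. sol x k * sol a k)"
        unfolding poly_mult Q by simp
      also have "\<dots> = complex_of_real (\<rho> m) * (sol x (Suc m) * sol a m)"
        unfolding christoffel_darboux using az Suc by (simp add: zeros_def)
      finally show ?thesis by (simp add: Suc[symmetric] sol_def)
    qed
    then have "[:- a, 1:] * Q = smult (complex_of_real (\<rho> m) * sol a m) (jacobi_poly \<rho> q n)"
      by (intro poly_eq_poly_eq_iff[THEN iffD1] ext)
    then have "poly (pderiv ([:- a, 1:] * Q)) a = 0" using a by (simp add: pderiv_smult)
    then have "poly Q a = 0" by (simp add: pderiv_mult pderiv_pCons del: mult_pCons_left)
    then show False using sum_sol_sol_cnj[of a m] zeros_real[OF az] by (simp add: Q)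
  qed
qed

lemma card_zeros: "card (zeros n) = n"
  and prod_zeros: "sol w n = (\<Prod>z\<in>zeros n. w - z) / complex_of_real (\<Prod>k<n. \<rho> k)"
proof -
  have eq: "jacobi_poly \<rho> q n = smult (1 / complex_of_real (\<Prod>k<n. \<rho> k)) (\<Prod>z\<in>zeros n. [:- z, 1:])"
    using complex_poly_decompose_rsquarefree[OF rsquarefree_jacobi_poly[of n]]
    unfolding lead_coeff_jacobi_poly zeros_def sol_def by simp
  have "degree (\<Prod>z\<in>zeros n. [:- z, 1:]) = card (zeros n)"
    by (subst degree_prod_sum_eq) auto
  moreover have "1 / complex_of_real (\<Prod>k<n. \<rho> k) \<noteq> 0" using \<rho>_ne by (auto simp del: of_real_prod)
  ultimately show "card (zeros n) = n"
    using degree_jacobi_poly[of n] arg_cong[OF eq, of degree] by (simp del: of_real_prod)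
  show "sol w n = (\<Prod>z\<in>zeros n. w - z) / complex_of_real (\<Prod>k<n. \<rho> k)"
    unfolding sol_def by (subst eq) (simp add: poly_prod del: of_real_prod)
qed

end

text \<open>A majorant that is uniform on graph norm balls of the maximal domain. Square summability
  of h turns it into the compactness axiom for A.\<close>

locale compact_extension = jacobi +
  fixes A :: oper and h :: "nat \<Rightarrow> real"
  assumes extension: "canonical_extension \<rho> q A"
    and summable_h: "summable (\<lambda>n. (h n)\<^sup>2)"
    and dominated: "(x, y) \<in> maximal_graph \<rho> q \<Longrightarrow> cmod (seq_of x n) \<le> h n * (norm x + norm y)"
begin

abbreviation "G \<equiv> graph_of A"

lemmas A_subset = canonical_extensionD(1)[OF extension]
  and adjoint_G = canonical_extensionD(2)[OF extension]
  and minimal_subset_G = canonical_extensionD(3)[OF extension]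
  and G_subset_maximal = canonical_extensionD(4)[OF extension]

section \<open>The spectrum of an extension, and comparison of eigenvalue counts\<close>

lemma h_nonneg: "h n \<ge> 0"
proof -
  define d :: cseq where "d k = (if k = n then 1 else 0)" for k
  have d: "d \<in> finsupp" by (rule finsuppI[of "Suc n"]) (auto simp: d_def)
  then have d2: "d \<in> ell2" "J d \<in> ell2" using jacobi_diff_finsupp[OF d] finsupp_subset_ell2 by auto
  then have "(l2_of d, l2_of (J d)) \<in> maximal_graph \<rho> q" by (simp add: maximal_graph_def l2_of_inverse)
  from dominated[OF this, of n] have "1 \<le> h n * (norm (l2_of d) + norm (l2_of (J d)))"
    by (simp add: l2_of_inverse d2 d_def)
  then show ?thesis
    by (smt (verit) mult_nonneg_nonneg mult_nonpos_nonneg norm_ge_zero)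
qed

sublocale compact_selfadjoint G
proof
  show "adjoint_graph G = G" by (rule adjoint_G)
  fix X Y :: "nat \<Rightarrow> l2" and B assume XY: "\<And>k. (X k, Y k) \<in> G" "\<And>k. norm (X k) \<le> 1" "\<And>k. norm (Y k) \<le> B"
  have "summable (\<lambda>n. (h n * (1 + B))\<^sup>2)"
    unfolding power_mult_distrib by (rule summable_mult2[OF summable_h])
  moreover have "cmod (seq_of (X k) n) \<le> h n * (1 + B)" for k n
  proof -
    have "cmod (seq_of (X k) n) \<le> h n * (norm (X k) + norm (Y k))"
      using XY(1) G_subset_maximal by (intro dominated) auto
    also have "\<dots> \<le> h n * (1 + B)" by (intro mult_left_mono add_mono XY h_nonneg)
    finally show ?thesis .
  qed
  ultimately obtain r x where "strict_mono (r :: nat \<Rightarrow> nat)" "(\<lambda>k. X (r k)) \<longlonglongrightarrow> x"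
    by (rule l2_convergent_subsequence_of_dominated)
  then show "\<exists>r x. strict_mono (r :: nat \<Rightarrow> nat) \<and> (\<lambda>k. X (r k)) \<longlonglongrightarrow> x" by blast
qed

definition eigenvalues :: "real set" where
  "eigenvalues = {\<mu>. \<exists>x. x \<noteq> 0 \<and> (x, complex_of_real \<mu> *\<^sub>C x) \<in> G}"

text \<open>The eigenvector with first entry 1. The value is meaningful only if the solution is
  square summable, in particular at eigenvalues.\<close>

definition eigvec :: "real \<Rightarrow> l2" where
  "eigvec \<mu> = l2_of (sol (complex_of_real \<mu>))"

lemma eigenspace:
  assumes "(x, complex_of_real \<mu> *\<^sub>C x) \<in> G" "x \<noteq> 0"
  shows "sol (complex_of_real \<mu>) \<in> ell2" "x = seq_of x 0 *\<^sub>C eigvec \<mu>" "seq_of x 0 \<noteq> 0"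
proof -
  have "\<And>n. J (seq_of x) n = complex_of_real \<mu> * seq_of x n"
    using assms(1) G_subset_maximal by (force simp: maximal_graph_def fun_eq_iff)
  from solution_unique[OF this] have x: "\<And>n. seq_of x n = seq_of x 0 * sol (complex_of_real \<mu>) n" .
  show x0: "seq_of x 0 \<noteq> 0"
  proof
    assume "seq_of x 0 = 0"
    then have "seq_of x n = 0" for n using x[of n] by simp
    then have "x = 0" by (intro l2_eqI) simp
    then show False using assms(2) by simp
  qed
  have "sol (complex_of_real \<mu>) n = (1 / seq_of x 0) * seq_of x n" for n
    using x[of n] x0 by (simp add: field_simps)
  then have "sol (complex_of_real \<mu>) = seq_of ((1 / seq_of x 0) *\<^sub>C x)" by (intro ext) simp
  then show ell2: "sol (complex_of_real \<mu>) \<in> ell2" using seq_of by metis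
  show "x = seq_of x 0 *\<^sub>C eigvec \<mu>"
  proof (rule l2_eqI)
    fix n show "seq_of x n = seq_of (seq_of x 0 *\<^sub>C eigvec \<mu>) n"
      using x[of n] by (simp add: eigvec_def l2_of_inverse[OF ell2])
  qed
qed

lemma eigvec:
  assumes "\<mu> \<in> eigenvalues"
  shows "(eigvec \<mu>, complex_of_real \<mu> *\<^sub>C eigvec \<mu>) \<in> G" "eigvec \<mu> \<noteq> 0"
proof -
  obtain x where x: "x \<noteq> 0" "(x, complex_of_real \<mu> *\<^sub>C x) \<in> G" using assms by (auto simp: eigenvalues_def)
  note e = eigenspace[OF x(2,1)]
  show "eigvec \<mu> \<noteq> 0" using e(2) x(1) by (metis scaleC_simps(3))
  have "eigvec \<mu> = (1 / seq_of x 0) *\<^sub>C x"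
    using arg_cong[OF e(2), of "\<lambda>y. (1 / seq_of x 0) *\<^sub>C y"] e(3) by (simp add: scaleC_algebra)
  moreover have "((1 / seq_of x 0) *\<^sub>C x, (1 / seq_of x 0) *\<^sub>C complex_of_real \<mu> *\<^sub>C x) \<in> G"
    by (rule complex_linearD(4)[OF linear x(2)])
  ultimately show "(eigvec \<mu>, complex_of_real \<mu> *\<^sub>C eigvec \<mu>) \<in> G"
    by (simp add: scaleC_algebra mult.commute)
qed

text \<open>Compactness makes A - z bounded below and onto as soon as it is injective, so only
  eigenvalues are left outside the resolvent set.\<close>

lemma spectrum_eq: "spectrum A = complex_of_real ` eigenvalues"
proof -
  have mem: "(u, v) \<in> A \<longleftrightarrow> u \<in> ell2 \<and> v \<in> ell2 \<and> (l2_of u, l2_of v) \<in> G" for u v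
    using A_subset by (auto simp: graph_of_def l2_of_inverse)
  have res: "z \<in> resolvent_set A \<longleftrightarrow> (\<forall>x. (x, z *\<^sub>C x) \<in> G \<longrightarrow> x = 0)" for z
  proof
    assume z: "z \<in> resolvent_set A"
    show "\<forall>x. (x, z *\<^sub>C x) \<in> G \<longrightarrow> x = 0"
    proof (intro allI impI)
      fix x assume x: "(x, z *\<^sub>C x) \<in> G"
      have ex1: "\<exists>!u. (u, 0 + cseq_scale z u) \<in> A" using z ell2_zero unfolding resolvent_set_def by blast
      have "(seq_of y, 0 + cseq_scale z (seq_of y)) \<in> A \<longleftrightarrow> (y, z *\<^sub>C y) \<in> G" for y
        by (simp add: graph_of_def scaleC.rep_eq)
      moreover have "(0, z *\<^sub>C 0) \<in> G" using complex_linearD(1)[OF linear] by simp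
      ultimately have "seq_of x = seq_of 0" using ex1 x by blast
      then show "x = 0" by (simp add: seq_of_inject)
    qed
  next
    assume no: "\<forall>x. (x, z *\<^sub>C x) \<in> G \<longrightarrow> x = 0"
    have "\<exists>!u. (u, w + cseq_scale z u) \<in> A" if w: "w \<in> ell2" for w
    proof -
      have tr: "(seq_of y, w + cseq_scale z (seq_of y)) \<in> A \<longleftrightarrow> (y, l2_of w + z *\<^sub>C y) \<in> G" for y
        by (simp add: graph_of_def plus_l2.rep_eq scaleC.rep_eq l2_of_inverse w)
      obtain x where x: "(x, l2_of w + z *\<^sub>C x) \<in> G" using surj_of_not_eigenvalue[of z "l2_of w"] no by blast
      have "u = seq_of x" if u: "(u, w + cseq_scale z u) \<in> A" for u
      proof -
        have "u \<in> ell2" using u A_subset by auto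
        then have "(l2_of u, l2_of w + z *\<^sub>C l2_of u) \<in> G" using tr[of "l2_of u"] u by (simp add: l2_of_inverse)
        from complex_linearD(3)[OF linear this x]
        have "(l2_of u - x, z *\<^sub>C (l2_of u - x)) \<in> G" by (simp add: scaleC_algebra)
        then have "l2_of u = x" using no by fastforce
        then show ?thesis using \<open>u \<in> ell2\<close> by (metis l2_of_inverse)
      qed
      then show ?thesis using tr x by blast
    qed
    moreover obtain C where C: "\<forall>(x, y)\<in>G. norm x \<le> C * norm (y - z *\<^sub>C x)"
      using bounded_below_of_not_eigenvalue[of z] no by blast
    have "ell2_norm u \<le> C * ell2_norm (v - cseq_scale z u)" if uv: "(u, v) \<in> A" for u v
    proof -
      have "v - cseq_scale z u = seq_of (l2_of v - z *\<^sub>C l2_of u)"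
        using uv by (intro ext) (simp add: mem l2_of_inverse cseq_scale_def)
      then show ?thesis
        using C uv by (force simp: mem ell2_norm_l2_of norm_eq_ell2_norm[symmetric])
    qed
    ultimately show "z \<in> resolvent_set A" unfolding resolvent_set_def by blast
  qed
  show ?thesis
  proof (rule set_eqI)
    fix z
    have "z \<in> spectrum A \<longleftrightarrow> (\<exists>x. x \<noteq> 0 \<and> (x, z *\<^sub>C x) \<in> G)" unfolding spectrum_def Compl_iff res by blast
    also have "\<dots> \<longleftrightarrow> z \<in> complex_of_real ` eigenvalues"
    proof
      assume "\<exists>x. x \<noteq> 0 \<and> (x, z *\<^sub>C x) \<in> G"
      then obtain x where x: "x \<noteq> 0" "(x, z *\<^sub>C x) \<in> G" by blast
      from eigenvalue_real[OF x(2,1)] obtain \<mu> where "z = complex_of_real \<mu>" by (rule Reals_cases)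
      then show "z \<in> complex_of_real ` eigenvalues" using x unfolding eigenvalues_def by blast
    qed (auto simp: eigenvalues_def)
    finally show "z \<in> spectrum A \<longleftrightarrow> z \<in> complex_of_real ` eigenvalues" .
  qed
qed

lemma orthogonal_eigvec:
  "\<mu> \<in> eigenvalues \<Longrightarrow> \<nu> \<in> eigenvalues \<Longrightarrow> \<mu> \<noteq> \<nu> \<Longrightarrow> cinner (eigvec \<mu>) (eigvec \<nu>) = 0"
  by (rule eigenvectors_orthogonal) (auto intro: eigvec)

text \<open>If there were more eigenvectors than indices in Z, some nonzero combination x would
  vanish on Z. Orthogonality of the eigenvectors gives |Ax| \<le> r |x|, which the hypothesis on Z
  forbids.\<close>

lemma card_eigenvalues_le:
  assumes S: "S \<subseteq> eigenvalues" "finite S" "\<And>\<mu>. \<mu> \<in> S \<Longrightarrow> \<bar>\<mu>\<bar> \<le> r" and r: "r \<ge> 0"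
    and Z: "finite Z" "\<And>x y. (x, y) \<in> maximal_graph \<rho> q \<Longrightarrow> (\<And>n. n \<in> Z \<Longrightarrow> seq_of x n = 0) \<Longrightarrow>
      norm y \<le> r * norm x \<Longrightarrow> x = 0"
  shows "card S \<le> card Z"
proof (rule ccontr)
  assume "\<not> ?thesis"
  then obtain c where c: "\<exists>\<mu>\<in>S. c \<mu> \<noteq> 0" "\<forall>n\<in>Z. (\<Sum>\<mu>\<in>S. c \<mu> * seq_of (eigvec \<mu>) n) = 0"
    using nontrivial_solution_exists[OF Z(1) S(2), of "\<lambda>\<mu> n. seq_of (eigvec \<mu>) n"] by auto
  define x where "x = (\<Sum>\<mu>\<in>S. c \<mu> *\<^sub>C eigvec \<mu>)"
  define y where "y = (\<Sum>\<mu>\<in>S. (c \<mu> * complex_of_real \<mu>) *\<^sub>C eigvec \<mu>)"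
  have "(x, y) \<in> G"
    unfolding x_def y_def
  proof (rule complex_linear_sum[OF linear])
    fix \<mu> assume "\<mu> \<in> S"
    then show "(c \<mu> *\<^sub>C eigvec \<mu>, (c \<mu> * complex_of_real \<mu>) *\<^sub>C eigvec \<mu>) \<in> G"
      using complex_linearD(4)[OF linear eigvec(1), of \<mu> "c \<mu>"] S(1) by (auto simp: scaleC_algebra)
  qed
  moreover have "norm y \<le> r * norm x"
    unfolding x_def y_def
    by (rule norm_sum_orthogonal_eigenvectors_le) (use S r in \<open>auto intro!: orthogonal_eigvec\<close>)
  moreover have "seq_of x n = 0" if "n \<in> Z" for n using c(2) that by (simp add: x_def seq_of_sum)
  ultimately have "x = 0" using Z(2) G_subset_maximal by blast
  moreover have "(norm x)\<^sup>2 = (\<Sum>\<mu>\<in>S. (cmod (c \<mu>))\<^sup>2 * (norm (eigvec \<mu>))\<^sup>2)"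
    unfolding x_def by (rule orthogonal_norm_sum) (use S in \<open>auto intro!: orthogonal_eigvec\<close>)
  ultimately have "\<forall>\<mu>\<in>S. (cmod (c \<mu>))\<^sup>2 * (norm (eigvec \<mu>))\<^sup>2 = 0"
    using S(2) by (simp add: sum_nonneg_eq_0_iff)
  then show False using c(1) eigvec(2) S(1) by auto
qed

text \<open>The zeros of p_{n+1} are the eigenvalues of the matrix truncated to the indices 0..n,
  with truncated solutions as orthogonal eigenvectors. With too many zeros, a nonzero combination
  lies in the domain of A, is orthogonal to all eigenvectors of A in the interval and satisfies |Ax|
  \<le> t |x|.\<close>

lemma card_zeros_le:
  assumes fin: "finite {\<mu> \<in> eigenvalues. \<bar>\<mu>\<bar> \<le> t}" and t: "t \<ge> 0"
  shows "card {z \<in> zeros (Suc n). cmod z \<le> t} \<le> card {\<mu> \<in> eigenvalues. \<bar>\<mu>\<bar> \<le> t} + 1"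
proof (rule ccontr)
  assume contr: "\<not> ?thesis"
  let ?M = "{\<mu> \<in> eigenvalues. \<bar>\<mu>\<bar> \<le> t}" and ?I = "{z \<in> zeros (Suc n). cmod z \<le> t}"
  define v where "v z k = (if k \<le> n then sol z k else 0)" for z k
  have v_fs: "v z \<in> finsupp" for z by (rule finsuppI[of "Suc n"]) (auto simp: v_def)
  then have v: "seq_of (l2_of (v z)) = v z" for z using finsupp_subset_ell2 by (intro l2_of_inverse) auto
  define e where "e z = l2_of (v z)" for z
  \<comment> \<open>The conditions are indexed by \<open>Some \<mu>\<close> for orthogonality to an eigenvector, and by \<open>None\<close> for
    the vanishing of the last coordinate, which makes the truncation invisible to the operator.\<close>
  define f where "f z w = (case w of None \<Rightarrow> sol z n | Some \<mu> \<Rightarrow> cinner (e z) (eigvec \<mu>))" for z w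
  have "card (insert None (Some ` ?M)) = card ?M + 1"
    using fin by (subst card_insert_disjoint) (auto simp: card_image)
  then obtain c where c: "\<exists>z\<in>?I. c z \<noteq> 0" "\<forall>w\<in>insert None (Some ` ?M). (\<Sum>z\<in>?I. c z * f z w) = 0"
    using nontrivial_solution_exists[of "insert None (Some ` ?M)" ?I f] contr fin finite_zeros by auto
  define x where "x = (\<Sum>z\<in>?I. c z *\<^sub>C e z)"
  define y where "y = (\<Sum>z\<in>?I. (c z * complex_of_real (Re z)) *\<^sub>C e z)"
  have re: "complex_of_real (Re z) = z" if "z \<in> ?I" for z
    using zeros_real[of z] that by (auto simp: complex_eq_iff)
  have xk: "seq_of x k = (if k \<le> n then (\<Sum>z\<in>?I. c z * sol z k) else 0)" for k
    by (simp add: x_def e_def seq_of_sum v) (simp add: v_def)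
  have yk: "seq_of y k = (if k \<le> n then (\<Sum>z\<in>?I. c z * (z * sol z k)) else 0)" for k
    using re by (simp add: y_def e_def seq_of_sum v) (simp add: v_def mult.assoc)
  have xn: "(\<Sum>z\<in>?I. c z * sol z n) = 0" using c(2) by (simp add: f_def)
  \<comment> \<open>The formula extends one index beyond the truncation because each z is a zero of
    p_{n+1}. This makes row n come out right, while row n + 1 vanishes because coordinate n of x
    does.\<close>
  have xsol: "seq_of x k = (\<Sum>z\<in>?I. c z * sol z k)" if "k \<le> Suc n" for k
    using that by (cases "k = Suc n") (auto simp: xk zeros_def)
  have "J (seq_of x) k = seq_of y k" for k
  proof (cases "k \<le> n")
    case True
    have "J (seq_of x) k = J (\<lambda>k. \<Sum>z\<in>?I. c z * sol z k) k"
      using True by (cases k) (auto simp: jacobi_diff_simps xsol)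
    also have "\<dots> = (\<Sum>z\<in>?I. c z * J (sol z) k)"
      by (cases k) (simp_all add: jacobi_diff_simps sum_distrib_left algebra_simps sum.distrib)
    finally show ?thesis using True by (simp add: J_sol yk)
  next
    case False
    then obtain m where m: "k = Suc m" "n \<le> m" by (cases k) auto
    have "seq_of x m = 0" using m xn by (cases "m = n") (auto simp: xk)
    then show ?thesis using m by (simp add: jacobi_diff_simps xk yk)
  qed
  then have "(x, y) \<in> minimal_graph \<rho> q"
    by (auto simp: minimal_graph_def maximal_graph_def xk intro!: finsuppI[of "Suc n"])
  then have xyG: "(x, y) \<in> G" using minimal_subset_G by auto
  have orth: "cinner (e z) (e w) = 0" if "z \<in> ?I" "w \<in> ?I" "z \<noteq> w" for z w
  proof -
    have "cinner (e z) (e w) = (\<Sum>k<Suc n. sol z k * cnj (sol w k))"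
      by (subst cinner_finite[of "Suc n"]) (auto simp: e_def v v_def)
    also have "\<dots> = (\<Sum>k<Suc n. sol z k * sol w k)"
      using zeros_real[of w "Suc n"] that by (simp add: cnj_sol)
    finally show ?thesis using christoffel_darboux[of z w n] that by (simp add: zeros_def)
  qed
  have le: "norm y \<le> t * norm x"
    unfolding x_def y_def
    by (rule norm_sum_orthogonal_eigenvectors_le)
       (use orth t finite_zeros abs_Re_le_cmod order_trans in \<open>auto intro: order_trans[OF abs_Re_le_cmod]\<close>)
  have x_ne: "x \<noteq> 0"
  proof
    assume "x = 0"
    moreover have "(norm x)\<^sup>2 = (\<Sum>z\<in>?I. (cmod (c z))\<^sup>2 * (norm (e z))\<^sup>2)"
      unfolding x_def by (rule orthogonal_norm_sum) (use orth finite_zeros in auto)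
    ultimately have "\<forall>z\<in>?I. (cmod (c z))\<^sup>2 * (norm (e z))\<^sup>2 = 0"
      using finite_zeros by (simp add: sum_nonneg_eq_0_iff)
    moreover have "e z \<noteq> 0" for z
    proof
      assume "e z = 0"
      then have "seq_of (e z) 0 = 0" by simp
      then show False by (simp add: e_def v v_def)
    qed
    ultimately show False using c(1) by auto
  qed
  have "norm y > t * norm x"
  proof (rule norm_gt_of_orthogonal_eigenvectors[OF fin _ _ _ xyG x_ne])
    show "(eigvec \<mu>, complex_of_real \<mu> *\<^sub>C eigvec \<mu>) \<in> G" "eigvec \<mu> \<noteq> 0" if "\<mu> \<in> ?M" for \<mu>
      using eigvec[of \<mu>] that by auto
    show "\<mu> \<in> ?M \<and> (\<exists>c. x = c *\<^sub>C eigvec \<mu>)"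
      if "\<bar>\<mu>\<bar> \<le> t" "(x, complex_of_real \<mu> *\<^sub>C x) \<in> G" "x \<noteq> 0" for \<mu> x
      using eigenspace(2)[OF that(2,3)] that by (auto simp: eigenvalues_def)
    show "cinner x (eigvec \<mu>) = 0" if "\<mu> \<in> ?M" for \<mu>
    proof -
      have "cinner x (eigvec \<mu>) = (\<Sum>z\<in>?I. c z * f z (Some \<mu>))"
        by (simp add: x_def f_def cinner_sum_left cinner_scaleC_left)
      then show ?thesis using c(2) that by simp
    qed
  qed
  then show False using le by simp
qed

text \<open>The product over the zeros is bounded below by the counting bound and above through the
  leading coefficient of p_N. The powers j^\<beta> cancel, and powers of L^(-\<beta>) / Y stay
  bounded, so this ratio cannot exceed 1.\<close>

lemma density_lower_bound:
  assumes \<beta>: "\<beta> > 0" and Y: "Y > 0" and L: "L > 0"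
    and \<rho>_le: "\<And>k. k \<ge> k0 \<Longrightarrow> \<rho> k \<le> real k powr \<beta> * Y"
    and fin: "\<And>t. finite {\<mu> \<in> eigenvalues. \<bar>\<mu>\<bar> \<le> t}"
    and count: "\<And>t. t \<ge> t0 \<Longrightarrow> real (card {\<mu> \<in> eigenvalues. \<bar>\<mu>\<bar> \<le> t}) \<le> L * t powr (1 / \<beta>)"
    and bound: "\<And>n. cmod (sol \<i> n) \<le> B"
  shows "L powr (- \<beta>) \<le> Y"
proof (rule ccontr)
  assume "\<not> ?thesis"
  then have x1: "L powr (- \<beta>) / Y > 1" using Y by (simp add: field_simps)
  define t1 where "t1 = max t0 0"
  \<comment> \<open>Large enough for the bound on \<rho>, for positive factors j^\<beta>, and to
    exceed the number of zeros not covered by the counting hypothesis; the summand 1 is the possible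
    extra zero.\<close>
  define j0 where "j0 = max (max 1 k0) (card {\<mu> \<in> eigenvalues. \<bar>\<mu>\<bar> \<le> t1} + 1)"
  have B: "B \<ge> 0" using bound[of 0] norm_ge_zero order_trans by blast
  define C where "C = B * (\<Prod>k<j0. \<rho> k)"
  have main: "(L powr (- \<beta>) / Y) ^ m \<le> C" for m
  proof -
    define N where "N = j0 + m"
    have N: "N = Suc (N - 1)" by (simp add: N_def j0_def)
    \<comment> \<open>The zeros are real, so passing from |z| to |i - z| makes every factor at least
      1 and only lowers the counting function.\<close>
    have f_ge: "cmod z \<le> cmod (\<i> - z)" "1 \<le> cmod (\<i> - z)" if "z \<in> zeros N" for z
    proof -
      have z: "Im z = 0" using zeros_real[OF that] by (simp add: complex_eq_iff)
      show "cmod z \<le> cmod (\<i> - z)" "1 \<le> cmod (\<i> - z)" by (auto simp: cmod_def z intro!: real_le_rsqrt)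
    qed
    have sub: "card {z \<in> zeros N. cmod (\<i> - z) \<le> t} \<le> card {\<mu> \<in> eigenvalues. \<bar>\<mu>\<bar> \<le> t} + 1" if t: "t \<ge> 0" for t
    proof -
      have "card {z \<in> zeros N. cmod (\<i> - z) \<le> t} \<le> card {z \<in> zeros N. cmod z \<le> t}"
        by (intro card_mono) (auto simp: finite_zeros intro: order_trans[OF f_ge(1)])
      also have "\<dots> \<le> card {\<mu> \<in> eigenvalues. \<bar>\<mu>\<bar> \<le> t} + 1"
        using card_zeros_le[OF fin t, of "N - 1"] N by simp
      finally show ?thesis .
    qed
    have "(\<Prod>j=j0..<card (zeros N). (real j / L) powr (1 / (1 / \<beta>))) \<le> (\<Prod>z\<in>zeros N. cmod (\<i> - z))"
    proof (rule prod_ge_of_counting)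
      show "real (card {z \<in> zeros N. cmod (\<i> - z) \<le> t}) \<le> L * t powr (1 / \<beta>) + 1" if "t \<ge> t1" for t
        using sub[of t] count[of t] that by (simp add: t1_def)
      show "card {z \<in> zeros N. cmod (\<i> - z) \<le> t1} \<le> j0"
        using sub[of t1] by (simp add: t1_def j0_def)
    qed (use \<beta> L finite_zeros f_ge in auto)
    also have "(\<Prod>z\<in>zeros N. cmod (\<i> - z)) = cmod (sol \<i> N) * (\<Prod>k<N. \<rho> k)"
    proof -
      have pos: "(\<Prod>k<N. \<rho> k) > 0" by (intro prod_pos) (use \<rho>_pos in auto)
      have "cmod (sol \<i> N) = (\<Prod>z\<in>zeros N. cmod (\<i> - z)) / (\<Prod>k<N. \<rho> k)"
        unfolding prod_zeros norm_divide norm_of_real using pos by (simp add: prod_norm)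
      then show ?thesis using pos by (metis eq_divide_eq less_irrefl)
    qed
    also have "\<dots> \<le> B * (\<Prod>k<N. \<rho> k)"
      by (intro mult_right_mono bound prod_nonneg) (use \<rho>_pos in \<open>auto intro: less_imp_le\<close>)
    also have "(\<Prod>k<N. \<rho> k) = (\<Prod>k<j0. \<rho> k) * (\<Prod>k=j0..<N. \<rho> k)"
      by (subst prod.union_disjoint[symmetric]) (auto simp: N_def intro!: prod.cong)
    also have "B * ((\<Prod>k<j0. \<rho> k) * (\<Prod>k=j0..<N. \<rho> k)) \<le> C * (\<Prod>k=j0..<N. real k powr \<beta> * Y)"
    proof -
      have "(\<Prod>k=j0..<N. \<rho> k) \<le> (\<Prod>k=j0..<N. real k powr \<beta> * Y)"
        by (intro prod_mono) (use \<rho>_pos \<rho>_le in \<open>auto simp: j0_def intro: less_imp_le\<close>)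
      moreover have "C \<ge> 0" unfolding C_def using B \<rho>_pos by (intro mult_nonneg_nonneg prod_nonneg) (auto intro: less_imp_le)
      ultimately show ?thesis unfolding C_def mult.assoc[symmetric] by (rule mult_left_mono)
    qed
    finally have "(\<Prod>j=j0..<N. (real j / L) powr \<beta>) \<le> C * (\<Prod>k=j0..<N. real k powr \<beta> * Y)"
      using \<beta> by (simp add: card_zeros)
    moreover have "(\<Prod>j=j0..<N. (real j / L) powr \<beta>) = (\<Prod>k=j0..<N. real k powr \<beta>) * (L powr (- \<beta>)) ^ m"
    proof -
      have "(real j / L) powr \<beta> = real j powr \<beta> * L powr (- \<beta>)" for j
        using L by (simp add: powr_divide powr_minus_divide)
      then show ?thesis by (simp add: prod.distrib N_def)
    qed
    moreover have "(\<Prod>k=j0..<N. real k powr \<beta> * Y) = (\<Prod>k=j0..<N. real k powr \<beta>) * Y ^ m"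
      by (simp add: prod.distrib N_def)
    ultimately have "(\<Prod>k=j0..<N. real k powr \<beta>) * (L powr (- \<beta>)) ^ m \<le> (\<Prod>k=j0..<N. real k powr \<beta>) * (C * Y ^ m)"
      by (simp add: mult_ac)
    moreover have "(\<Prod>k=j0..<N. real k powr \<beta>) > 0" by (intro prod_pos) (auto simp: j0_def)
    ultimately have "(L powr (- \<beta>)) ^ m \<le> C * Y ^ m" by (simp only: mult_le_cancel_left_pos)
    then show ?thesis using Y by (simp add: power_divide divide_le_eq)
  qed
  obtain m where "C < (L powr (- \<beta>) / Y) ^ m" using real_arch_pow[OF x1] by blast
  then show False using main[of m] by simp
qed

end


section \<open>Sequences of bounded variation\<close>

definition bv :: "(nat \<Rightarrow> real) \<Rightarrow> bool" where
  "bv f \<longleftrightarrow> summable (\<lambda>n. \<bar>f (Suc n) - f n\<bar>)"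

lemma bv_convergent:
  assumes "bv f"
  shows "convergent f"
proof -
  have "summable (\<lambda>n. f (Suc n) - f n)"
    using assms unfolding bv_def by (rule summable_rabs_cancel)
  then have "convergent (\<lambda>n. \<Sum>k<n. f (Suc k) - f k)" by (simp add: summable_iff_convergent)
  then have "convergent (\<lambda>n. f n - f 0)" by (simp add: sum_lessThan_telescope)
  then show ?thesis by (simp add: convergent_diff_const_right_iff)
qed

lemma bv_bounded:
  assumes "bv f"
  obtains K where "K > 0" "\<And>n. \<bar>f n\<bar> \<le> K"
  using convergent_imp_Bseq[OF bv_convergent[OF assms]] unfolding Bseq_def by auto

lemma bv_const: "bv (\<lambda>_. c)"
  by (simp add: bv_def)

lemma bv_add:
  assumes "bv f" "bv g"
  shows "bv (\<lambda>n. f n + g n)"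
  unfolding bv_def
proof (rule summable_comparison_test')
  show "summable (\<lambda>n. \<bar>f (Suc n) - f n\<bar> + \<bar>g (Suc n) - g n\<bar>)"
    using assms unfolding bv_def by (rule summable_add)
qed simp

lemma bv_mult:
  assumes "bv f" "bv g"
  shows "bv (\<lambda>n. f n * g n)"
proof -
  obtain K where K: "K > 0" "\<And>n. \<bar>f n\<bar> \<le> K" using bv_bounded[OF assms(1)] by metis
  obtain L where L: "\<And>n. \<bar>g n\<bar> \<le> L" using bv_bounded[OF assms(2)] by metis
  show ?thesis
    unfolding bv_def
  proof (rule summable_comparison_test')
    show "summable (\<lambda>n. K * \<bar>g (Suc n) - g n\<bar> + \<bar>f (Suc n) - f n\<bar> * L)"
      using assms unfolding bv_def by (intro summable_add summable_mult summable_mult2)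
    fix n
    have "f (Suc n) * g (Suc n) - f n * g n = f (Suc n) * (g (Suc n) - g n) + (f (Suc n) - f n) * g n"
      by (simp add: algebra_simps)
    then have "\<bar>f (Suc n) * g (Suc n) - f n * g n\<bar> \<le>
        \<bar>f (Suc n)\<bar> * \<bar>g (Suc n) - g n\<bar> + \<bar>f (Suc n) - f n\<bar> * \<bar>g n\<bar>"
      by (metis abs_mult abs_triangle_ineq)
    also have "\<dots> \<le> K * \<bar>g (Suc n) - g n\<bar> + \<bar>f (Suc n) - f n\<bar> * L"
      using K(1) by (intro add_mono mult_mono K L) auto
    finally show "norm \<bar>f (Suc n) * g (Suc n) - f n * g n\<bar> \<le> K * \<bar>g (Suc n) - g n\<bar> + \<bar>f (Suc n) - f n\<bar> * L"
      by simp
  qed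
qed

lemma bv_of_summable:
  assumes "summable (\<lambda>n. \<bar>f n\<bar>)"
  shows "bv f"
  unfolding bv_def
proof (rule summable_comparison_test')
  show "summable (\<lambda>n. \<bar>f (Suc n)\<bar> + \<bar>f n\<bar>)"
    using assms by (intro summable_add) (simp_all add: summable_Suc_iff[of "\<lambda>n. \<bar>f n\<bar>"])
qed simp

lemma bv_of_mono_bounded:
  assumes "\<And>n. n \<ge> m \<Longrightarrow> f n \<le> f (Suc n)" "\<And>n. \<bar>f n\<bar> \<le> K"
  shows "bv f"
proof -
  have "summable (\<lambda>n. \<bar>f (Suc (n + m)) - f (n + m)\<bar>)"
  proof (rule summableI_nonneg_bounded)
    fix n
    have "(\<Sum>k<n. \<bar>f (Suc (k + m)) - f (k + m)\<bar>) = (\<Sum>k<n. f (Suc k + m) - f (k + m))"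
      by (intro sum.cong) (use assms(1) in auto)
    also have "\<dots> = f (n + m) - f m" by (simp only: sum_lessThan_telescope[of "\<lambda>k. f (k + m)"] add_0)
    also have "\<dots> \<le> 2 * K" using assms(2)[of "n + m"] assms(2)[of m] by linarith
    finally show "(\<Sum>k<n. \<bar>f (Suc (k + m)) - f (k + m)\<bar>) \<le> 2 * K" .
  qed simp
  then show ?thesis
    unfolding bv_def using summable_iff_shift[of "\<lambda>n. \<bar>f (Suc n) - f n\<bar>" m] by simp
qed

lemma bv_cong_eventually:
  assumes "bv f" "\<forall>\<^sub>F n in sequentially. f n = g n"
  shows "bv g"
proof -
  obtain N where "\<And>n. n \<ge> N \<Longrightarrow> f n = g n" using assms(2) by (auto simp: eventually_sequentially)
  then have "\<forall>\<^sub>F n in sequentially. \<bar>f (Suc n) - f n\<bar> = \<bar>g (Suc n) - g n\<bar>"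
    by (auto simp: eventually_sequentially intro!: exI[of _ N])
  then show ?thesis using assms(1) unfolding bv_def by (simp add: summable_cong)
qed


section \<open>Energy estimates for solutions\<close>

text \<open>A discrete Gronwall inequality. Absolutely summable perturbations b cost only a bounded
  factor, and one close to 1 when m is large.\<close>

lemma discrete_growth_bound:
  fixes N b g :: "nat \<Rightarrow> real"
  assumes "\<And>n. n \<ge> m \<Longrightarrow> N (Suc n) \<le> (1 + b n) * N n + g n"
    and "\<And>n. b n \<ge> 0" "\<And>n. g n \<ge> 0" "N m \<ge> 0" "n \<ge> m"
  shows "N n \<le> exp (\<Sum>k=m..<n. b k) * (N m + (\<Sum>k=m..<n. g k))"
  using \<open>n \<ge> m\<close>
proof (induction n rule: dec_induct)
  case (step n)
  let ?E = "exp (\<Sum>k=m..<n. b k)" and ?S = "N m + (\<Sum>k=m..<n. g k)"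
  have S: "?S \<ge> 0" using assms(3,4) by (intro add_nonneg_nonneg sum_nonneg) auto
  have "N (Suc n) \<le> (1 + b n) * N n + g n" using assms(1) step by simp
  also have "\<dots> \<le> (1 + b n) * (?E * ?S) + g n"
    using step.IH assms(2)[of n] by (intro add_right_mono mult_left_mono) auto
  also have "\<dots> \<le> exp (b n) * (?E * ?S) + g n"
    using S by (intro add_right_mono mult_right_mono exp_ge_add_one_self) auto
  also have "\<dots> \<le> exp (b n) * (?E * ?S) + exp (b n) * ?E * g n"
  proof -
    have "1 \<le> exp (b n) * ?E" using assms(2) by (simp add: mult_exp_exp sum_nonneg)
    then show ?thesis using mult_right_mono[of 1 "exp (b n) * ?E" "g n"] assms(3)[of n] by simp
  qed
  also have "\<dots> = exp (\<Sum>k=m..<Suc n. b k) * (N m + (\<Sum>k=m..<Suc n. g k))"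
    using step by (simp add: exp_add algebra_simps)
  finally show ?case .
qed simp

text \<open>The square of the following quantity is
  \<open>\<alpha>\<^sup>2 (\<bar>a\<bar>\<^sup>2 + \<bar>b\<bar>\<^sup>2) + \<alpha> \<gamma> Re (a b\<^sup>*)\<close>, which is invariant under the recurrence with constant
  coefficients \<open>\<alpha> w\<^sub>n\<^sub>+\<^sub>1 + \<gamma> w\<^sub>n + \<alpha> w\<^sub>n\<^sub>-\<^sub>1 = 0\<close>.\<close>

definition energy :: "real \<Rightarrow> real \<Rightarrow> complex \<Rightarrow> complex \<Rightarrow> real" where
  "energy \<alpha> \<gamma> a b = norm (\<alpha> *\<^sub>R b + (\<gamma> / 2) *\<^sub>R a, sqrt (\<alpha>\<^sup>2 - \<gamma>\<^sup>2 / 4) *\<^sub>R a)"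

lemma energy_squared:
  assumes "\<alpha>\<^sup>2 - \<gamma>\<^sup>2 / 4 \<ge> 0"
  shows "(energy \<alpha> \<gamma> a b)\<^sup>2 = \<alpha>\<^sup>2 * ((cmod a)\<^sup>2 + (cmod b)\<^sup>2) + \<alpha> * \<gamma> * inner a b"
proof -
  have "(energy \<alpha> \<gamma> a b)\<^sup>2 = (norm (\<alpha> *\<^sub>R b + (\<gamma> / 2) *\<^sub>R a))\<^sup>2 + (\<alpha>\<^sup>2 - \<gamma>\<^sup>2 / 4) * (cmod a)\<^sup>2"
    using assms by (simp add: energy_def norm_Pair power_mult_distrib)
  also have "(norm (\<alpha> *\<^sub>R b + (\<gamma> / 2) *\<^sub>R a))\<^sup>2 = \<alpha>\<^sup>2 * (cmod b)\<^sup>2 + \<alpha> * \<gamma> * inner a b + \<gamma>\<^sup>2 / 4 * (cmod a)\<^sup>2"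
    unfolding power2_norm_eq_inner
    by (simp add: inner_add_left inner_add_right inner_commute[of b a] power2_eq_square field_simps)
  finally show ?thesis by (simp add: algebra_simps)
qed

lemma energy_nonneg: "energy \<alpha> \<gamma> a b \<ge> 0"
  by (simp add: energy_def)

lemma energy_ge:
  assumes "\<alpha>\<^sup>2 - \<gamma>\<^sup>2 / 4 \<ge> 0"
  shows "(\<alpha>\<^sup>2 - \<gamma>\<^sup>2 / 4) * (cmod a)\<^sup>2 \<le> (energy \<alpha> \<gamma> a b)\<^sup>2"
    and "(\<alpha>\<^sup>2 - \<gamma>\<^sup>2 / 4) * (cmod b)\<^sup>2 \<le> (energy \<alpha> \<gamma> a b)\<^sup>2"
proof -
  have 1: "(\<alpha>\<^sup>2 - \<gamma>\<^sup>2 / 4) * (cmod a)\<^sup>2 \<le> (energy \<alpha> \<gamma> a b)\<^sup>2" for a b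
  proof -
    have "(energy \<alpha> \<gamma> a b)\<^sup>2 = (norm (\<alpha> *\<^sub>R b + (\<gamma> / 2) *\<^sub>R a))\<^sup>2 + (\<alpha>\<^sup>2 - \<gamma>\<^sup>2 / 4) * (cmod a)\<^sup>2"
      using assms by (simp add: energy_def norm_Pair power_mult_distrib)
    then show ?thesis by simp
  qed
  show "(\<alpha>\<^sup>2 - \<gamma>\<^sup>2 / 4) * (cmod a)\<^sup>2 \<le> (energy \<alpha> \<gamma> a b)\<^sup>2" by (rule 1)
  have "(energy \<alpha> \<gamma> a b)\<^sup>2 = (energy \<alpha> \<gamma> b a)\<^sup>2"
    unfolding energy_squared[OF assms] by (simp add: inner_commute add.commute)
  then show "(\<alpha>\<^sup>2 - \<gamma>\<^sup>2 / 4) * (cmod b)\<^sup>2 \<le> (energy \<alpha> \<gamma> a b)\<^sup>2" using 1[of b a] by simp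
qed

text \<open>Bounded variation enters here: the energy changes by the variation of the coefficients,
  relative to the discriminant. Since it is a norm, the inhomogeneity enters additively with factor
  1, which keeps the constant of the estimates sharp.\<close>

lemma energy_step:
  fixes \<alpha> \<alpha>' \<gamma> \<gamma>' :: real and a b b' h :: complex
  assumes c: "\<alpha>\<^sup>2 - \<gamma>\<^sup>2 / 4 > 0" and c': "\<alpha>'\<^sup>2 - \<gamma>'\<^sup>2 / 4 \<ge> 0" and \<alpha>': "\<alpha>' > 0"
    and rec: "\<alpha>' *\<^sub>R b' + \<gamma>' *\<^sub>R b + \<alpha> *\<^sub>R a = h"
  shows "energy \<alpha>' \<gamma>' b b' \<le>
    (1 + (\<bar>\<alpha>'\<^sup>2 - \<alpha>\<^sup>2\<bar> + \<bar>\<gamma>' - \<gamma>\<bar> * \<bar>\<alpha>\<bar>) / (\<alpha>\<^sup>2 - \<gamma>\<^sup>2 / 4)) * energy \<alpha> \<gamma> a b + cmod h"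
proof -
  define d where "d = (\<bar>\<alpha>'\<^sup>2 - \<alpha>\<^sup>2\<bar> + \<bar>\<gamma>' - \<gamma>\<bar> * \<bar>\<alpha>\<bar>) / (\<alpha>\<^sup>2 - \<gamma>\<^sup>2 / 4)"
  have d: "d \<ge> 0" unfolding d_def using c by (intro divide_nonneg_pos add_nonneg_nonneg) auto
  define e where "e = energy \<alpha> \<gamma> a b"
  \<comment> \<open>The next term of the homogeneous recurrence; the actual b' differs from it by h
    / \<alpha>', which moves only the first component of the norm.\<close>
  define s where "s = (- \<gamma>' *\<^sub>R b - \<alpha> *\<^sub>R a) /\<^sub>R \<alpha>'"
  have s: "\<alpha>' *\<^sub>R s = - \<gamma>' *\<^sub>R b - \<alpha> *\<^sub>R a" using \<alpha>' by (simp add: s_def)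
  have b': "\<alpha>' *\<^sub>R b' = \<alpha>' *\<^sub>R s + h" unfolding s rec[symmetric] by simp
  have "energy \<alpha>' \<gamma>' b b' = norm ((\<alpha>' *\<^sub>R s + (\<gamma>' / 2) *\<^sub>R b, sqrt (\<alpha>'\<^sup>2 - \<gamma>'\<^sup>2 / 4) *\<^sub>R b) + (h, 0))"
    by (simp add: energy_def b' algebra_simps)
  also have "\<dots> \<le> energy \<alpha>' \<gamma>' b s + cmod h"
    unfolding energy_def by (rule order_trans[OF norm_triangle_ineq]) (simp add: norm_Pair)
  finally have 1: "energy \<alpha>' \<gamma>' b b' \<le> energy \<alpha>' \<gamma>' b s + cmod h" .
  have "(energy \<alpha>' \<gamma>' b s)\<^sup>2 = \<alpha>'\<^sup>2 * (cmod b)\<^sup>2 + (norm (\<alpha>' *\<^sub>R s))\<^sup>2 + \<gamma>' * inner b (\<alpha>' *\<^sub>R s)"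
    unfolding energy_squared[OF c'] by (simp add: power_mult_distrib algebra_simps)
  also have "\<dots> = \<alpha>'\<^sup>2 * (cmod b)\<^sup>2 + \<alpha>\<^sup>2 * (cmod a)\<^sup>2 + \<gamma>' * \<alpha> * inner a b"
    unfolding s power2_norm_eq_inner
    by (simp add: inner_diff_left inner_diff_right inner_commute[of b a] power2_eq_square algebra_simps)
  also have "\<dots> = e\<^sup>2 + ((\<alpha>'\<^sup>2 - \<alpha>\<^sup>2) * (cmod b)\<^sup>2 + (\<gamma>' - \<gamma>) * \<alpha> * inner a b)"
    unfolding e_def energy_squared[OF less_imp_le[OF c]] by (simp add: algebra_simps)
  also have "\<dots> \<le> e\<^sup>2 + (\<bar>\<alpha>'\<^sup>2 - \<alpha>\<^sup>2\<bar> * (e\<^sup>2 / (\<alpha>\<^sup>2 - \<gamma>\<^sup>2 / 4)) + \<bar>\<gamma>' - \<gamma>\<bar> * \<bar>\<alpha>\<bar> * (e\<^sup>2 / (\<alpha>\<^sup>2 - \<gamma>\<^sup>2 / 4)))"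
  proof -
    have B: "(cmod b)\<^sup>2 \<le> e\<^sup>2 / (\<alpha>\<^sup>2 - \<gamma>\<^sup>2 / 4)" and A: "(cmod a)\<^sup>2 \<le> e\<^sup>2 / (\<alpha>\<^sup>2 - \<gamma>\<^sup>2 / 4)"
      using energy_ge[of \<alpha> \<gamma>, where a = a and b = b] c unfolding e_def by (simp_all add: pos_le_divide_eq mult.commute)
    have "\<bar>inner a b\<bar> \<le> cmod a * cmod b" by (rule Cauchy_Schwarz_ineq2)
    also have "\<dots> \<le> ((cmod a)\<^sup>2 + (cmod b)\<^sup>2) / 2"
      using sum_squares_bound[of "cmod a" "cmod b"] by simp
    also have "\<dots> \<le> e\<^sup>2 / (\<alpha>\<^sup>2 - \<gamma>\<^sup>2 / 4)"
    proof -
      have "(p + t) / 2 \<le> X" if "p \<le> X" "t \<le> X" for p t X :: real using that by simp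
      from this[OF A B] show ?thesis .
    qed
    finally have AB: "\<bar>inner a b\<bar> \<le> e\<^sup>2 / (\<alpha>\<^sup>2 - \<gamma>\<^sup>2 / 4)" .
    have "(\<alpha>'\<^sup>2 - \<alpha>\<^sup>2) * (cmod b)\<^sup>2 \<le> \<bar>\<alpha>'\<^sup>2 - \<alpha>\<^sup>2\<bar> * (e\<^sup>2 / (\<alpha>\<^sup>2 - \<gamma>\<^sup>2 / 4))"
      by (rule order_trans[OF mult_right_mono[OF abs_ge_self] mult_left_mono[OF B]]) auto
    moreover have "(\<gamma>' - \<gamma>) * \<alpha> * inner a b \<le> \<bar>\<gamma>' - \<gamma>\<bar> * \<bar>\<alpha>\<bar> * (e\<^sup>2 / (\<alpha>\<^sup>2 - \<gamma>\<^sup>2 / 4))"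
    proof -
      have "(\<gamma>' - \<gamma>) * \<alpha> * inner a b \<le> \<bar>\<gamma>' - \<gamma>\<bar> * \<bar>\<alpha>\<bar> * \<bar>inner a b\<bar>"
        using abs_ge_self[of "(\<gamma>' - \<gamma>) * \<alpha> * inner a b"] by (simp add: abs_mult)
      also have "\<dots> \<le> \<bar>\<gamma>' - \<gamma>\<bar> * \<bar>\<alpha>\<bar> * (e\<^sup>2 / (\<alpha>\<^sup>2 - \<gamma>\<^sup>2 / 4))" by (intro mult_left_mono AB) auto
      finally show ?thesis .
    qed
    ultimately show ?thesis by simp
  qed
  also have "\<dots> = (1 + d) * e\<^sup>2"
  proof -
    have "E + (A * (E / C) + B * (E / C)) = (1 + (A + B) / C) * E" for A B C E :: real
      by (simp add: add_divide_distrib ring_distribs)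
    then show ?thesis unfolding d_def .
  qed
  \<comment> \<open>Trades the square root of 1 + d for 1 + d, harmless since d will be
    summable.\<close>
  also have "\<dots> \<le> ((1 + d) * e)\<^sup>2"
  proof -
    have "1 + d \<le> (1 + d)\<^sup>2" using d by (intro self_le_power) auto
    then show ?thesis unfolding power_mult_distrib by (rule mult_right_mono) simp
  qed
  finally have "(energy \<alpha>' \<gamma>' b s)\<^sup>2 \<le> ((1 + d) * e)\<^sup>2" .
  then have "energy \<alpha>' \<gamma>' b s \<le> (1 + d) * e"
    by (rule power2_le_imp_le) (use d in \<open>simp add: e_def energy_nonneg\<close>)
  then show ?thesis using 1 unfolding d_def e_def by linarith
qed

text \<open>\<alpha> and \<gamma> are the coefficients satisfied by n^(\<beta>/2) u_n. Positivity of
  the limit c means that the characteristic roots of the limiting recurrence are nonreal and of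
  modulus 1.\<close>

locale elliptic_jacobi = jacobi +
  fixes \<beta> c :: real and \<alpha> \<gamma> :: "nat \<Rightarrow> real"
  defines "\<alpha> \<equiv> \<lambda>n. \<rho> n * (real n powr (- \<beta> / 2) * real (Suc n) powr (- \<beta> / 2))"
    and "\<gamma> \<equiv> \<lambda>n. q n * real n powr (- \<beta>)"
  assumes \<beta>_gt_1: "\<beta> > 1" and bv_\<alpha>: "bv \<alpha>" and bv_\<gamma>: "bv \<gamma>"
    and c_pos: "c > 0" and lim_c: "(\<lambda>n. (\<alpha> n)\<^sup>2 - (\<gamma> n)\<^sup>2 / 4) \<longlonglongrightarrow> c"
begin

section \<open>A priori bounds for solutions in the elliptic case\<close>

definition weight :: "nat \<Rightarrow> real" where
  "weight n = real n powr (- \<beta> / 2)"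

definition scaled :: "cseq \<Rightarrow> cseq" where
  "scaled u n = (real n powr (\<beta> / 2)) *\<^sub>R u n"

lemma weight_nonneg: "weight n \<ge> 0"
  by (simp add: weight_def)

lemma weight_squared: "(weight n)\<^sup>2 = real n powr (- \<beta>)"
  by (cases "n = 0") (simp_all add: weight_def power2_eq_square powr_add[symmetric])

lemma cmod_scaled: "n \<ge> 1 \<Longrightarrow> cmod (u n) = weight n * cmod (scaled u n)"
  by (simp add: weight_def scaled_def powr_minus field_simps)

text \<open>The place where \<beta> > 1 makes bounded scaled solutions square summable.\<close>

lemma summable_weight: "summable (\<lambda>n. (weight n)\<^sup>2)"
  unfolding weight_squared using \<beta>_gt_1 by (simp add: summable_real_powr_iff)

lemma \<alpha>_pos: "n \<ge> 1 \<Longrightarrow> \<alpha> n > 0"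
  using \<rho>_pos by (simp add: \<alpha>_def)

text \<open>Row n + 1 multiplied by (n + 1)^(-\<beta>/2), so that the two off-diagonal coefficients
  become consecutive values of one sequence.\<close>

lemma scaled_recurrence:
  assumes "n \<ge> 1"
  shows "\<alpha> (Suc n) *\<^sub>R scaled u (Suc (Suc n)) + \<gamma> (Suc n) *\<^sub>R scaled u (Suc n) + \<alpha> n *\<^sub>R scaled u n =
    weight (Suc n) *\<^sub>R J u (Suc n)"
proof -
  have p: "real k powr (- \<beta> / 2) * real k powr (\<beta> / 2) = 1" if "k \<ge> 1" for k
    using that by (simp add: powr_add[symmetric])
  have g: "real k powr (- \<beta>) * real k powr (\<beta> / 2) = real k powr (- \<beta> / 2)" for k
    by (simp add: powr_add[symmetric])
  have "\<alpha> (Suc n) *\<^sub>R scaled u (Suc (Suc n)) = (weight (Suc n) * \<rho> (Suc n)) *\<^sub>R u (Suc (Suc n))"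
    using p[of "Suc (Suc n)"] by (simp add: \<alpha>_def scaled_def weight_def mult_ac)
  moreover have "\<gamma> (Suc n) *\<^sub>R scaled u (Suc n) = (weight (Suc n) * q (Suc n)) *\<^sub>R u (Suc n)"
    using g[of "Suc n"] by (simp add: \<gamma>_def scaled_def weight_def mult_ac)
  moreover have "\<alpha> n *\<^sub>R scaled u n = (weight (Suc n) * \<rho> n) *\<^sub>R u n"
    using p[OF assms] by (simp add: \<alpha>_def scaled_def weight_def mult_ac)
  ultimately show ?thesis by (simp add: jacobi_diff_simps scaleR_conv_of_real algebra_simps)
qed

definition local_energy :: "cseq \<Rightarrow> nat \<Rightarrow> real" where
  "local_energy u n = energy (\<alpha> n) (\<gamma> n) (scaled u n) (scaled u (Suc n))"

lemma local_energy_zero: "u n = 0 \<Longrightarrow> u (Suc n) = 0 \<Longrightarrow> local_energy u n = 0"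
  by (simp add: local_energy_def energy_def scaled_def)

text \<open>The growth rate of \<open>energy_step\<close>. The absolute value in the denominator
  keeps it nonnegative also at the initial indices, where the discriminant may have either
  sign.\<close>

definition variation :: "nat \<Rightarrow> real" where
  "variation n = (\<bar>(\<alpha> (Suc n))\<^sup>2 - (\<alpha> n)\<^sup>2\<bar> + \<bar>\<gamma> (Suc n) - \<gamma> n\<bar> * \<bar>\<alpha> n\<bar>) / \<bar>(\<alpha> n)\<^sup>2 - (\<gamma> n)\<^sup>2 / 4\<bar>"

lemma variation_nonneg: "variation n \<ge> 0"
  by (simp add: variation_def)

lemma summable_variation: "summable variation"
proof -
  obtain K where K: "K > 0" "\<And>n. \<bar>\<alpha> n\<bar> \<le> K" using bv_bounded[OF bv_\<alpha>] by metis
  have "\<forall>\<^sub>F n in sequentially. (\<alpha> n)\<^sup>2 - (\<gamma> n)\<^sup>2 / 4 > c / 2"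
    using order_tendstoD(1)[OF lim_c, of "c / 2"] c_pos by simp
  then have "\<forall>\<^sub>F n in sequentially.
      norm (variation n) \<le> (2 * K * \<bar>\<alpha> (Suc n) - \<alpha> n\<bar> + \<bar>\<gamma> (Suc n) - \<gamma> n\<bar> * K) / (c / 2)"
  proof eventually_elim
    case (elim n)
    have "\<bar>(\<alpha> (Suc n))\<^sup>2 - (\<alpha> n)\<^sup>2\<bar> = \<bar>\<alpha> (Suc n) + \<alpha> n\<bar> * \<bar>\<alpha> (Suc n) - \<alpha> n\<bar>"
      by (simp add: abs_mult[symmetric] power2_eq_square algebra_simps)
    also have "\<dots> \<le> 2 * K * \<bar>\<alpha> (Suc n) - \<alpha> n\<bar>"
      using K(2)[of n] K(2)[of "Suc n"] by (intro mult_right_mono) auto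
    finally have "\<bar>(\<alpha> (Suc n))\<^sup>2 - (\<alpha> n)\<^sup>2\<bar> + \<bar>\<gamma> (Suc n) - \<gamma> n\<bar> * \<bar>\<alpha> n\<bar> \<le>
        2 * K * \<bar>\<alpha> (Suc n) - \<alpha> n\<bar> + \<bar>\<gamma> (Suc n) - \<gamma> n\<bar> * K"
      by (intro add_mono mult_left_mono K) auto
    then have "variation n \<le> (2 * K * \<bar>\<alpha> (Suc n) - \<alpha> n\<bar> + \<bar>\<gamma> (Suc n) - \<gamma> n\<bar> * K) / (c / 2)"
      unfolding variation_def using elim c_pos K(1) by (intro frac_le) (auto intro!: add_nonneg_nonneg)
    then show ?case using variation_nonneg[of n] by simp
  qed
  moreover have "summable (\<lambda>n. (2 * K * \<bar>\<alpha> (Suc n) - \<alpha> n\<bar> + \<bar>\<gamma> (Suc n) - \<gamma> n\<bar> * K) / (c / 2))"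
    using bv_\<alpha> bv_\<gamma> unfolding bv_def by (intro summable_divide summable_add summable_mult summable_mult2)
  ultimately show ?thesis by (rule summable_comparison_test_ev)
qed

text \<open>Any constant above 1 / sqrt c is reached by starting late. M is uniform in the starting
  index and in u, so the estimate can be restarted at the beginning of each block.\<close>

lemma solution_bound:
  assumes \<kappa>: "\<kappa> > 1 / sqrt c"
  shows "\<exists>M\<ge>1. \<forall>m\<ge>M. \<forall>u. \<forall>n>m. cmod (scaled u n) \<le>
    \<kappa> * (local_energy u m + (\<Sum>k=Suc m..<n. weight k * cmod (J u k)))"
proof -
  have sc: "sqrt c > 0" using c_pos by simp
  \<comment> \<open>The room between 1 and \<kappa> sqrt c is split: beyond M the energy grows by a
    factor of at most \<delta>, and the root of the discriminant exceeds \<delta> / \<kappa>. Their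
    quotient is \<kappa>.\<close>
  define \<delta> where "\<delta> = (\<kappa> * sqrt c + 1) / 2"
  have ksc: "\<kappa> * sqrt c > 1" using \<kappa> sc by (simp add: field_simps)
  then have \<delta>: "\<delta> > 1" "\<delta> < \<kappa> * sqrt c" by (auto simp: \<delta>_def)
  have \<kappa>0: "\<kappa> > 0" using ksc sc by (smt (verit) mult_nonpos_nonneg)
  have "(\<delta> / \<kappa>)\<^sup>2 < c"
  proof -
    have "\<delta> / \<kappa> < sqrt c" using \<delta> \<kappa>0 by (simp add: field_simps)
    then have "(\<delta> / \<kappa>)\<^sup>2 < (sqrt c)\<^sup>2" using \<delta> \<kappa>0 by (intro power_strict_mono) auto
    then show ?thesis using c_pos by simp
  qed
  from order_tendstoD(1)[OF lim_c this] obtain M1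
    where M1: "\<And>n. n \<ge> M1 \<Longrightarrow> (\<delta> / \<kappa>)\<^sup>2 < (\<alpha> n)\<^sup>2 - (\<gamma> n)\<^sup>2 / 4"
    unfolding eventually_sequentially by auto
  obtain M2 where M2: "\<And>m n. m \<ge> M2 \<Longrightarrow> (\<Sum>k=m..<n. variation k) < ln \<delta>"
  proof -
    obtain M2 where "\<forall>m\<ge>M2. \<forall>n. norm (\<Sum>k=m..<n. variation k) < ln \<delta>"
      using summable_variation[unfolded summable_Cauchy, rule_format, of "ln \<delta>"] \<delta>(1) by auto
    then show ?thesis using that[of M2] by (auto simp: sum_nonneg variation_nonneg)
  qed
  define M where "M = max 1 (max M1 M2)"
  have "cmod (scaled u n) \<le> \<kappa> * (local_energy u m + (\<Sum>k=Suc m..<n. weight k * cmod (J u k)))"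
    if m: "m \<ge> M" and n: "n > m" for m u n
  proof -
    have cpos: "(\<alpha> k)\<^sup>2 - (\<gamma> k)\<^sup>2 / 4 > 0" if "k \<ge> M" for k
      using M1[of k] that by (smt (verit) M_def max.bounded_iff zero_le_power2)
    define l where "l = n - 1"
    have l: "n = Suc l" "l \<ge> m" using n by (auto simp: l_def)
    have "local_energy u l \<le> exp (\<Sum>k=m..<l. variation k) *
        (local_energy u m + (\<Sum>k=m..<l. weight (Suc k) * cmod (J u (Suc k))))"
    proof (rule discrete_growth_bound[OF _ _ _ _ l(2)])
      fix k assume k: "k \<ge> m"
      have "local_energy u (Suc k) \<le> (1 + variation k) * local_energy u k + cmod (weight (Suc k) *\<^sub>R J u (Suc k))"
        using energy_step[OF cpos[of k] less_imp_le[OF cpos[of "Suc k"]] \<alpha>_pos[of "Suc k"] scaled_recurrence[of k u]]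
          cpos[of k] k m
        by (simp add: local_energy_def variation_def M_def)
      then show "local_energy u (Suc k) \<le> (1 + variation k) * local_energy u k + weight (Suc k) * cmod (J u (Suc k))"
        by (simp add: weight_nonneg)
    qed (auto simp: variation_nonneg weight_nonneg local_energy_def energy_nonneg)
    also have "\<dots> \<le> \<delta> * (local_energy u m + (\<Sum>k=m..<l. weight (Suc k) * cmod (J u (Suc k))))"
    proof (rule mult_right_mono)
      have "(\<Sum>k=m..<l. variation k) \<le> ln \<delta>" using M2[of m l] m by (simp add: M_def)
      then have "exp (\<Sum>k=m..<l. variation k) \<le> exp (ln \<delta>)" by simp
      then show "exp (\<Sum>k=m..<l. variation k) \<le> \<delta>" using \<delta> by simp
    qed (auto simp: local_energy_def energy_nonneg weight_nonneg intro!: add_nonneg_nonneg sum_nonneg)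
    also have "(\<Sum>k=m..<l. weight (Suc k) * cmod (J u (Suc k))) = (\<Sum>k=Suc m..<n. weight k * cmod (J u k))"
      unfolding l(1) by (rule sum.shift_bounds_Suc_ivl[symmetric])
    finally have E: "local_energy u l \<le> \<delta> * (local_energy u m + (\<Sum>k=Suc m..<n. weight k * cmod (J u k)))" .
    have "(\<delta> / \<kappa> * cmod (scaled u n))\<^sup>2 \<le> ((\<alpha> l)\<^sup>2 - (\<gamma> l)\<^sup>2 / 4) * (cmod (scaled u n))\<^sup>2"
      unfolding power_mult_distrib using M1[of l] l m by (intro mult_right_mono) (auto simp: M_def)
    also have "\<dots> \<le> (local_energy u l)\<^sup>2"
      unfolding local_energy_def l(1) using cpos[of l] l m by (intro energy_ge) auto
    finally have "\<delta> / \<kappa> * cmod (scaled u n) \<le> local_energy u l"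
      by (rule power2_le_imp_le) (simp add: local_energy_def energy_nonneg)
    then have "\<delta> / \<kappa> * cmod (scaled u n) \<le> \<delta> * (local_energy u m + (\<Sum>k=Suc m..<n. weight k * cmod (J u k)))"
      using E by linarith
    then have "\<delta> * (cmod (scaled u n) / \<kappa>) \<le> \<delta> * (local_energy u m + (\<Sum>k=Suc m..<n. weight k * cmod (J u k)))"
      by simp
    then have "cmod (scaled u n) / \<kappa> \<le> local_energy u m + (\<Sum>k=Suc m..<n. weight k * cmod (J u k))"
      using \<delta>(1) by (subst (asm) mult_le_cancel_left_pos) auto
    then show ?thesis using \<kappa>0 by (simp only: pos_divide_le_eq mult.commute)
  qed
  then show ?thesis by (intro exI[of _ M]) (auto simp: M_def)
qed

lemma sum_weight_le: "finite I \<Longrightarrow> (\<Sum>k\<in>I. (weight k)\<^sup>2) \<le> (\<Sum>k. (weight k)\<^sup>2)"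
  by (rule sum_le_suminf[OF summable_weight]) auto

text \<open>For Ju = i u the inhomogeneity is \<open>(weight k)\<^sup>2\<close> times the modulus of
  the scaled solution itself, a summable kernel.\<close>

lemma scaled_sol_i_bounded: "\<exists>B. \<forall>n. cmod (scaled (sol \<i>) n) \<le> B"
proof -
  define \<kappa> where "\<kappa> = 1 / sqrt c + 1"
  have \<kappa>0: "\<kappa> > 0" using c_pos by (simp add: \<kappa>_def add_pos_pos)
  obtain M where M: "M \<ge> 1" "\<And>m u n. m \<ge> M \<Longrightarrow> n > m \<Longrightarrow> cmod (scaled u n) \<le>
      \<kappa> * (local_energy u m + (\<Sum>k=Suc m..<n. weight k * cmod (J u k)))"
    using solution_bound[of \<kappa>] by (auto simp: \<kappa>_def)
  define x where "x n = cmod (scaled (sol \<i>) n)" for n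
  define E where "E = \<kappa> * local_energy (sol \<i>) M"
  \<comment> \<open>The right side of the estimate. It satisfies a one-step inequality, to which
    Gronwall applies, and dominates x.\<close>
  define s where "s n = E + (\<Sum>k=Suc M..<n. \<kappa> * (weight k)\<^sup>2 * x k)" for n
  have xs: "x n \<le> s n" if n: "n > M" for n
  proof -
    have "weight k * cmod (J (sol \<i>) k) = (weight k)\<^sup>2 * x k" if "k \<in> {Suc M..<n}" for k
      using that M(1) cmod_scaled[of k "sol \<i>"] by (simp add: J_sol norm_mult x_def power2_eq_square)
    then have "x n \<le> \<kappa> * (local_energy (sol \<i>) M + (\<Sum>k=Suc M..<n. (weight k)\<^sup>2 * x k))"
      using M(2)[of M n "sol \<i>"] n by (simp add: x_def)
    then show ?thesis by (simp add: s_def E_def algebra_simps sum_distrib_left)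
  qed
  have s_bound: "s n \<le> exp (\<Sum>k=Suc M..<n. \<kappa> * (weight k)\<^sup>2) * (s (Suc M) + (\<Sum>k=Suc M..<n. 0))" if "n \<ge> Suc M" for n
  proof (rule discrete_growth_bound[OF _ _ _ _ that])
    fix k assume k: "k \<ge> Suc M"
    have "s (Suc k) = s k + \<kappa> * (weight k)\<^sup>2 * x k" using k by (simp add: s_def)
    also have "\<dots> \<le> s k + \<kappa> * (weight k)\<^sup>2 * s k" using xs[of k] k \<kappa>0 by (intro add_left_mono mult_left_mono) auto
    finally show "s (Suc k) \<le> (1 + \<kappa> * (weight k)\<^sup>2) * s k + 0" by (simp add: algebra_simps)
  qed (use \<kappa>0 in \<open>auto simp: s_def E_def local_energy_def energy_nonneg\<close>)
  define B where "B = exp (\<kappa> * (\<Sum>k. (weight k)\<^sup>2)) * E"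
  have E0: "E \<ge> 0" using \<kappa>0 by (simp add: E_def local_energy_def energy_nonneg)
  have xB: "x n \<le> B" if n: "n > M" for n
  proof -
    have "x n \<le> exp (\<Sum>k=Suc M..<n. \<kappa> * (weight k)\<^sup>2) * E"
      using xs[OF n] s_bound[of n] n by (simp add: s_def)
    also have "\<dots> \<le> B"
      unfolding B_def using \<kappa>0 E0 sum_weight_le[of "{Suc M..<n}"]
      by (intro mult_right_mono) (auto simp: sum_distrib_left[symmetric])
    finally show ?thesis .
  qed
  have "x n \<le> max B (Max (x ` {..M}))" for n
  proof (cases "n > M")
    case False
    then have "x n \<le> Max (x ` {..M})" by (intro Max_ge) auto
    then show ?thesis by simp
  qed (use xB in \<open>simp add: le_max_iff_disj\<close>)
  then show ?thesis unfolding x_def by blast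
qed

lemma sol_i_ell2: "sol \<i> \<in> ell2"
proof -
  obtain B where B: "\<And>n. cmod (scaled (sol \<i>) n) \<le> B" using scaled_sol_i_bounded by blast
  have "summable (\<lambda>n. (cmod (sol \<i> n))\<^sup>2)"
  proof (rule summable_comparison_test'[of _ 1])
    show "summable (\<lambda>n. (weight n)\<^sup>2 * B\<^sup>2)" by (rule summable_mult2[OF summable_weight])
    fix n :: nat assume n: "n \<ge> 1"
    have "cmod (sol \<i> n) \<le> weight n * B"
      unfolding cmod_scaled[OF n, of "sol \<i>"] by (intro mult_left_mono B weight_nonneg)
    then have "(cmod (sol \<i> n))\<^sup>2 \<le> (weight n * B)\<^sup>2" by (intro power_mono) auto
    then show "norm ((cmod (sol \<i> n))\<^sup>2) \<le> (weight n)\<^sup>2 * B\<^sup>2" by (simp add: power_mult_distrib)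
  qed
  then show ?thesis by (simp add: ell2_def)
qed

text \<open>The energy at the fixed index M depends on two coordinates and is bounded by |x|; the
  inhomogeneous part is bounded by |y| through Cauchy-Schwarz. Hence h decays like the
  weight.\<close>

lemma maximal_domain_dominated:
  "\<exists>h. summable (\<lambda>n. (h n)\<^sup>2) \<and>
     (\<forall>x y. (x, y) \<in> maximal_graph \<rho> q \<longrightarrow> (\<forall>n. cmod (seq_of x n) \<le> h n * (norm x + norm y)))"
proof -
  define \<kappa> where "\<kappa> = 1 / sqrt c + 1"
  have \<kappa>0: "\<kappa> > 0" using c_pos by (simp add: \<kappa>_def add_pos_pos)
  obtain M where M: "M \<ge> 1" "\<And>m u n. m \<ge> M \<Longrightarrow> n > m \<Longrightarrow> cmod (scaled u n) \<le>
      \<kappa> * (local_energy u m + (\<Sum>k=Suc m..<n. weight k * cmod (J u k)))"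
    using solution_bound[of \<kappa>] by (auto simp: \<kappa>_def)
  define W where "W = sqrt (\<Sum>k. (weight k)\<^sup>2)"
  define C where "C = \<bar>\<alpha> M\<bar> * real (Suc M) powr (\<beta> / 2) + \<bar>\<gamma> M\<bar> / 2 * real M powr (\<beta> / 2) +
      \<bar>sqrt ((\<alpha> M)\<^sup>2 - (\<gamma> M)\<^sup>2 / 4)\<bar> * real M powr (\<beta> / 2)"
  have C0: "C \<ge> 0" by (simp add: C_def)
  define h where "h n = (if n \<le> M then 1 else weight n * (\<kappa> * (C + W)))" for n
  have "summable (\<lambda>n. (h n)\<^sup>2)"
  proof (rule summable_comparison_test'[of _ "Suc M"])
    show "summable (\<lambda>n. (weight n)\<^sup>2 * (\<kappa> * (C + W))\<^sup>2)" by (rule summable_mult2[OF summable_weight])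
  qed (simp add: h_def power_mult_distrib)
  moreover have "cmod (seq_of x n) \<le> h n * (norm x + norm y)" if xy: "(x, y) \<in> maximal_graph \<rho> q" for x y n
  proof (cases "n \<le> M")
    case True
    then show ?thesis using cmod_seq_of_le[of x n] by (simp add: h_def add_increasing2)
  next
    case False
    have y: "J (seq_of x) = seq_of y" using xy by (simp add: maximal_graph_def)
    have "local_energy (seq_of x) M \<le> C * norm x"
    proof -
      have "local_energy (seq_of x) M \<le> cmod (\<alpha> M *\<^sub>R scaled (seq_of x) (Suc M) + (\<gamma> M / 2) *\<^sub>R scaled (seq_of x) M) +
          cmod (sqrt ((\<alpha> M)\<^sup>2 - (\<gamma> M)\<^sup>2 / 4) *\<^sub>R scaled (seq_of x) M)"
        unfolding local_energy_def energy_def by (rule norm_Pair_le)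
      also have "\<dots> \<le> cmod (\<alpha> M *\<^sub>R scaled (seq_of x) (Suc M)) + cmod ((\<gamma> M / 2) *\<^sub>R scaled (seq_of x) M) +
          cmod (sqrt ((\<alpha> M)\<^sup>2 - (\<gamma> M)\<^sup>2 / 4) *\<^sub>R scaled (seq_of x) M)"
        by (intro add_right_mono norm_triangle_ineq)
      also have "\<dots> \<le> C * norm x"
      proof -
        have "cmod (t *\<^sub>R scaled (seq_of x) k) \<le> \<bar>t\<bar> * real k powr (\<beta> / 2) * norm x" for t k
          by (simp add: scaled_def abs_mult mult.assoc mult_left_mono cmod_seq_of_le)
        from this[of "\<alpha> M" "Suc M"] this[of "\<gamma> M / 2" M] this[of "sqrt ((\<alpha> M)\<^sup>2 - (\<gamma> M)\<^sup>2 / 4)" M]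
        show ?thesis unfolding C_def distrib_right by simp
      qed
      finally show ?thesis .
    qed
    moreover have "(\<Sum>k=Suc M..<n. weight k * cmod (J (seq_of x) k)) \<le> W * norm y"
    proof -
      have "(\<Sum>k=Suc M..<n. weight k * cmod (seq_of y k)) \<le>
          L2_set weight {Suc M..<n} * L2_set (\<lambda>k. cmod (seq_of y k)) {Suc M..<n}"
        using L2_set_mult_ineq[of weight "\<lambda>k. cmod (seq_of y k)" "{Suc M..<n}"] by (simp add: weight_nonneg)
      also have "\<dots> \<le> W * norm y"
      proof (intro mult_mono)
        show "L2_set weight {Suc M..<n} \<le> W"
          unfolding L2_set_def W_def using sum_weight_le[of "{Suc M..<n}"] by simp
        have "(\<Sum>k=Suc M..<n. (cmod (seq_of y k))\<^sup>2) \<le> (\<Sum>k<n. (cmod (seq_of y k))\<^sup>2)" by (intro sum_mono2) auto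
        then have "(\<Sum>k=Suc M..<n. (cmod (seq_of y k))\<^sup>2) \<le> (norm y)\<^sup>2" using sum_cmod_le_norm[of y n] by linarith
        then show "L2_set (\<lambda>k. cmod (seq_of y k)) {Suc M..<n} \<le> norm y"
          unfolding L2_set_def by (intro real_le_lsqrt) auto
      qed (auto simp: W_def suminf_nonneg summable_weight)
      finally show ?thesis by (simp add: y)
    qed
    ultimately have "cmod (scaled (seq_of x) n) \<le> \<kappa> * (C * norm x + W * norm y)"
      using M(2)[of M n "seq_of x"] False \<kappa>0 by (smt (verit) add_mono mult_left_mono not_le order_refl)
    also have "\<dots> \<le> \<kappa> * ((C + W) * (norm x + norm y))"
    proof -
      have "0 \<le> C * norm y" "0 \<le> W * norm x"
        using C0 by (auto simp: W_def suminf_nonneg summable_weight intro!: mult_nonneg_nonneg)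
      then show ?thesis using \<kappa>0 by (intro mult_left_mono) (auto simp: algebra_simps)
    qed
    finally have "weight n * cmod (scaled (seq_of x) n) \<le> weight n * (\<kappa> * ((C + W) * (norm x + norm y)))"
      by (intro mult_left_mono weight_nonneg)
    then show ?thesis using cmod_scaled[of n "seq_of x"] False by (simp add: h_def mult.assoc)
  qed
  ultimately show ?thesis by blast
qed

end


section \<open>Upper bound for the number of eigenvalues\<close>

lemma sum_powr_tail_le:
  assumes "\<beta> > 1" "N \<ge> 1"
  shows "(\<Sum>j\<in>{N<..n}. real j powr (- \<beta>)) \<le> real N powr (1 - \<beta>) / (\<beta> - 1)"
proof -
  have increment: "(\<beta> - 1) * real (Suc k) powr (- \<beta>) \<le> real k powr (1 - \<beta>) - real (Suc k) powr (1 - \<beta>)" if k: "k \<ge> 1" for k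
  proof -
    have "\<exists>\<xi>. real k < \<xi> \<and> \<xi> < real (Suc k) \<and>
        real (Suc k) powr (1 - \<beta>) - real k powr (1 - \<beta>) = (real (Suc k) - real k) * ((1 - \<beta>) * \<xi> powr (- \<beta>))"
    proof (rule MVT2)
      fix x :: real assume "real k \<le> x"
      then have "x > 0" using k by linarith
      then show "((\<lambda>x. x powr (1 - \<beta>)) has_real_derivative (1 - \<beta>) * x powr (- \<beta>)) (at x)"
        by (auto intro!: derivative_eq_intros)
    qed simp
    then obtain \<xi> where \<xi>: "real k < \<xi>" "\<xi> < real (Suc k)"
        "real (Suc k) powr (1 - \<beta>) - real k powr (1 - \<beta>) = (1 - \<beta>) * \<xi> powr (- \<beta>)" by auto
    have "real (Suc k) powr (- \<beta>) \<le> \<xi> powr (- \<beta>)"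
      using \<xi> assms k by (intro powr_mono2') auto
    then have "(\<beta> - 1) * real (Suc k) powr (- \<beta>) \<le> (\<beta> - 1) * \<xi> powr (- \<beta>)"
      using assms by (intro mult_left_mono) auto
    then show ?thesis using \<xi>(3) by (simp add: algebra_simps)
  qed
  have "(\<beta> - 1) * (\<Sum>j\<in>{N<..n}. real j powr (- \<beta>)) \<le> real N powr (1 - \<beta>) - real n powr (1 - \<beta>)" if "n \<ge> N"
    using that
  proof (induction n rule: dec_induct)
    case (step k)
    have "{N<..Suc k} = insert (Suc k) {N<..k}" using step by auto
    then show ?case using step.IH \<open>k \<ge> N\<close> assms(2) increment[of k] by (simp add: algebra_simps)
  qed simp
  note telescoped = this
  have "(\<beta> - 1) * (\<Sum>j\<in>{N<..n}. real j powr (- \<beta>)) \<le> real N powr (1 - \<beta>)"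
  proof (cases "n \<ge> N")
    case True
    then show ?thesis using telescoped powr_ge_zero[of "real n" "1 - \<beta>"] by linarith
  next
    case False
    then have "{N<..n} = {}" by auto
    then show ?thesis by simp
  qed
  then show ?thesis using assms(1) by (simp add: pos_le_divide_eq mult.commute)
qed

context elliptic_jacobi
begin

text \<open>A new block starts whenever \<open>\<kappa>' r \<Sum> k\<^sup>-\<^sup>\<beta>\<close> passes an integer. The conditions at
  the second index of each block annihilate its initial energy.\<close>

lemma separating_conditions:
  assumes \<kappa>': "\<kappa>' > 1 / sqrt c"
  shows "\<exists>r0>0. \<forall>r\<ge>r0. \<exists>Z. finite Z \<and> real (card Z) \<le> \<beta> / (\<beta> - 1) * (2 * \<kappa>' * r) powr (1 / \<beta>) + 3 \<and>
    (\<forall>x y. (x, y) \<in> maximal_graph \<rho> q \<longrightarrow> (\<forall>n\<in>Z. seq_of x n = 0) \<longrightarrow> norm y \<le> r * norm x \<longrightarrow> x = 0)"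
proof -
  \<comment> \<open>The margin between \<kappa> and \<kappa>' makes the final inequality strict: it
    reads 1 \<le> (\<kappa> / \<kappa>')^2.\<close>
  define \<kappa> where "\<kappa> = (1 / sqrt c + \<kappa>') / 2"
  have \<kappa>: "\<kappa> > 1 / sqrt c" "\<kappa> < \<kappa>'" using \<kappa>' by (auto simp: \<kappa>_def)
  have "1 / sqrt c > 0" using c_pos by simp
  then have \<kappa>0: "\<kappa> > 0" "\<kappa>' > 0" using \<kappa> by linarith+
  obtain M where M: "M \<ge> 1" "\<And>m u n. m \<ge> M \<Longrightarrow> n > m \<Longrightarrow> cmod (scaled u n) \<le>
      \<kappa> * (local_energy u m + (\<Sum>k=Suc m..<n. weight k * cmod (J u k)))"
    using solution_bound[OF \<kappa>(1)] by auto
  define r0 where "r0 = real M powr \<beta> / (2 * \<kappa>')"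
  have r0: "r0 > 0" using M(1) \<kappa>0 by (simp add: r0_def)
  have "\<exists>Z. finite Z \<and> real (card Z) \<le> \<beta> / (\<beta> - 1) * (2 * \<kappa>' * r) powr (1 / \<beta>) + 3 \<and>
    (\<forall>x y. (x, y) \<in> maximal_graph \<rho> q \<longrightarrow> (\<forall>n\<in>Z. seq_of x n = 0) \<longrightarrow> norm y \<le> r * norm x \<longrightarrow> x = 0)"
    if r: "r \<ge> r0" for r
  proof -
    have r_pos: "r > 0" using r r0 by linarith
    \<comment> \<open>N plus two conditions per block costs about N + 2 \<kappa>' r N^(1-\<beta>) /
      (\<beta> - 1), minimal at N^\<beta> = 2 \<kappa>' r. With this X the cost is X + X / (\<beta>
      - 1) = \<beta> / (\<beta> - 1) X, up to the rounding in +3. The threshold r0 ensures X \<ge>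
      M.\<close>
    define X where "X = (2 * \<kappa>' * r) powr (1 / \<beta>)"
    define N where "N = nat \<lceil>X\<rceil>"
    have X\<beta>: "X powr \<beta> = 2 * \<kappa>' * r" using \<beta>_gt_1 \<kappa>0 r_pos by (simp add: X_def powr_powr)
    have X0: "X > 0" using \<kappa>0 r_pos by (simp add: X_def)
    have NX: "X \<le> real N" "real N \<le> X + 1" using X0 by (auto simp: N_def)
    have MX: "real M \<le> X"
    proof -
      have "real M powr \<beta> \<le> 2 * \<kappa>' * r" using r \<kappa>0 by (simp add: r0_def pos_divide_le_eq mult_ac)
      then have "(real M powr \<beta>) powr (1 / \<beta>) \<le> X" unfolding X_def using \<beta>_gt_1 by (intro powr_mono2) auto
      then show ?thesis using \<beta>_gt_1 by (simp add: powr_powr)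
    qed
    have MN: "M \<le> N" using MX NX(1) by simp
    define \<Phi> where "\<Phi> n = \<kappa>' * r * (\<Sum>j\<in>{N<..n}. (weight j)\<^sup>2)" for n
    define blk where "blk n = nat \<lfloor>\<Phi> n\<rfloor>" for n
    have \<Phi>_nonneg: "\<Phi> n \<ge> 0" for n unfolding \<Phi>_def using \<kappa>0 r_pos by (intro mult_nonneg_nonneg sum_nonneg) auto
    have \<Phi>_mono: "\<Phi> m \<le> \<Phi> n" if "m \<le> n" for m n
      unfolding \<Phi>_def using \<kappa>0 r_pos that by (intro mult_left_mono sum_mono2) auto
    have blk_mono: "blk m \<le> blk n" if "m \<le> n" for m n
      unfolding blk_def using \<Phi>_mono[OF that] by (intro nat_mono floor_mono)
    have \<Phi>_le: "\<Phi> n \<le> X / (2 * (\<beta> - 1))" for n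
    proof -
      have "\<Phi> n \<le> \<kappa>' * r * (real N powr (1 - \<beta>) / (\<beta> - 1))"
        unfolding \<Phi>_def weight_squared using \<kappa>0 r_pos \<beta>_gt_1 MN M(1)
        by (intro mult_left_mono sum_powr_tail_le) auto
      also have "\<dots> \<le> \<kappa>' * r * (X powr (1 - \<beta>) / (\<beta> - 1))"
        using \<kappa>0 r_pos \<beta>_gt_1 X0 NX by (intro mult_left_mono divide_right_mono powr_mono2') auto
      also have "\<kappa>' * r = X powr \<beta> / 2" by (simp add: X\<beta>)
      also have "X powr \<beta> / 2 * (X powr (1 - \<beta>) / (\<beta> - 1)) = (X powr \<beta> * X powr (1 - \<beta>)) / (2 * (\<beta> - 1))" by simp
      also have "X powr \<beta> * X powr (1 - \<beta>) = X" using X0 by (simp add: powr_add[symmetric])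
      finally show ?thesis .
    qed
    \<comment> \<open>Indices in one block share the integer part of \<Phi>, so \<Phi> grows by less
      than 1 between them.\<close>
    have blk_sum: "\<kappa>' * r * (\<Sum>j\<in>F. (weight j)\<^sup>2) \<le> 1"
      if F: "finite F" "\<And>j. j \<in> F \<Longrightarrow> j > k \<and> blk j = blk k" and k: "k \<ge> N" for F k
    proof (cases "F = {}")
      case False
      define m where "m = Max F"
      have m: "m \<in> F" "\<And>j. j \<in> F \<Longrightarrow> j \<le> m" using F(1) False by (auto simp: m_def)
      have "{N<..m} = {N<..k} \<union> {k<..m}" using k F(2)[OF m(1)] by auto
      then have "(\<Sum>j\<in>{N<..m}. (weight j)\<^sup>2) = (\<Sum>j\<in>{N<..k}. (weight j)\<^sup>2) + (\<Sum>j\<in>{k<..m}. (weight j)\<^sup>2)"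
        by (simp add: sum.union_disjoint)
      then have "\<Phi> m = \<Phi> k + \<kappa>' * r * (\<Sum>j\<in>{k<..m}. (weight j)\<^sup>2)" by (simp add: \<Phi>_def algebra_simps)
      moreover have "\<Phi> m < \<Phi> k + 1"
        using F(2)[OF m(1)] \<Phi>_nonneg[of m] \<Phi>_nonneg[of k] unfolding blk_def by (simp add: nat_eq_iff) linarith
      ultimately have "\<kappa>' * r * (\<Sum>j\<in>{k<..m}. (weight j)\<^sup>2) \<le> 1" by linarith
      moreover have "\<kappa>' * r * (\<Sum>j\<in>F. (weight j)\<^sup>2) \<le> \<kappa>' * r * (\<Sum>j\<in>{k<..m}. (weight j)\<^sup>2)"
        using F(2) m(2) \<kappa>0 r_pos by (intro mult_left_mono sum_mono2) auto
      ultimately show ?thesis by linarith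
    qed simp
    \<comment> \<open>The first indices of the blocks after the initial one. Each has a new value of
      \<open>blk\<close>, so there are at most as many as the total integer growth of
      \<Phi>.\<close>
    define D where "D = {n. n > N \<and> blk n \<noteq> blk (n - 1)}"
    have D_inj: "inj_on blk D"
    proof (rule linorder_inj_onI')
      fix m n assume "m \<in> D" "n \<in> D" "m < n"
      then have "blk m \<le> blk (n - 1)" "blk (n - 1) \<le> blk n" "blk (n - 1) \<noteq> blk n"
        by (auto simp: D_def intro!: blk_mono)
      then show "blk m \<noteq> blk n" by linarith
    qed
    define b where "b = nat \<lfloor>X / (2 * (\<beta> - 1))\<rfloor>"
    have D_img: "blk ` D \<subseteq> {1..b}"
    proof
      fix t assume "t \<in> blk ` D"
      then obtain n where n: "n \<in> D" "t = blk n" by auto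
      have "blk (n - 1) \<le> blk n" by (intro blk_mono) auto
      then have "blk n \<ge> 1" using n(1) by (auto simp: D_def)
      moreover have "blk n \<le> b" unfolding blk_def b_def by (intro nat_mono floor_mono \<Phi>_le)
      ultimately show "t \<in> {1..b}" using n(2) by simp
    qed
    have D_fin: "finite D" using D_img D_inj by (meson finite_atLeastAtMost finite_imageD finite_subset)
    have "card D \<le> b" using card_mono[OF _ D_img] card_image[OF D_inj] by simp
    moreover have "real b \<le> X / (2 * (\<beta> - 1))"
      unfolding b_def using X0 \<beta>_gt_1 by (simp add: of_nat_nat)
    ultimately have D_card: "real (card D) \<le> X / (2 * (\<beta> - 1))" by linarith
    \<comment> \<open>The energy at a block start involves two consecutive entries; N and N + 1
      serve the block that begins at N.\<close>
    define Z where "Z = {..Suc N} \<union> D \<union> Suc ` D"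
    have "card Z \<le> card {..Suc N} + card D + card (Suc ` D)"
      unfolding Z_def by (intro order_trans[OF card_Un_le] add_right_mono card_Un_le)
    also have "card (Suc ` D) = card D" by (simp add: card_image)
    finally have "real (card Z) \<le> real N + 2 + 2 * real (card D)" by simp
    also have "\<dots> \<le> X + 3 + 2 * (X / (2 * (\<beta> - 1)))" using NX D_card by linarith
    also have "\<dots> = \<beta> / (\<beta> - 1) * X + 3" using \<beta>_gt_1 by (simp add: field_simps)
    finally have Z_card: "real (card Z) \<le> \<beta> / (\<beta> - 1) * X + 3" .
    have "x = 0" if xy: "(x, y) \<in> maximal_graph \<rho> q" "\<forall>n\<in>Z. seq_of x n = 0" "norm y \<le> r * norm x" for x y
    proof (rule ccontr)
      assume "x \<noteq> 0"
      have y: "J (seq_of x) = seq_of y" using xy(1) by (simp add: maximal_graph_def)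
      define g where "g k = (cmod (seq_of y k))\<^sup>2" for k
      \<comment> \<open>The estimate restarted at the first index m of the block of n, where the
        energy is 0, followed by Cauchy-Schwarz. This uses the block bound once, for the sum over
        k.\<close>
      have pt: "(cmod (seq_of x n))\<^sup>2 \<le> \<kappa>\<^sup>2 / (\<kappa>' * r) * (\<Sum>k | N < k \<and> k < n \<and> blk k = blk n. (weight n)\<^sup>2 * g k)" for n
      proof (cases "n \<le> N")
        case True
        then have "seq_of x n = 0" using xy(2) by (simp add: Z_def)
        moreover have "\<kappa>\<^sup>2 / (\<kappa>' * r) * (\<Sum>k | N < k \<and> k < n \<and> blk k = blk n. (weight n)\<^sup>2 * g k) \<ge> 0"
          using \<kappa>0 r_pos by (intro mult_nonneg_nonneg sum_nonneg divide_nonneg_pos) (auto simp: g_def)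
        ultimately show ?thesis by simp
      next
        case False
        define m where "m = (LEAST m. m \<ge> N \<and> blk m = blk n)"
        have m: "m \<ge> N" "blk m = blk n" "m \<le> n"
          using LeastI[of "\<lambda>m. m \<ge> N \<and> blk m = blk n" n] Least_le[of "\<lambda>m. m \<ge> N \<and> blk m = blk n" n] False
          by (auto simp: m_def)
        have mZ: "m \<in> Z" "Suc m \<in> Z"
        proof -
          have "m = N \<or> m \<in> D"
          proof (rule disjCI)
            assume "m \<notin> D"
            show "m = N"
            proof (rule ccontr)
              assume "m \<noteq> N"
              then have "m - 1 \<ge> N \<and> blk (m - 1) = blk n" using m \<open>m \<notin> D\<close> by (auto simp: D_def)
              then have "m \<le> m - 1" unfolding m_def by (rule Least_le)
              then show False using m(1) \<open>m \<noteq> N\<close> by linarith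
            qed
          qed
          then show "m \<in> Z" "Suc m \<in> Z" by (auto simp: Z_def)
        qed
        show ?thesis
        proof (cases "m = n")
          case True
          then have "seq_of x n = 0" using xy(2) mZ by simp
          moreover have "\<kappa>\<^sup>2 / (\<kappa>' * r) * (\<Sum>k | N < k \<and> k < n \<and> blk k = blk n. (weight n)\<^sup>2 * g k) \<ge> 0"
            using \<kappa>0 r_pos by (intro mult_nonneg_nonneg sum_nonneg divide_nonneg_pos) (auto simp: g_def)
          ultimately show ?thesis by simp
        next
          case neq: False
          have blk_eq: "blk k = blk n" if "k \<in> {Suc m..<n}" for k
            using blk_mono[of m k] blk_mono[of k n] that m(2) by auto
          have "local_energy (seq_of x) m = 0" using xy(2) mZ by (intro local_energy_zero) auto
          then have "cmod (scaled (seq_of x) n) \<le> \<kappa> * (\<Sum>k=Suc m..<n. weight k * cmod (seq_of y k))"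
            using M(2)[of m n "seq_of x"] m neq MN by (simp add: y)
          also have "\<dots> \<le> \<kappa> * (L2_set weight {Suc m..<n} * L2_set (\<lambda>k. cmod (seq_of y k)) {Suc m..<n})"
            using L2_set_mult_ineq[of weight "\<lambda>k. cmod (seq_of y k)" "{Suc m..<n}"] \<kappa>0
            by (intro mult_left_mono) (auto simp: weight_nonneg)
          finally have "(cmod (scaled (seq_of x) n))\<^sup>2 \<le>
              (\<kappa> * (L2_set weight {Suc m..<n} * L2_set (\<lambda>k. cmod (seq_of y k)) {Suc m..<n}))\<^sup>2"
            by (intro power_mono) auto
          also have "\<dots> = \<kappa>\<^sup>2 * ((\<Sum>k=Suc m..<n. (weight k)\<^sup>2) * (\<Sum>k=Suc m..<n. g k))"
            by (simp add: power_mult_distrib L2_set_def sum_nonneg g_def)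
          also have "\<dots> \<le> \<kappa>\<^sup>2 * (1 / (\<kappa>' * r) * (\<Sum>k | N < k \<and> k < n \<and> blk k = blk n. g k))"
          proof (intro mult_left_mono mult_mono)
            have "\<kappa>' * r * (\<Sum>k=Suc m..<n. (weight k)\<^sup>2) \<le> 1"
              using blk_eq m by (intro blk_sum[of _ m]) auto
            then show "(\<Sum>k=Suc m..<n. (weight k)\<^sup>2) \<le> 1 / (\<kappa>' * r)"
              using \<kappa>0 r_pos by (simp add: pos_le_divide_eq mult.commute)
            show "(\<Sum>k=Suc m..<n. g k) \<le> (\<Sum>k | N < k \<and> k < n \<and> blk k = blk n. g k)"
              using blk_eq m by (intro sum_mono2) (auto simp: g_def)
          qed (use \<kappa>0 r_pos in \<open>auto simp: g_def intro!: sum_nonneg\<close>)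
          finally have "(weight n)\<^sup>2 * (cmod (scaled (seq_of x) n))\<^sup>2 \<le>
              (weight n)\<^sup>2 * (\<kappa>\<^sup>2 * (1 / (\<kappa>' * r) * (\<Sum>k | N < k \<and> k < n \<and> blk k = blk n. g k)))"
            by (intro mult_left_mono) auto
          also have "\<dots> = \<kappa>\<^sup>2 / (\<kappa>' * r) * (\<Sum>k | N < k \<and> k < n \<and> blk k = blk n. (weight n)\<^sup>2 * g k)"
            by (simp add: sum_distrib_left[symmetric])
          also have "(weight n)\<^sup>2 * (cmod (scaled (seq_of x) n))\<^sup>2 = (cmod (seq_of x n))\<^sup>2"
            using cmod_scaled[of n "seq_of x"] False by (simp add: power_mult_distrib)
          finally show ?thesis .
        qed
      qed
      \<comment> \<open>Exchanging the sums and using the block bound again, now for the sum over n,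
        gives the second factor 1 / (\<kappa>' r). In effect this is a Hilbert-Schmidt bound for the
        solution kernel of each block.\<close>
      have part: "(\<Sum>n<L. (cmod (seq_of x n))\<^sup>2) \<le> (\<kappa> / (\<kappa>' * r))\<^sup>2 * (norm y)\<^sup>2" for L
      proof -
        have "(\<Sum>n<L. (cmod (seq_of x n))\<^sup>2) \<le>
            (\<Sum>n<L. \<kappa>\<^sup>2 / (\<kappa>' * r) * (\<Sum>k | N < k \<and> k < n \<and> blk k = blk n. (weight n)\<^sup>2 * g k))"
          by (intro sum_mono pt)
        also have "\<dots> = \<kappa>\<^sup>2 / (\<kappa>' * r) * (\<Sum>n<L. \<Sum>k | k < L \<and> (N < k \<and> k < n \<and> blk k = blk n). (weight n)\<^sup>2 * g k)"
          unfolding sum_distrib_left[symmetric]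
          by (intro arg_cong2[of _ _ _ _ "(*)"] refl sum.cong Collect_cong) auto
        also have "(\<Sum>n<L. \<Sum>k | k < L \<and> (N < k \<and> k < n \<and> blk k = blk n). (weight n)\<^sup>2 * g k) =
            (\<Sum>k<L. \<Sum>n | n < L \<and> (N < k \<and> k < n \<and> blk k = blk n). (weight n)\<^sup>2 * g k)"
          using sum.swap_restrict[of "{..<L}" "{..<L}" "\<lambda>n k. (weight n)\<^sup>2 * g k" "\<lambda>n k. N < k \<and> k < n \<and> blk k = blk n"]
          by simp
        also have "\<dots> \<le> (\<Sum>k<L. 1 / (\<kappa>' * r) * g k)"
        proof (rule sum_mono)
          fix k
          show "(\<Sum>n | n < L \<and> (N < k \<and> k < n \<and> blk k = blk n). (weight n)\<^sup>2 * g k) \<le> 1 / (\<kappa>' * r) * g k"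
          proof (cases "k > N")
            case True
            then have "\<kappa>' * r * (\<Sum>n | n < L \<and> (N < k \<and> k < n \<and> blk k = blk n). (weight n)\<^sup>2) \<le> 1"
              by (intro blk_sum[of _ k]) auto
            then have "(\<Sum>n | n < L \<and> (N < k \<and> k < n \<and> blk k = blk n). (weight n)\<^sup>2) \<le> 1 / (\<kappa>' * r)"
              using \<kappa>0 r_pos by (simp add: pos_le_divide_eq mult.commute)
            then have "(\<Sum>n | n < L \<and> (N < k \<and> k < n \<and> blk k = blk n). (weight n)\<^sup>2) * g k \<le> 1 / (\<kappa>' * r) * g k"
              by (rule mult_right_mono) (simp add: g_def)
            then show ?thesis by (simp only: sum_distrib_right)
          qed (use \<kappa>0 r_pos in \<open>simp add: g_def\<close>)
        qed
        also have "\<dots> \<le> 1 / (\<kappa>' * r) * (norm y)\<^sup>2"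
          unfolding sum_distrib_left[symmetric] g_def using \<kappa>0 r_pos
          by (intro mult_left_mono sum_cmod_le_norm) auto
        finally show ?thesis
          using \<kappa>0 r_pos by (simp add: power_divide power2_eq_square divide_right_mono mult_left_mono mult.assoc)
      qed
      have "(norm x)\<^sup>2 \<le> (\<kappa> / (\<kappa>' * r))\<^sup>2 * (norm y)\<^sup>2"
        unfolding norm_l2_squared[of x] by (rule suminf_le_const[OF summable_norm2 part])
      also have "\<dots> \<le> (\<kappa> / (\<kappa>' * r))\<^sup>2 * (r * norm x)\<^sup>2"
        using xy(3) by (intro mult_left_mono power_mono) auto
      also have "\<dots> = (\<kappa> / \<kappa>')\<^sup>2 * (norm x)\<^sup>2"
        using r_pos by (simp add: power_divide power_mult_distrib)
      finally have "1 \<le> (\<kappa> / \<kappa>')\<^sup>2" using \<open>x \<noteq> 0\<close> by simp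
      moreover have "(\<kappa> / \<kappa>')\<^sup>2 < 1" using \<kappa> \<kappa>0 by (simp add: power_less_one_iff abs_square_less_1)
      ultimately show False by simp
    qed
    moreover have "finite Z" using D_fin by (simp add: Z_def)
    ultimately show ?thesis using Z_card unfolding X_def by blast
  qed
  then show ?thesis using r0 by blast
qed

end


section \<open>Density and convergence exponent\<close>

lemma card_infinite_le:
  assumes "\<And>F. finite F \<Longrightarrow> F \<subseteq> S \<Longrightarrow> real (card F) \<le> B"
  shows "finite S" "real (card S) \<le> B"
proof -
  show "finite S"
  proof (rule ccontr)
    assume "infinite S"
    then obtain F where "F \<subseteq> S" "finite F" "card F = nat \<lceil>B\<rceil> + 1"
      using infinite_arbitrarily_large by blast
    then show False using assms[of F] by simp linarith
  qed
  then show "real (card S) \<le> B" using assms by blast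
qed

text \<open>Again by removing a point of largest modulus: the counting bound at that modulus shows
  that the j-th point in order of modulus has modulus at least (j / K)^(1/\<gamma>).\<close>

lemma sum_powr_le_of_counting:
  fixes F :: "complex set"
  assumes "finite F" "K > 0" "\<gamma> > 0" "\<alpha> > 0" "\<And>z. z \<in> F \<Longrightarrow> cmod z \<ge> 1"
    and "\<And>t. t \<ge> 1 \<Longrightarrow> real (card {z \<in> F. cmod z \<le> t}) \<le> K * t powr \<gamma>"
  shows "(\<Sum>z\<in>F. cmod z powr (- \<alpha>)) \<le> (\<Sum>j\<in>{1..card F}. (real j / K) powr (- \<alpha> / \<gamma>))"
  using assms(1,5,6)
proof (induction "card F" arbitrary: F)
  case 0
  then show ?case by simp
next
  case (Suc m)
  have ne: "cmod ` F \<noteq> {}" "finite (cmod ` F)" using Suc by auto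
  obtain w where w: "w \<in> F" "cmod w = Max (cmod ` F)" using Max_in[OF ne(2,1)] by auto
  have "{z \<in> F. cmod z \<le> cmod w} = F" using ne unfolding w(2) by auto
  then have "real (Suc m) \<le> K * cmod w powr \<gamma>" using Suc.prems(3)[of "cmod w"] Suc.prems(2)[OF w(1)] Suc.hyps(2) by simp
  then have "real (Suc m) / K \<le> cmod w powr \<gamma>" using assms(2) by (simp add: field_simps)
  then have "(cmod w powr \<gamma>) powr (- \<alpha> / \<gamma>) \<le> (real (Suc m) / K) powr (- \<alpha> / \<gamma>)"
    using assms by (intro powr_mono2') auto
  then have top: "cmod w powr (- \<alpha>) \<le> (real (Suc m) / K) powr (- \<alpha> / \<gamma>)"
    using assms(3) by (simp add: powr_powr)
  have card: "m = card (F - {w})" using Suc.hyps(2) Suc.prems(1) w(1) by simp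
  have IH: "(\<Sum>z\<in>F - {w}. cmod z powr (- \<alpha>)) \<le> (\<Sum>j\<in>{1..m}. (real j / K) powr (- \<alpha> / \<gamma>))"
    unfolding card
  proof (rule Suc.hyps(1)[OF card])
    fix t :: real assume t: "t \<ge> 1"
    have "card {z \<in> F - {w}. cmod z \<le> t} \<le> card {z \<in> F. cmod z \<le> t}"
      using Suc.prems(1) by (intro card_mono) auto
    then show "real (card {z \<in> F - {w}. cmod z \<le> t}) \<le> K * t powr \<gamma>" using Suc.prems(3)[OF t] by linarith
  qed (use Suc.prems in auto)
  have "(\<Sum>z\<in>F. cmod z powr (- \<alpha>)) = cmod w powr (- \<alpha>) + (\<Sum>z\<in>F - {w}. cmod z powr (- \<alpha>))"
    using Suc.prems(1) w(1) by (rule sum.remove)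
  also have "\<dots> \<le> (\<Sum>j\<in>{1..card F}. (real j / K) powr (- \<alpha> / \<gamma>))"
    using IH top by (simp add: Suc.hyps(2)[symmetric])
  finally show ?case .
qed

lemma summable_on_of_counting:
  fixes S :: "complex set"
  assumes fin: "\<And>t. finite {z \<in> S. cmod z \<le> t}" and "K > 0" "\<gamma> > 0" "\<alpha> > \<gamma>"
    and count: "\<And>t. t \<ge> 1 \<Longrightarrow> real (card {z \<in> S. cmod z \<le> t}) \<le> K * t powr \<gamma>"
  shows "(\<lambda>z. cmod z powr (- \<alpha>)) summable_on (S - {0})"
proof -
  let ?T = "{z \<in> S. cmod z \<ge> 1}" and ?f = "\<lambda>z. cmod z powr (- \<alpha>)"
  define B where "B = (\<Sum>j. (real j / K) powr (- \<alpha> / \<gamma>))"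
  have summable: "summable (\<lambda>j. (real j / K) powr (- \<alpha> / \<gamma>))"
  proof -
    have "(real j / K) powr (- \<alpha> / \<gamma>) = real j powr (- \<alpha> / \<gamma>) / K powr (- \<alpha> / \<gamma>)" for j
      using assms(2) by (simp add: powr_divide)
    moreover have "- \<alpha> / \<gamma> < - 1" using assms by (simp add: field_simps)
    ultimately show ?thesis by (simp add: summable_divide summable_real_powr_iff)
  qed
  have "?f summable_on ?T"
  proof (rule nonneg_bdd_above_summable_on)
    have "sum ?f F \<le> B" if F: "F \<subseteq> ?T" "finite F" for F
    proof -
      have "sum ?f F \<le> (\<Sum>j\<in>{1..card F}. (real j / K) powr (- \<alpha> / \<gamma>))"
      proof (rule sum_powr_le_of_counting[OF F(2) assms(2,3)])
        fix t :: real assume t: "t \<ge> 1"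
        have "card {z \<in> F. cmod z \<le> t} \<le> card {z \<in> S. cmod z \<le> t}" using F by (intro card_mono fin) auto
        then show "real (card {z \<in> F. cmod z \<le> t}) \<le> K * t powr \<gamma>" using count[OF t] by linarith
      qed (use F assms in auto)
      also have "\<dots> \<le> B" unfolding B_def by (rule sum_le_suminf[OF summable]) auto
      finally show ?thesis .
    qed
    then show "bdd_above (sum ?f ` {F. F \<subseteq> ?T \<and> finite F})" by (auto intro!: bdd_aboveI[of _ B])
  qed simp
  moreover have "?f summable_on {z \<in> S. cmod z \<le> 1}" using fin by (rule summable_on_finite)
  ultimately have "?f summable_on (?T \<union> {z \<in> S. cmod z \<le> 1})" by (rule summable_on_union)
  then show ?thesis by (rule summable_on_subset_banach) auto
qed

text \<open>Every nonzero point of modulus at most t contributes at least t^(-\<alpha>) to the sum.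
  The additional 1 is for the point 0.\<close>

lemma counting_of_summable_on:
  fixes S :: "complex set"
  assumes fin: "\<And>t. finite {z \<in> S. cmod z \<le> t}" and "\<alpha> > 0"
    and sum: "(\<lambda>z. cmod z powr (- \<alpha>)) summable_on (S - {0})"
  shows "\<exists>B\<ge>0. \<forall>t>0. real (card {z \<in> S. cmod z \<le> t}) \<le> B * t powr \<alpha> + 1"
proof -
  let ?f = "\<lambda>z. cmod z powr (- \<alpha>)"
  define B where "B = infsum ?f (S - {0})"
  have "real (card {z \<in> S. cmod z \<le> t}) \<le> B * t powr \<alpha> + 1" if t: "t > 0" for t
  proof -
    let ?F = "{z \<in> S - {0}. cmod z \<le> t}"
    have finF: "finite ?F" by (rule finite_subset[OF _ fin[of t]]) auto
    have "real (card ?F) * t powr (- \<alpha>) = (\<Sum>z\<in>?F. t powr (- \<alpha>))" by simp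
    also have "\<dots> \<le> (\<Sum>z\<in>?F. ?f z)" using t assms(2) by (intro sum_mono powr_mono2') auto
    also have "\<dots> \<le> B" unfolding B_def by (rule finite_sum_le_infsum[OF sum finF]) auto
    finally have "real (card ?F) \<le> B * t powr \<alpha>" using t by (simp add: powr_minus field_simps)
    moreover have "card {z \<in> S. cmod z \<le> t} \<le> card (insert 0 ?F)" using finF by (intro card_mono) auto
    moreover have "card (insert 0 ?F) = card ?F + 1" using finF by simp
    ultimately show ?thesis by linarith
  qed
  moreover have "B \<ge> 0" unfolding B_def by (rule infsum_nonneg) simp
  ultimately show ?thesis by blast
qed

text \<open>The lower hypothesis holds only for arbitrarily large t, which is enough for a limsup
  and also excludes every exponent below \<gamma>.\<close>

lemma density_from_counting:
  fixes S :: "complex set"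
  assumes real: "S \<subseteq> \<real>" and fin: "\<And>t. finite {z \<in> S. cmod z \<le> t}"
    and \<gamma>: "\<gamma> > 0" and C: "C > 0" and l: "l > 0"
    and upper: "\<And>t. t \<ge> t0 \<Longrightarrow> real (card {z \<in> S. cmod z \<le> t}) \<le> C * t powr \<gamma> + 3"
    and lower: "\<And>t1. \<exists>t\<ge>t1. real (card {z \<in> S. cmod z \<le> t}) > l * t powr \<gamma>"
  shows "convergence_exponent S = ereal \<gamma>" "ereal l \<le> upper_density S \<gamma>" "upper_density S \<gamma> \<le> ereal C"
proof -
  let ?n = "\<lambda>t. real (card {z \<in> S. cmod z \<le> t})"
  have count: "counting_fun S t = ereal (?n t)" for t
  proof -
    have "S \<inter> complex_of_real ` {-t..t} = {z \<in> S. cmod z \<le> t}"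
      using real by (auto simp: Reals_def image_iff abs_le_iff minus_le_iff)
    then show ?thesis using fin[of t] by (simp add: counting_fun_def)
  qed
  show "ereal l \<le> upper_density S \<gamma>"
  proof (rule ccontr)
    assume "\<not> ?thesis"
    then have "Limsup at_top (\<lambda>t. counting_fun S t / ereal (t powr \<gamma>)) < ereal l" by (simp add: upper_density_def)
    then have "\<forall>\<^sub>F t in at_top. counting_fun S t / ereal (t powr \<gamma>) < ereal l" by (rule Limsup_lessD)
    then obtain t1 where t1: "\<And>t. t \<ge> t1 \<Longrightarrow> counting_fun S t / ereal (t powr \<gamma>) < ereal l"
      by (auto simp: eventually_at_top_linorder)
    obtain t where t: "t \<ge> max t1 1" "?n t > l * t powr \<gamma>" using lower by blast
    have "?n t / t powr \<gamma> < l" using t1[of t] t(1) by (simp add: count)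
    then show False using t by (simp add: field_simps)
  qed
  show "upper_density S \<gamma> \<le> ereal C"
  proof -
    have "upper_density S \<gamma> \<le> Limsup at_top (\<lambda>t. ereal (C + 3 / t powr \<gamma>))"
      unfolding upper_density_def
    proof (rule Limsup_mono)
      show "\<forall>\<^sub>F t in at_top. counting_fun S t / ereal (t powr \<gamma>) \<le> ereal (C + 3 / t powr \<gamma>)"
        using eventually_ge_at_top[of "max t0 1"]
      proof eventually_elim
        case (elim t)
        then have "?n t / t powr \<gamma> \<le> (C * t powr \<gamma> + 3) / t powr \<gamma>"
          using upper[of t] by (intro divide_right_mono) auto
        also have "\<dots> = C + 3 / t powr \<gamma>" using elim by (simp add: field_simps)
        finally show ?case using elim by (simp add: count)
      qed
    qed
    also have "\<dots> = ereal C"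
    proof (rule lim_imp_Limsup)
      have "((\<lambda>t::real. C + 3 / t powr \<gamma>) \<longlongrightarrow> C) at_top" using \<gamma> by real_asymp
      then show "((\<lambda>t. ereal (C + 3 / t powr \<gamma>)) \<longlongrightarrow> ereal C) at_top" by (simp add: lim_ereal)
    qed simp
    finally show ?thesis .
  qed
  show "convergence_exponent S = ereal \<gamma>"
    unfolding convergence_exponent_def
  proof (rule antisym)
    let ?A = "{ereal \<alpha> |\<alpha>. \<alpha> > 0 \<and> (\<lambda>z. cmod z powr (- \<alpha>)) summable_on (S - {0})}"
    show "Inf ?A \<le> ereal \<gamma>"
    proof (rule ereal_le_epsilon2)
      fix d :: real assume d: "d > 0"
      define t2 where "t2 = max t0 1"
      \<comment> \<open>As t^\<gamma> \<ge> 1, this constant absorbs the additive 3 and the bounded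
        range of t before the asymptotic bound sets in.\<close>
      define K where "K = ?n t2 + C + 3"
      have "?n t \<le> K * t powr \<gamma>" if t: "t \<ge> 1" for t
      proof -
        have p: "t powr \<gamma> \<ge> 1" using t \<gamma> by (simp add: ge_one_powr_ge_zero)
        show ?thesis
        proof (cases "t \<ge> t2")
          case True
          then have "?n t \<le> C * t powr \<gamma> + 3" using upper by (simp add: t2_def)
          also have "\<dots> \<le> C * t powr \<gamma> + (?n t2 + 3) * t powr \<gamma>"
            using mult_mono[of 3 "?n t2 + 3" 1 "t powr \<gamma>"] p by simp
          also have "\<dots> = K * t powr \<gamma>" by (simp add: K_def algebra_simps)
          finally show ?thesis .
        next
          case False
          then have "?n t \<le> ?n t2" by (simp add: card_mono fin Collect_mono_iff)
          also have "\<dots> \<le> K * 1" using C by (simp add: K_def)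
          also have "\<dots> \<le> K * t powr \<gamma>" using p C by (intro mult_left_mono) (auto simp: K_def)
          finally show ?thesis .
        qed
      qed
      then have "(\<lambda>z. cmod z powr (- (\<gamma> + d))) summable_on (S - {0})"
        using C d \<gamma> by (intro summable_on_of_counting[OF fin, of K \<gamma>]) (auto simp: K_def intro: add_nonneg_pos)
      then have "ereal (\<gamma> + d) \<in> ?A" using d \<gamma> by fastforce
      then have "Inf ?A \<le> ereal (\<gamma> + d)" by (rule Inf_lower)
      then show "Inf ?A \<le> ereal \<gamma> + ereal d" by simp
    qed
    show "ereal \<gamma> \<le> Inf ?A"
    proof (rule Inf_greatest)
      fix e assume "e \<in> ?A"
      then obtain \<alpha> where \<alpha>: "e = ereal \<alpha>" "\<alpha> > 0" "(\<lambda>z. cmod z powr (- \<alpha>)) summable_on (S - {0})" by auto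
      obtain B where B: "B \<ge> 0" "\<And>t. t > 0 \<Longrightarrow> ?n t \<le> B * t powr \<alpha> + 1"
        using counting_of_summable_on[OF fin \<alpha>(2,3)] by auto
      have "\<gamma> \<le> \<alpha>"
      proof (rule ccontr)
        assume lt: "\<not> ?thesis"
        have "((\<lambda>t. B * t powr (\<alpha> - \<gamma>) + 1 / t powr \<gamma>) \<longlongrightarrow> B * 0 + 0) at_top"
        proof (intro tendsto_add tendsto_mult tendsto_const)
          show "((\<lambda>t. t powr (\<alpha> - \<gamma>)) \<longlongrightarrow> 0) at_top" using lt by real_asymp
          show "((\<lambda>t. 1 / t powr \<gamma>) \<longlongrightarrow> (0::real)) at_top" using \<gamma> by real_asymp
        qed
        then have "\<forall>\<^sub>F t in at_top. B * t powr (\<alpha> - \<gamma>) + 1 / t powr \<gamma> < l"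
          using l by (intro order_tendstoD) auto
        then obtain t3 where t3: "\<And>t. t \<ge> t3 \<Longrightarrow> B * t powr (\<alpha> - \<gamma>) + 1 / t powr \<gamma> < l"
          by (auto simp: eventually_at_top_linorder)
        obtain t where t: "t \<ge> max t3 1" "?n t > l * t powr \<gamma>" using lower by blast
        have pos: "t powr \<gamma> > 0" using t(1) by simp
        have "?n t \<le> B * t powr \<alpha> + 1" using B(2) t(1) by simp
        also have "\<dots> = (B * t powr (\<alpha> - \<gamma>) + 1 / t powr \<gamma>) * t powr \<gamma>"
          using t(1) by (simp add: powr_diff distrib_right)
        also have "\<dots> \<le> l * t powr \<gamma>" using t3[of t] t(1) by (intro mult_right_mono) auto
        finally show False using t(2) by simp
      qed
      then show "ereal \<gamma> \<le> e" by (simp add: \<alpha>(1))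
    qed
  qed
qed


section \<open>Limit point criteria\<close>

context jacobi
begin

text \<open>Either \<open>\<bar>p\<^sub>n(\<i>)\<bar>\<close> is eventually increasing, or it is decreasing and then
  \<open>\<rho>\<^sub>n \<bar>p\<^sub>n(\<i>)\<bar>\<close> is bounded, which contradicts \<open>1 \<le> \<rho>\<^sub>n \<bar>p\<^sub>n(\<i>) p\<^sub>n\<^sub>+\<^sub>1(\<i>)\<bar>\<close> if \<open>p\<^sub>n(\<i>)\<close> tends to 0.\<close>

lemma not_ell2_of_dominant_diagonal:
  assumes q1: "\<And>n. n \<ge> N \<Longrightarrow> \<bar>q (Suc n)\<bar> \<ge> \<rho> (Suc n) + \<rho> n"
    and q2: "\<And>n. n \<ge> N \<Longrightarrow> \<bar>q (Suc n)\<bar> \<ge> 2 * \<rho> (Suc n)"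
  shows "sol \<i> \<notin> ell2"
proof
  assume "sol \<i> \<in> ell2"
  define a where "a n = cmod (sol \<i> n)" for n
  have "(\<lambda>n. (a n)\<^sup>2) \<longlonglongrightarrow> 0"
    using \<open>sol \<i> \<in> ell2\<close> unfolding ell2_def a_def by (intro summable_LIMSEQ_zero) simp
  then have "(\<lambda>n. sqrt ((a n)\<^sup>2)) \<longlonglongrightarrow> sqrt 0" by (rule tendsto_real_sqrt)
  then have a_lim: "a \<longlonglongrightarrow> 0" by (simp add: a_def[abs_def])
  have a_pos: "a n > 0" for n
    using one_le_sol_i[of n] by (cases "a n = 0") (auto simp: a_def)
  have three: "\<bar>q (Suc n)\<bar> * a (Suc n) \<le> \<rho> n * a n + \<rho> (Suc n) * a (Suc (Suc n))" for n
  proof -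
    have "(\<i> - complex_of_real (q (Suc n))) * sol \<i> (Suc n) =
        complex_of_real (\<rho> n) * sol \<i> n + complex_of_real (\<rho> (Suc n)) * sol \<i> (Suc (Suc n))"
      using J_sol[of \<i> "Suc n"] by (simp add: jacobi_diff_simps algebra_simps)
    then have "cmod (\<i> - complex_of_real (q (Suc n))) * a (Suc n) \<le> \<rho> n * a n + \<rho> (Suc n) * a (Suc (Suc n))"
      unfolding a_def norm_mult[symmetric]
      using norm_triangle_ineq[of "complex_of_real (\<rho> n) * sol \<i> n" "complex_of_real (\<rho> (Suc n)) * sol \<i> (Suc (Suc n))"]
        \<rho>_pos[of n] \<rho>_pos[of "Suc n"] by (simp add: norm_mult)
    moreover have "\<bar>q (Suc n)\<bar> \<le> cmod (\<i> - complex_of_real (q (Suc n)))"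
      using abs_Re_le_cmod[of "\<i> - complex_of_real (q (Suc n))"] by simp
    ultimately show ?thesis using mult_right_mono[OF _ less_imp_le[OF a_pos[of "Suc n"]]] order_trans by blast
  qed
  show False
  proof (cases "\<exists>n\<ge>N. a n \<le> a (Suc n)")
    \<comment> \<open>The first hypothesis gives \<rho>_{n+1} (a_{n+2} - a_{n+1}) \<ge> \<rho>_n
      (a_{n+1} - a_n), so a single nonnegative increment forces all later ones, against a tending to
      0.\<close>
    case True
    then obtain n0 where n0: "n0 \<ge> N" "a n0 \<le> a (Suc n0)" by blast
    have inc: "a n \<le> a (Suc n) \<and> a (Suc n0) \<le> a (Suc n)" if "n \<ge> n0" for n
      using that
    proof (induction n rule: dec_induct)
      case (step n)
      have "(\<rho> (Suc n) + \<rho> n) * a (Suc n) \<le> \<bar>q (Suc n)\<bar> * a (Suc n)"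
        using q1[of n] step n0 a_pos[of "Suc n"] by (intro mult_right_mono) auto
      moreover have "\<rho> n * a n \<le> \<rho> n * a (Suc n)" using step.IH \<rho>_pos[of n] by simp
      ultimately have "\<rho> (Suc n) * a (Suc n) \<le> \<rho> (Suc n) * a (Suc (Suc n))"
        using three[of n] by (simp add: distrib_right)
      then show ?case using step.IH \<rho>_pos[of "Suc n"] by simp
    qed (use n0 in simp)
    have "\<forall>\<^sub>F n in sequentially. a n < a (Suc n0)" by (rule order_tendstoD(2)[OF a_lim a_pos])
    then obtain K where K: "\<And>n. n \<ge> K \<Longrightarrow> a n < a (Suc n0)" by (auto simp: eventually_sequentially)
    have "K \<le> Suc (max K n0)" by simp
    then show False using K[of "Suc (max K n0)"] inc[of "max K n0"] by linarith
  next
    \<comment> \<open>Here a is strictly decreasing from N on, and the second hypothesis makes the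
      products \<rho>_n a_n decrease too.\<close>
    case False
    have dec: "\<rho> (Suc n) * a (Suc n) \<le> \<rho> n * a n" if n: "n \<ge> N" for n
    proof -
      have "2 * \<rho> (Suc n) * a (Suc n) \<le> \<bar>q (Suc n)\<bar> * a (Suc n)"
        using q2[OF n] a_pos[of "Suc n"] by (intro mult_right_mono) auto
      moreover have "\<rho> (Suc n) * a (Suc (Suc n)) \<le> \<rho> (Suc n) * a (Suc n)"
      proof (rule mult_left_mono)
        show "a (Suc (Suc n)) \<le> a (Suc n)" using False n by (metis le_SucI less_imp_le not_le)
      qed (use \<rho>_pos[of "Suc n"] in simp)
      ultimately show ?thesis using three[of n] by simp
    qed
    have bound: "\<rho> n * a n \<le> \<rho> N * a N" if "n \<ge> N" for n
      using that by (induction n rule: dec_induct) (auto intro: order_trans[OF dec])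
    have D: "\<rho> N * a N > 0" using \<rho>_pos a_pos by simp
    have "\<forall>\<^sub>F n in sequentially. a n < 1 / (\<rho> N * a N)" using D by (intro order_tendstoD(2)[OF a_lim]) simp
    then obtain K where K: "\<And>n. n \<ge> K \<Longrightarrow> a n < 1 / (\<rho> N * a N)" by (auto simp: eventually_sequentially)
    define n where "n = max K N"
    have "1 \<le> (\<rho> n * a n) * a (Suc n)" using one_le_sol_i[of n] by (simp add: a_def mult_ac)
    also have "\<dots> \<le> (\<rho> N * a N) * a (Suc n)" using bound[of n] a_pos[of "Suc n"] by (intro mult_right_mono) (auto simp: n_def)
    also have "\<dots> < (\<rho> N * a N) * (1 / (\<rho> N * a N))" using K[of "Suc n"] D by (intro mult_strict_left_mono) (auto simp: n_def)
    also have "\<dots> = 1" using less_imp_neq[OF D] by (metis nonzero_eq_divide_eq mult.commute)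
    finally show False by simp
  qed
qed

text \<open>Carleman's condition for at most linear growth: 1 / \<rho>_n is at most |p_n(i)
  p_{n+1}(i)|, which is summable if p(i) is square summable, whereas the harmonic series
  diverges.\<close>

lemma carleman:
  assumes "\<And>n. n \<ge> N \<Longrightarrow> \<rho> n \<le> K * real n" "N \<ge> 1"
  shows "sol \<i> \<notin> ell2"
proof
  assume s: "sol \<i> \<in> ell2"
  then have s': "(\<lambda>n. sol \<i> (Suc n)) \<in> ell2"
    using summable_Suc_iff[of "\<lambda>n. (cmod (sol \<i> n))\<^sup>2"] by (simp add: ell2_def)
  have K: "K > 0" using assms \<rho>_pos[of N] by (smt (verit) mult_nonpos_nonneg of_nat_0_le_iff order_refl)
  have "summable (\<lambda>n. K * (cmod (sol \<i> (Suc n)) * cmod (sol \<i> n)))"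
    using summable_prod_of_ell2[OF s' s] by (rule summable_mult)
  then have "summable (\<lambda>n. 1 / real n)"
  proof (rule summable_comparison_test'[of _ N])
    fix n assume n: "n \<ge> N"
    have "1 \<le> \<rho> n * (cmod (sol \<i> (Suc n)) * cmod (sol \<i> n))"
      using one_le_sol_i[of n] by (simp add: mult.assoc)
    also have "\<dots> \<le> K * real n * (cmod (sol \<i> (Suc n)) * cmod (sol \<i> n))"
      using assms(1)[OF n] by (intro mult_right_mono) auto
    finally show "norm (1 / real n) \<le> K * (cmod (sol \<i> (Suc n)) * cmod (sol \<i> n))"
      using n assms(2) by (simp add: field_simps)
  qed
  then have "summable (\<lambda>n. inverse (real n))" by (simp add: divide_inverse)
  then show False using not_summable_harmonic[where 'a = real] by simp
qed

end


section \<open>The spectrum in the elliptic case\<close>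

context elliptic_jacobi
begin

lemma spectrum_density:
  assumes ext: "canonical_extension \<rho> q A"
    and a: "1 / sqrt c = a / x0" "a > 0" "x0 > 0"
    and \<rho>_le: "\<And>Y. Y > x0 \<Longrightarrow> \<forall>\<^sub>F k in sequentially. \<rho> k \<le> real k powr \<beta> * Y"
  shows "convergence_exponent (spectrum A) = ereal (1 / \<beta>)"
    and "ereal ((\<beta> - 1) / \<beta> * (1 / x0) powr (1 / \<beta>)) \<le> upper_density (spectrum A) (1 / \<beta>)"
    and "upper_density (spectrum A) (1 / \<beta>) \<le> ereal (exp 1 * (\<beta> / (\<beta> - 1)) * (a / x0) powr (1 / \<beta>))"
proof -
  obtain h where h: "summable (\<lambda>n. (h n)\<^sup>2)"
      "\<And>x y n. (x, y) \<in> maximal_graph \<rho> q \<Longrightarrow> cmod (seq_of x n) \<le> h n * (norm x + norm y)"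
    using maximal_domain_dominated by blast
  interpret compact_extension \<rho> q A h
    by unfold_locales (fact ext, fact h(1), rule h(2))
  \<comment> \<open>Twice this is e a / x0. It is admissible because e > 2.\<close>
  define \<kappa>' where "\<kappa>' = exp 1 / 2 * (a / x0)"
  have e2: "exp 1 > (2::real)" using exp_lower_Taylor_quadratic[of "1::real"] by simp
  have ax: "a / x0 > 0" using a by simp
  have gt: "\<kappa>' > 1 / sqrt c"
  proof -
    have "1 * (a / x0) < exp 1 / 2 * (a / x0)" by (rule mult_strict_right_mono) (use e2 ax in simp_all)
    then show ?thesis by (simp only: \<kappa>'_def a(1) mult_1)
  qed
  obtain r0 where r0: "r0 > 0" and sep: "\<And>r. r \<ge> r0 \<Longrightarrow> \<exists>Z. finite Z \<and>
      real (card Z) \<le> \<beta> / (\<beta> - 1) * (2 * \<kappa>' * r) powr (1 / \<beta>) + 3 \<and>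
      (\<forall>x y. (x, y) \<in> maximal_graph \<rho> q \<longrightarrow> (\<forall>n\<in>Z. seq_of x n = 0) \<longrightarrow> norm y \<le> r * norm x \<longrightarrow> x = 0)"
    using separating_conditions[OF gt] by blast
  let ?E = "\<lambda>t. {\<mu> \<in> eigenvalues. \<bar>\<mu>\<bar> \<le> t}" and ?C = "exp 1 * (\<beta> / (\<beta> - 1)) * (a / x0) powr (1 / \<beta>)"
  have up: "finite (?E r) \<and> real (card (?E r)) \<le> ?C * r powr (1 / \<beta>) + 3" if r: "r \<ge> r0" for r
  proof -
    obtain Z where Z: "finite Z" "real (card Z) \<le> \<beta> / (\<beta> - 1) * (2 * \<kappa>' * r) powr (1 / \<beta>) + 3"
        "\<And>x y. (x, y) \<in> maximal_graph \<rho> q \<Longrightarrow> (\<And>n. n \<in> Z \<Longrightarrow> seq_of x n = 0) \<Longrightarrow> norm y \<le> r * norm x \<Longrightarrow> x = 0"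
      using sep[OF r] by blast
    have le: "real (card F) \<le> real (card Z)" if "finite F" "F \<subseteq> ?E r" for F
    proof -
      have "card F \<le> card Z"
        by (rule card_eigenvalues_le[of F r Z]) (use that r r0 Z in auto)
      then show ?thesis by simp
    qed
    have "(2 * \<kappa>' * r) powr (1 / \<beta>) = exp (1 / \<beta>) * ((a / x0) powr (1 / \<beta>) * r powr (1 / \<beta>))"
    proof -
      have eq: "2 * \<kappa>' * r = exp 1 * ((a / x0) * r)" by (simp add: \<kappa>'_def)
      have pm: "(u * v) powr p = u powr p * v powr p" if "u > 0" "v > 0" for u v p :: real
        using that by (simp add: powr_mult)
      have "r > 0" using r r0 by linarith
      then show ?thesis
        unfolding eq using pm[of "exp 1" "(a / x0) * r" "1 / \<beta>"] pm[of "a / x0" r "1 / \<beta>"] ax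
        by (simp only: mult_pos_pos exp_gt_zero exp_powr_real mult_1)
    qed
    also have "\<dots> \<le> exp 1 * ((a / x0) powr (1 / \<beta>) * r powr (1 / \<beta>))"
      using \<beta>_gt_1 by (intro mult_right_mono) auto
    finally have "\<beta> / (\<beta> - 1) * (2 * \<kappa>' * r) powr (1 / \<beta>) \<le>
        \<beta> / (\<beta> - 1) * (exp 1 * ((a / x0) powr (1 / \<beta>) * r powr (1 / \<beta>)))"
      using \<beta>_gt_1 by (intro mult_left_mono) auto
    also have "\<dots> = ?C * r powr (1 / \<beta>)" by simp
    finally have "real (card Z) \<le> ?C * r powr (1 / \<beta>) + 3" using Z(2) by linarith
    moreover have "finite (?E r)" "real (card (?E r)) \<le> real (card Z)"
      using card_infinite_le[OF le] by blast+
    ultimately show ?thesis by linarith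
  qed
  have fin: "finite (?E t)" for t
    by (rule finite_subset[of _ "?E (max t r0)"]) (use up[of "max t r0"] in auto)
  have count: "{z \<in> spectrum A. cmod z \<le> t} = complex_of_real ` ?E t" for t
    by (auto simp: spectrum_eq)
  have card: "card {z \<in> spectrum A. cmod z \<le> t} = card (?E t)" for t
    unfolding count by (rule card_image) (auto simp: inj_on_def)
  let ?l = "(\<beta> - 1) / \<beta> * (1 / x0) powr (1 / \<beta>)"
  have l: "?l > 0" using \<beta>_gt_1 a by simp
  have low: "\<exists>t\<ge>t1. real (card (?E t)) > ?l * t powr (1 / \<beta>)" for t1
  proof (rule ccontr)
    assume "\<not> ?thesis"
    then have le: "\<And>t. t \<ge> t1 \<Longrightarrow> real (card (?E t)) \<le> ?l * t powr (1 / \<beta>)" by (auto simp: not_less)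
    have "?l powr (- \<beta>) = ((\<beta> - 1) / \<beta>) powr (- \<beta>) * x0"
    proof -
      have "?l powr (- \<beta>) = ((\<beta> - 1) / \<beta>) powr (- \<beta>) * ((1 / x0) powr (1 / \<beta>)) powr (- \<beta>)"
        by (rule powr_mult)
      also have "((1 / x0) powr (1 / \<beta>)) powr (- \<beta>) = (1 / x0) powr (- 1)"
        using \<beta>_gt_1 by (simp add: powr_powr)
      also have "\<dots> = x0" using a by (simp add: powr_minus)
      finally show ?thesis .
    qed
    \<comment> \<open>This factor makes room for some Y strictly between x0 and the power of the
      density; the bound on \<rho> is available only for Y > x0.\<close>
    moreover have "((\<beta> - 1) / \<beta>) powr (- \<beta>) > 1"
    proof -
      have "((\<beta> - 1) / \<beta>) powr (- \<beta>) > ((\<beta> - 1) / \<beta>) powr 0"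
        using \<beta>_gt_1 by (intro powr_less_mono') auto
      then show ?thesis using \<beta>_gt_1 by simp
    qed
    ultimately have gt: "?l powr (- \<beta>) > x0" using a by simp
    define Y where "Y = (x0 + ?l powr (- \<beta>)) / 2"
    have Y: "Y > x0" "Y < ?l powr (- \<beta>)" using gt by (auto simp: Y_def)
    obtain k0 where k0: "\<And>k. k \<ge> k0 \<Longrightarrow> \<rho> k \<le> real k powr \<beta> * Y"
      using \<rho>_le[OF Y(1)] by (auto simp: eventually_sequentially)
    have "?l powr (- \<beta>) \<le> Y"
    proof (rule density_lower_bound[OF _ _ l k0 fin le])
      show "cmod (sol \<i> n) \<le> norm (l2_of (sol \<i>))" for n
        using cmod_seq_of_le[of "l2_of (sol \<i>)" n] by (simp add: l2_of_inverse sol_i_ell2)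
    qed (use \<beta>_gt_1 Y a in auto)
    then show False using Y by simp
  qed
  have "spectrum A \<subseteq> \<real>" by (auto simp: spectrum_eq)
  moreover have "finite {z \<in> spectrum A. cmod z \<le> t}" for t unfolding count using fin by simp
  moreover have "?C > 0" using \<beta>_gt_1 a(2,3) by (intro mult_pos_pos divide_pos_pos) auto
  moreover have "real (card {z \<in> spectrum A. cmod z \<le> t}) \<le> ?C * t powr (1 / \<beta>) + 3" if "t \<ge> r0" for t
    using up[OF that] by (simp add: card)
  moreover have "\<exists>t\<ge>t1. real (card {z \<in> spectrum A. cmod z \<le> t}) > ?l * t powr (1 / \<beta>)" for t1
    using low by (simp add: card)
  moreover have "1 / \<beta> > 0" using \<beta>_gt_1 by simp
  ultimately show "convergence_exponent (spectrum A) = ereal (1 / \<beta>)"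
    "ereal ?l \<le> upper_density (spectrum A) (1 / \<beta>)" "upper_density (spectrum A) (1 / \<beta>) \<le> ereal ?C"
    using density_from_counting[of "spectrum A" "1 / \<beta>" ?C ?l r0] l by blast+
qed

end


section \<open>Power asymptotics\<close>

text \<open>1 / n is monotone and bounded, and the remainder is absolutely summable because
  \<epsilon> > 0. This is what the second order of the expansion provides: bounded variation, which
  convergence alone would not give.\<close>

lemma power_asymptotics:
  fixes R :: "nat \<Rightarrow> real"
  assumes "\<epsilon> > 0" "R \<in> O(\<lambda>n. 1 / real n powr (1 + \<epsilon>))"
  shows "bv (\<lambda>n. x0 + x1 / real n + R n)" "(\<lambda>n. x0 + x1 / real n + R n) \<longlonglongrightarrow> x0"
proof -
  have s: "summable (\<lambda>n. \<bar>R n\<bar>)"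
  proof (rule summable_comparison_test_bigo)
    have "summable (\<lambda>n. real n powr (- (1 + \<epsilon>)))" using assms(1) by (simp add: summable_real_powr_iff)
    moreover have "norm (1 / real n powr (1 + \<epsilon>)) = real n powr (- (1 + \<epsilon>))" for n
      by (subst powr_minus_divide) simp
    ultimately show "summable (\<lambda>n. norm (1 / real n powr (1 + \<epsilon>)))" by simp
    show "(\<lambda>n. \<bar>R n\<bar>) \<in> O(\<lambda>n. 1 / real n powr (1 + \<epsilon>))" using assms(2) by simp
  qed
  have "bv (\<lambda>n. - 1 / real n)"
  proof (rule bv_of_mono_bounded[of 1])
    show "- 1 / real n \<le> - 1 / real (Suc n)" if "n \<ge> 1" for n using that by (simp add: field_simps)
    show "\<bar>- 1 / real n\<bar> \<le> 1" for n by (cases "n = 0") auto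
  qed
  from bv_mult[OF bv_const[of "- x1"] this] have "bv (\<lambda>n. x1 / real n)" by simp
  then show "bv (\<lambda>n. x0 + x1 / real n + R n)"
    by (rule bv_add[OF bv_add[OF bv_const] bv_of_summable[OF s]])
  have "R \<longlonglongrightarrow> 0" using summable_LIMSEQ_zero[OF s] by (simp add: tendsto_rabs_zero_iff)
  moreover have "(\<lambda>n. x1 / real n) \<longlonglongrightarrow> 0" by real_asymp
  ultimately have "(\<lambda>n. x0 + x1 / real n + R n) \<longlonglongrightarrow> x0 + 0 + 0" by (intro tendsto_add tendsto_const)
  then show "(\<lambda>n. x0 + x1 / real n + R n) \<longlonglongrightarrow> x0" by simp
qed

theorem theorem1:
  fixes \<rho> q R S :: "nat \<Rightarrow> real"
    and \<epsilon> \<beta>\<^sub>1 \<beta>\<^sub>2 x\<^sub>0 x\<^sub>1 y\<^sub>0 y\<^sub>1 a :: real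
  assumes "\<And>n. \<rho> n > 0"
    and "\<epsilon> > 0" and "x\<^sub>0 > 0" and "y\<^sub>0 \<noteq> 0"
    and "R \<in> O(\<lambda>n. 1 / real n powr (1 + \<epsilon>))"
    and "\<forall>\<^sub>F n in sequentially. \<rho> n = real n powr \<beta>\<^sub>1 * (x\<^sub>0 + x\<^sub>1 / real n + R n)"
    and "S \<in> O(\<lambda>n. 1 / real n powr (1 + \<epsilon>))"
    and "\<forall>\<^sub>F n in sequentially. q n = real n powr \<beta>\<^sub>2 * (y\<^sub>0 + y\<^sub>1 / real n + S n)"
    and "a = (if \<beta>\<^sub>1 > \<beta>\<^sub>2 then 1 else (1 - y\<^sub>0\<^sup>2 / (4 * x\<^sub>0\<^sup>2)) powr (- 1 / 2))"
  shows "(\<beta>\<^sub>1 \<le> \<beta>\<^sub>2 \<and> (\<beta>\<^sub>1 = \<beta>\<^sub>2 \<longrightarrow> 2 * x\<^sub>0 < \<bar>y\<^sub>0\<bar>) \<longrightarrow> limit_point \<rho> q) \<and>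
    (\<beta>\<^sub>1 \<ge> \<beta>\<^sub>2 \<and> (\<beta>\<^sub>1 = \<beta>\<^sub>2 \<longrightarrow> 2 * x\<^sub>0 > \<bar>y\<^sub>0\<bar>) \<longrightarrow> (limit_circle \<rho> q \<longleftrightarrow> \<beta>\<^sub>1 > 1)) \<and>
    ((\<beta>\<^sub>1 \<le> \<beta>\<^sub>2 \<and> (\<beta>\<^sub>1 = \<beta>\<^sub>2 \<longrightarrow> 2 * x\<^sub>0 < \<bar>y\<^sub>0\<bar>) \<or>
      \<beta>\<^sub>1 \<ge> \<beta>\<^sub>2 \<and> (\<beta>\<^sub>1 = \<beta>\<^sub>2 \<longrightarrow> 2 * x\<^sub>0 > \<bar>y\<^sub>0\<bar>)) \<and> limit_circle \<rho> q \<longrightarrow>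
     (\<forall>A. canonical_extension \<rho> q A \<longrightarrow>
        convergence_exponent (spectrum A) = ereal (1 / \<beta>\<^sub>1) \<and>
        ereal ((\<beta>\<^sub>1 - 1) / \<beta>\<^sub>1 * (1 / x\<^sub>0) powr (1 / \<beta>\<^sub>1)) \<le> upper_density (spectrum A) (1 / \<beta>\<^sub>1) \<and>
        upper_density (spectrum A) (1 / \<beta>\<^sub>1)
          \<le> ereal (exp 1 * (\<beta>\<^sub>1 / (\<beta>\<^sub>1 - 1)) * (a / x\<^sub>0) powr (1 / \<beta>\<^sub>1))))"
proof -
  interpret jacobi \<rho> q by unfold_locales (rule assms(1))
  let ?X = "\<lambda>n. x\<^sub>0 + x\<^sub>1 / real n + R n" and ?Y = "\<lambda>n. y\<^sub>0 + y\<^sub>1 / real n + S n"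
  note X = power_asymptotics[OF assms(2,5), of x\<^sub>0 x\<^sub>1] and Y = power_asymptotics[OF assms(2,7), of y\<^sub>0 y\<^sub>1]
  have \<rho>_scaled: "\<forall>\<^sub>F n in sequentially. ?X n * real n powr (\<beta>\<^sub>1 + b) = \<rho> n * real n powr b" for b
    using assms(6) by eventually_elim (simp add: powr_add mult_ac)
  have q_scaled: "\<forall>\<^sub>F n in sequentially. ?Y n * real n powr (\<beta>\<^sub>2 + b) = q n * real n powr b" for b
    using assms(8) by eventually_elim (simp add: powr_add mult_ac)
  have powr_lim: "(\<lambda>n. real n powr b) \<longlonglongrightarrow> (if b = 0 then 1 else 0)" if "b \<le> 0" for b
  proof (cases "b = 0")
    case True
    have "(\<lambda>n. real n powr 0) \<longlonglongrightarrow> 1" by real_asymp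
    then show ?thesis using True by simp
  next
    case False
    then have "b < 0" using that by simp
    then have "(\<lambda>n. real n powr b) \<longlonglongrightarrow> 0" by real_asymp
    then show ?thesis using False by simp
  qed
  have \<rho>_lim: "(\<lambda>n. \<rho> n * real n powr b) \<longlonglongrightarrow> x\<^sub>0 * (if \<beta>\<^sub>1 + b = 0 then 1 else 0)" if "\<beta>\<^sub>1 + b \<le> 0" for b
    by (rule Lim_transform_eventually[OF tendsto_mult[OF X(2) powr_lim[OF that]] \<rho>_scaled])
  have q_lim: "(\<lambda>n. q n * real n powr b) \<longlonglongrightarrow> y\<^sub>0 * (if \<beta>\<^sub>2 + b = 0 then 1 else 0)" if "\<beta>\<^sub>2 + b \<le> 0" for b
    by (rule Lim_transform_eventually[OF tendsto_mult[OF Y(2) powr_lim[OF that]] q_scaled])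
  have point: "sol \<i> \<notin> ell2" if hyp: "\<beta>\<^sub>1 \<le> \<beta>\<^sub>2" "\<beta>\<^sub>1 = \<beta>\<^sub>2 \<longrightarrow> 2 * x\<^sub>0 < \<bar>y\<^sub>0\<bar>"
  proof -
    \<comment> \<open>The limit of \<rho>_n n^(-\<beta>_2). For \<beta>_1 < \<beta>_2 it is 0 and
      the strict inequality below is y_0 \<noteq> 0, so both cases are treated together.\<close>
    define \<xi> where "\<xi> = x\<^sub>0 * (if \<beta>\<^sub>1 = \<beta>\<^sub>2 then 1 else 0)"
    have \<xi>: "2 * \<xi> < \<bar>y\<^sub>0\<bar>" using hyp assms(4) by (auto simp: \<xi>_def)
    have r0: "(\<lambda>n. \<rho> n * real n powr (- \<beta>\<^sub>2)) \<longlonglongrightarrow> \<xi>" using \<rho>_lim[of "- \<beta>\<^sub>2"] hyp by (simp add: \<xi>_def)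
    have "(\<lambda>n. (real n / real (Suc n)) powr \<beta>\<^sub>2) \<longlonglongrightarrow> 1" by real_asymp
    from tendsto_mult[OF r0 this]
    have "(\<lambda>n. \<rho> n * real n powr (- \<beta>\<^sub>2) * (real n / real (Suc n)) powr \<beta>\<^sub>2) \<longlonglongrightarrow> \<xi>" by simp
    \<comment> \<open>Row n + 1 also contains \<rho>_n, so it has to be measured against the power
      at n + 1.\<close>
    then have r1: "(\<lambda>n. \<rho> n * real (Suc n) powr (- \<beta>\<^sub>2)) \<longlonglongrightarrow> \<xi>"
    proof (rule Lim_transform_eventually)
      show "\<forall>\<^sub>F n in sequentially. \<rho> n * real n powr (- \<beta>\<^sub>2) * (real n / real (Suc n)) powr \<beta>\<^sub>2 =
          \<rho> n * real (Suc n) powr (- \<beta>\<^sub>2)"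
        using eventually_gt_at_top[of 0]
        by eventually_elim (simp add: powr_divide powr_minus field_simps)
    qed
    have r2: "(\<lambda>n. \<rho> (Suc n) * real (Suc n) powr (- \<beta>\<^sub>2)) \<longlonglongrightarrow> \<xi>" using LIMSEQ_Suc[OF r0] .
    have "(\<lambda>n. q n * real n powr (- \<beta>\<^sub>2)) \<longlonglongrightarrow> y\<^sub>0" using q_lim[of "- \<beta>\<^sub>2"] by simp
    then have qa: "(\<lambda>n. \<bar>q (Suc n) * real (Suc n) powr (- \<beta>\<^sub>2)\<bar>) \<longlonglongrightarrow> \<bar>y\<^sub>0\<bar>"
      by (intro tendsto_rabs LIMSEQ_Suc[where f = "\<lambda>n. q n * real n powr (- \<beta>\<^sub>2)"])
    have "(\<lambda>n. \<bar>q (Suc n) * real (Suc n) powr (- \<beta>\<^sub>2)\<bar> -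
        (\<rho> (Suc n) * real (Suc n) powr (- \<beta>\<^sub>2) + \<rho> n * real (Suc n) powr (- \<beta>\<^sub>2))) \<longlonglongrightarrow> \<bar>y\<^sub>0\<bar> - (\<xi> + \<xi>)"
      by (intro tendsto_diff tendsto_add qa r1 r2)
    from order_tendstoD(1)[OF this, of 0]
    have e1: "\<forall>\<^sub>F n in sequentially. \<bar>q (Suc n)\<bar> \<ge> \<rho> (Suc n) + \<rho> n"
      using \<xi> by (auto elim!: eventually_mono simp: abs_mult distrib_right[symmetric])
    have "(\<lambda>n. \<bar>q (Suc n) * real (Suc n) powr (- \<beta>\<^sub>2)\<bar> - 2 * (\<rho> (Suc n) * real (Suc n) powr (- \<beta>\<^sub>2)))
        \<longlonglongrightarrow> \<bar>y\<^sub>0\<bar> - 2 * \<xi>"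
      by (intro tendsto_diff tendsto_mult tendsto_const qa r2)
    from order_tendstoD(1)[OF this, of 0]
    have e2: "\<forall>\<^sub>F n in sequentially. \<bar>q (Suc n)\<bar> \<ge> 2 * \<rho> (Suc n)"
      using \<xi> by (auto elim!: eventually_mono simp: abs_mult mult.assoc[symmetric])
    obtain N where "\<And>n. n \<ge> N \<Longrightarrow> \<bar>q (Suc n)\<bar> \<ge> \<rho> (Suc n) + \<rho> n \<and> \<bar>q (Suc n)\<bar> \<ge> 2 * \<rho> (Suc n)"
      using eventually_conj[OF e1 e2] by (auto simp: eventually_sequentially)
    then show ?thesis by (intro not_ell2_of_dominant_diagonal[of N]) auto
  qed
  have \<rho>_le: "\<forall>\<^sub>F k in sequentially. \<rho> k \<le> real k powr \<beta>\<^sub>1 * b" if "b > x\<^sub>0" for b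
    using assms(6) order_tendstoD(2)[OF X(2) that]
    by eventually_elim (simp add: mult_left_mono)
  have carl: "sol \<i> \<notin> ell2" if "\<beta>\<^sub>1 \<le> 1"
  proof -
    obtain N where N: "\<And>k. k \<ge> N \<Longrightarrow> \<rho> k \<le> real k powr \<beta>\<^sub>1 * (x\<^sub>0 + 1)"
      using \<rho>_le[of "x\<^sub>0 + 1"] by (auto simp: eventually_sequentially)
    have "\<rho> k \<le> (x\<^sub>0 + 1) * real k" if k: "k \<ge> max N 1" for k
    proof -
      have "real k powr \<beta>\<^sub>1 \<le> real k powr 1" using k \<open>\<beta>\<^sub>1 \<le> 1\<close> by (intro powr_mono) auto
      then have "real k powr \<beta>\<^sub>1 * (x\<^sub>0 + 1) \<le> real k * (x\<^sub>0 + 1)" using k assms(3) by (intro mult_right_mono) auto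
      then show ?thesis using N[of k] k by (simp add: mult.commute)
    qed
    then show ?thesis by (intro carleman[of "max N 1"]) auto
  qed
  have circle: "sol \<i> \<in> ell2 \<and> (\<forall>A. canonical_extension \<rho> q A \<longrightarrow>
        convergence_exponent (spectrum A) = ereal (1 / \<beta>\<^sub>1) \<and>
        ereal ((\<beta>\<^sub>1 - 1) / \<beta>\<^sub>1 * (1 / x\<^sub>0) powr (1 / \<beta>\<^sub>1)) \<le> upper_density (spectrum A) (1 / \<beta>\<^sub>1) \<and>
        upper_density (spectrum A) (1 / \<beta>\<^sub>1)
          \<le> ereal (exp 1 * (\<beta>\<^sub>1 / (\<beta>\<^sub>1 - 1)) * (a / x\<^sub>0) powr (1 / \<beta>\<^sub>1)))"
    if hyp: "\<beta>\<^sub>1 \<ge> \<beta>\<^sub>2" "\<beta>\<^sub>1 = \<beta>\<^sub>2 \<longrightarrow> 2 * x\<^sub>0 > \<bar>y\<^sub>0\<bar>" "\<beta>\<^sub>1 > 1"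
  proof -
    \<comment> \<open>The limit of the scaled diagonal, so that c is the limiting discriminant in
      both cases.\<close>
    define \<eta> where "\<eta> = y\<^sub>0 * (if \<beta>\<^sub>1 = \<beta>\<^sub>2 then 1 else 0)"
    define c where "c = x\<^sub>0\<^sup>2 - \<eta>\<^sup>2 / 4"
    define \<alpha> where "\<alpha> n = \<rho> n * (real n powr (- \<beta>\<^sub>1 / 2) * real (Suc n) powr (- \<beta>\<^sub>1 / 2))" for n
    define \<gamma> where "\<gamma> n = q n * real n powr (- \<beta>\<^sub>1)" for n
    \<comment> \<open>The geometric mean of the powers at n and n + 1 leaves a factor increasing to
      1, hence of bounded variation.\<close>
    have \<alpha>_eq: "\<forall>\<^sub>F n in sequentially. ?X n * (real n / real (Suc n)) powr (\<beta>\<^sub>1 / 2) = \<alpha> n"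
      using assms(6) eventually_gt_at_top[of 0]
    proof eventually_elim
      case (elim n)
      have "real n powr \<beta>\<^sub>1 * real n powr (- \<beta>\<^sub>1 / 2) = real n powr (\<beta>\<^sub>1 / 2)" by (simp add: powr_add[symmetric])
      moreover have "(real n / real (Suc n)) powr (\<beta>\<^sub>1 / 2) = real n powr (\<beta>\<^sub>1 / 2) * real (Suc n) powr (- \<beta>\<^sub>1 / 2)"
        by (simp add: powr_divide powr_minus_divide)
      ultimately show ?case unfolding \<alpha>_def elim(1) by (simp add: mult_ac)
    qed
    have "bv (\<lambda>n. (real n / real (Suc n)) powr (\<beta>\<^sub>1 / 2))"
    proof (rule bv_of_mono_bounded[of 0])
      fix n :: nat
      show "(real n / real (Suc n)) powr (\<beta>\<^sub>1 / 2) \<le> (real (Suc n) / real (Suc (Suc n))) powr (\<beta>\<^sub>1 / 2)"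
        using hyp(3) by (intro powr_mono2) (auto simp: field_simps)
      have "(real n / real (Suc n)) powr (\<beta>\<^sub>1 / 2) \<le> 1 powr (\<beta>\<^sub>1 / 2)" using hyp(3) by (intro powr_mono2) auto
      then show "\<bar>(real n / real (Suc n)) powr (\<beta>\<^sub>1 / 2)\<bar> \<le> 1" by simp
    qed
    then have bv_\<alpha>: "bv \<alpha>" by (rule bv_cong_eventually[OF bv_mult[OF X(1)] \<alpha>_eq])
    have "(\<lambda>n. (real n / real (Suc n)) powr (\<beta>\<^sub>1 / 2)) \<longlonglongrightarrow> 1" by real_asymp
    from Lim_transform_eventually[OF tendsto_mult[OF X(2) this] \<alpha>_eq] have \<alpha>_lim: "\<alpha> \<longlonglongrightarrow> x\<^sub>0" by simp
    \<comment> \<open>The sign makes the sequence increasing from 1 on; at 0 monotonicity fails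
      because \<open>0 powr b\<close> is 0.\<close>
    have "bv (\<lambda>n. - (real n powr (\<beta>\<^sub>2 + - \<beta>\<^sub>1)))"
    proof (rule bv_of_mono_bounded[of 1])
      fix n :: nat
      show "- (real n powr (\<beta>\<^sub>2 + - \<beta>\<^sub>1)) \<le> - (real (Suc n) powr (\<beta>\<^sub>2 + - \<beta>\<^sub>1))" if "n \<ge> 1"
        using that hyp(1) by (auto intro!: powr_mono2')
      have "real n powr (\<beta>\<^sub>2 + - \<beta>\<^sub>1) \<le> 1"
      proof (cases "n = 0")
        case False
        then have "real n powr (\<beta>\<^sub>2 + - \<beta>\<^sub>1) \<le> 1 powr (\<beta>\<^sub>2 + - \<beta>\<^sub>1)" using hyp(1) by (intro powr_mono2') auto
        then show ?thesis by simp
      qed simp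
      then show "\<bar>- (real n powr (\<beta>\<^sub>2 + - \<beta>\<^sub>1))\<bar> \<le> 1" by simp
    qed
    from bv_mult[OF bv_const[of "-1"] this] have "bv (\<lambda>n. real n powr (\<beta>\<^sub>2 + - \<beta>\<^sub>1))" by simp
    then have bv_\<gamma>: "bv \<gamma>"
      unfolding \<gamma>_def[abs_def] by (rule bv_cong_eventually[OF bv_mult[OF Y(1)] q_scaled])
    have "\<eta> = y\<^sub>0 * (if \<beta>\<^sub>2 + - \<beta>\<^sub>1 = 0 then 1 else 0)" by (simp add: \<eta>_def)
    then have \<gamma>_lim: "\<gamma> \<longlonglongrightarrow> \<eta>" using q_lim[of "- \<beta>\<^sub>1"] hyp(1) by (simp only: \<gamma>_def[abs_def])
    have c_lim: "(\<lambda>n. (\<alpha> n)\<^sup>2 - (\<gamma> n)\<^sup>2 / 4) \<longlonglongrightarrow> c"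
      unfolding c_def by (intro tendsto_intros \<alpha>_lim \<gamma>_lim) simp
    have c_pos: "c > 0"
    proof -
      have "\<bar>\<eta>\<bar> < 2 * x\<^sub>0" using hyp assms(3) by (auto simp: \<eta>_def)
      then have "\<bar>\<eta>\<bar>\<^sup>2 < (2 * x\<^sub>0)\<^sup>2" by (intro power_strict_mono) auto
      then show ?thesis by (simp add: c_def power_mult_distrib)
    qed
    have def_\<alpha>: "\<alpha> \<equiv> \<lambda>n. \<rho> n * (real n powr (- \<beta>\<^sub>1 / 2) * real (Suc n) powr (- \<beta>\<^sub>1 / 2))"
      by (rule eq_reflection) (rule ext, rule \<alpha>_def)
    have def_\<gamma>: "\<gamma> \<equiv> \<lambda>n. q n * real n powr (- \<beta>\<^sub>1)"
      by (rule eq_reflection) (rule ext, rule \<gamma>_def)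
    interpret E: elliptic_jacobi \<rho> q \<beta>\<^sub>1 c \<alpha> \<gamma>
    proof -
      show "elliptic_jacobi \<rho> q \<beta>\<^sub>1 c"
        by (unfold_locales; fact hyp(3) c_pos bv_\<alpha>[unfolded def_\<alpha>] bv_\<gamma>[unfolded def_\<gamma>]
            c_lim[unfolded def_\<alpha> def_\<gamma>])
    qed (fact def_\<alpha>, fact def_\<gamma>)
    have a_eq: "1 / sqrt c = a / x\<^sub>0" "a > 0"
    proof -
      \<comment> \<open>Then c = x_0^2 t and a = t^(-1/2); for \<beta>_1 > \<beta>_2 this is t = 1,
        matching a = 1.\<close>
      define t where "t = 1 - \<eta>\<^sup>2 / (4 * x\<^sub>0\<^sup>2)"
      have ct: "c = x\<^sub>0\<^sup>2 * t" using assms(3) by (simp add: c_def t_def field_simps)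
      then have t: "t > 0" using c_pos by (simp add: zero_less_mult_iff)
      have "a = t powr (- 1 / 2)" using hyp(1) by (auto simp: assms(9) t_def \<eta>_def)
      then have a: "a = 1 / sqrt t" using t by (simp add: powr_minus_divide powr_half_sqrt)
      then show "a > 0" using t by simp
      show "1 / sqrt c = a / x\<^sub>0" using a assms(3) by (simp add: ct real_sqrt_mult)
    qed
    have "sol \<i> \<in> ell2" by (rule E.sol_i_ell2)
    moreover note E.spectrum_density[OF _ a_eq assms(3) \<rho>_le]
    ultimately show ?thesis by simp
  qed
  show ?thesis
  proof (intro conjI impI; (elim conjE)?)
    assume "\<beta>\<^sub>1 \<le> \<beta>\<^sub>2" "\<beta>\<^sub>1 = \<beta>\<^sub>2 \<longrightarrow> 2 * x\<^sub>0 < \<bar>y\<^sub>0\<bar>"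
    then show "limit_point \<rho> q" by (intro limit_point_of_not_ell2 point)
  next
    assume "\<beta>\<^sub>2 \<le> \<beta>\<^sub>1" "\<beta>\<^sub>1 = \<beta>\<^sub>2 \<longrightarrow> \<bar>y\<^sub>0\<bar> < 2 * x\<^sub>0"
    then show "limit_circle \<rho> q \<longleftrightarrow> 1 < \<beta>\<^sub>1" using circle carl limit_circle_iff by (cases "\<beta>\<^sub>1 \<le> 1") auto
  next
    assume hyp: "\<beta>\<^sub>1 \<le> \<beta>\<^sub>2 \<and> (\<beta>\<^sub>1 = \<beta>\<^sub>2 \<longrightarrow> 2 * x\<^sub>0 < \<bar>y\<^sub>0\<bar>) \<or>
      \<beta>\<^sub>2 \<le> \<beta>\<^sub>1 \<and> (\<beta>\<^sub>1 = \<beta>\<^sub>2 \<longrightarrow> \<bar>y\<^sub>0\<bar> < 2 * x\<^sub>0)" and "limit_circle \<rho> q"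
    then have "sol \<i> \<in> ell2" by (simp add: limit_circle_iff)
    \<comment> \<open>Limit circle excludes both the assumptions of (i) and \<beta>_1 \<le> 1, which
      leaves exactly the hypotheses of \<open>circle\<close>.\<close>
    then have "\<not> \<beta>\<^sub>1 \<le> 1" "\<not> (\<beta>\<^sub>1 \<le> \<beta>\<^sub>2 \<and> (\<beta>\<^sub>1 = \<beta>\<^sub>2 \<longrightarrow> 2 * x\<^sub>0 < \<bar>y\<^sub>0\<bar>))" using carl point by blast+
    with hyp circle show "\<forall>A. canonical_extension \<rho> q A \<longrightarrow>
        convergence_exponent (spectrum A) = ereal (1 / \<beta>\<^sub>1) \<and>
        ereal ((\<beta>\<^sub>1 - 1) / \<beta>\<^sub>1 * (1 / x\<^sub>0) powr (1 / \<beta>\<^sub>1)) \<le> upper_density (spectrum A) (1 / \<beta>\<^sub>1) \<and>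
        upper_density (spectrum A) (1 / \<beta>\<^sub>1)
          \<le> ereal (exp 1 * (\<beta>\<^sub>1 / (\<beta>\<^sub>1 - 1)) * (a / x\<^sub>0) powr (1 / \<beta>\<^sub>1))"
      by (metis not_le)
  qed
qed

end
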